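(* Let $d\ge3$, $e\in\{2,\ldots,d-1\}$, $1>a_{e+1}\ge\ldots\ge a_d>0$, $\beta>-1$, and $$E:=\Big\{z\in\mathbb R^d:z_1^2+\ldots+z_e^2+\Big(\frac{z_{e+1}}{a_{e+1}}\Big)^2+\ldots+\Big(\frac{z_d}{a_d}\Big)^2\le1\Big\},\qquad\Sigma:=\mathrm{diag}(1,\ldots,1,a_{e+1}^2,\ldots,a_d^2).$$ Let $Z_1,Z_2,\ldots$ be i.i.d. with density $$f(z)=\frac{\Gamma(\frac d2+\beta+1)}{\Gamma(\beta+1)\pi^{d/2}\prod_{i=e+1}^da_i}\big(1-z^\top\Sigma^{-1}z\big)^\beta\,\mathbf 1\{z\in\mathrm{int}(E)\},$$ and $M_n:=\max_{1\le i,j\le n}|Z_i-Z_j|$. Then, for each $t\ge0$, $$G(t)\le\liminf_{n\to\infty}\mathbb P\big(b_n(2-M_n)\le t\big)\le\limsup_{n\to\infty}\mathbb P\big(b_n(2-M_n)\le t\big)\le G\Big(\frac t{1-a_{e+1}^2}\Big),$$ where $b_n$ and $G$ are the sequence and function defined in the context.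
   Context: $|\cdot|$ is the Euclidean norm and $\omega_e$ denotes the volume of the $e$-dimensional unit ball. Define $$a:=\frac{\Gamma(\frac d2+\beta+1)}{\Gamma(\frac{d-e}2+\beta+2)}\cdot\pi^{-e/2}\cdot e\cdot\omega_e\cdot2^{\frac{d-e}2+\beta},\qquad\alpha:=\frac{d-e}2+\beta+1,$$ $$\sigma:=\frac{2^{e-2}\,\Gamma(\frac e2)\,a^2\,\Gamma(\alpha+1)^2}{\sqrt\pi\,\Gamma(\frac{e+1}2+2\alpha)},\qquad b_n:=\Big(\frac\sigma2\Big)^{\frac2{2d-e+4\beta+3}}n^{\frac4{2d-e+4\beta+3}}\quad(n\ge1),$$ $$G(t):=1-\exp\Big(-t^{\frac{2d-e+4\beta+3}2}\Big),\quad t\ge0.$$ *)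

theory Defs
  imports "HOL-Probability.Probability"
begin

text \<open>
  Vectors live in \<open>real ^ 'd\<close>, so the dimension is \<open>CARD('d)\<close>. A bijection
  \<open>\<nu> :: 'd \<Rightarrow> nat\<close> onto \<open>{1..CARD('d)}\<close> numbers the coordinates: the entry \<open>z $ k\<close> is the
  coordinate of \<open>z\<close> with number \<open>\<nu> k\<close>. The semi-axes are \<open>a (e+1), \<dots>, a d\<close>; values of \<open>a\<close>
  at other indices are irrelevant.
\<close>

definition ellipsoid :: "('d::finite \<Rightarrow> nat) \<Rightarrow> nat \<Rightarrow> (nat \<Rightarrow> real) \<Rightarrow> (real ^ 'd) set" where
  "ellipsoid \<nu> e a =
     {z. (\<Sum>k | \<nu> k \<in> {1..e}. (z $ k)\<^sup>2)
         + (\<Sum>k | \<nu> k \<in> {e+1..CARD('d)}. (z $ k / a (\<nu> k))\<^sup>2) \<le> 1}"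

definition Sigma_mat :: "('d::finite \<Rightarrow> nat) \<Rightarrow> nat \<Rightarrow> (nat \<Rightarrow> real) \<Rightarrow> real ^ 'd ^ 'd" where
  "Sigma_mat \<nu> e a =
     (\<chi> k l. if k = l then (if \<nu> k \<le> e then 1 else (a (\<nu> k))\<^sup>2) else 0)"

definition pearson_density ::
  "('d::finite \<Rightarrow> nat) \<Rightarrow> nat \<Rightarrow> (nat \<Rightarrow> real) \<Rightarrow> real \<Rightarrow> real ^ 'd \<Rightarrow> real" where
  "pearson_density \<nu> e a \<beta> z =
     Gamma (real CARD('d) / 2 + \<beta> + 1)
       / (Gamma (\<beta> + 1) * pi powr (real CARD('d) / 2) * (\<Prod>i=e+1..CARD('d). a i))
     * (1 - z \<bullet> (matrix_inv (Sigma_mat \<nu> e a) *v z)) powr \<beta>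
     * indicator (interior (ellipsoid \<nu> e a)) z"

definition max_dist :: "(nat \<Rightarrow> 'w \<Rightarrow> 'v::real_normed_vector) \<Rightarrow> nat \<Rightarrow> 'w \<Rightarrow> real" where
  "max_dist Z n \<omega> = Max {norm (Z i \<omega> - Z j \<omega>) | i j. i \<in> {1..n} \<and> j \<in> {1..n}}"

definition a_const :: "nat \<Rightarrow> nat \<Rightarrow> real \<Rightarrow> real" where
  "a_const d e \<beta> =
     Gamma (real d / 2 + \<beta> + 1) / Gamma ((real d - real e) / 2 + \<beta> + 2)
     * pi powr (- real e / 2) * real e * unit_ball_vol (real e)
     * 2 powr ((real d - real e) / 2 + \<beta>)"

definition alpha_const :: "nat \<Rightarrow> nat \<Rightarrow> real \<Rightarrow> real" where
  "alpha_const d e \<beta> = (real d - real e) / 2 + \<beta> + 1"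

definition sigma_const :: "nat \<Rightarrow> nat \<Rightarrow> real \<Rightarrow> real" where
  "sigma_const d e \<beta> =
     2 powr (real e - 2) * Gamma (real e / 2) * (a_const d e \<beta>)\<^sup>2
       * (Gamma (alpha_const d e \<beta> + 1))\<^sup>2
     / (sqrt pi * Gamma ((real e + 1) / 2 + 2 * alpha_const d e \<beta>))"

definition b_seq :: "nat \<Rightarrow> nat \<Rightarrow> real \<Rightarrow> nat \<Rightarrow> real" where
  "b_seq d e \<beta> n =
     (sigma_const d e \<beta> / 2) powr (2 / (2 * real d - real e + 4 * \<beta> + 3))
     * real n powr (4 / (2 * real d - real e + 4 * \<beta> + 3))"

definition G_fun :: "nat \<Rightarrow> nat \<Rightarrow> real \<Rightarrow> real \<Rightarrow> real" where
  "G_fun d e \<beta> t = 1 - exp (- (t powr ((2 * real d - real e + 4 * \<beta> + 3) / 2)))"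

end

theory Submission
  imports Defs
begin

text \<open>
  Rescaling the short axes turns the sample into points \<open>U i\<close> with the rotation invariant density
  proportional to \<open>(1 - |u|^2)^\<beta>\<close> on the unit ball. Let \<open>D\<close> be the distance of two
  points after projection to the first \<open>e\<close> coordinates. Then \<open>|Z i - Z j| \<ge> D\<close>, and since the
  points lie in the unit ball, \<open>4 - |Z i - Z j|^2 \<ge> (1 - A) (4 - D^2)\<close> with \<open>A\<close> the square of the
  largest short semi-axis. Hence both bounds follow once \<open>D\<close> is understood: the
  number of pairs with \<open>D \<ge> 2 - s\<close> is asymptotically Poisson.

  For the Poisson limit let \<open>W\<close> be the number of such pairs, with mean \<open>l\<close>, and \<open>\<phi> u = E (u^W)\<close>.
  By local dependence \<open>\<phi>' - l \<phi>\<close> is small on \<open>[0, 1]\<close>, so the mean value theorem applied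
  to \<open>\<phi> u * exp (- l u)\<close> gives \<open>P (W = 0) \<approx> exp (- l)\<close>. The pair probability is computed in the
  independent variables \<open>\<rho> = |P U|^2\<close> (beta distributed) and the cosine \<open>c\<close> of the angle. With
  \<open>\<rho> = 1 - 2 s x\<close> and \<open>c = 1 - s w\<close> (the sign of \<open>c\<close> being flipped), dominated convergence
  leads to a Dirichlet integral over \<open>x + y + w / 2 \<le> 1\<close>.
\<close>


section \<open>Poisson approximation for pairs of i.i.d. points\<close>

text \<open>The Poisson limit meets one obstacle: pairs with a common point are dependent, there are
  of order n^3 combinations of two such pairs, and a point near the unit sphere has more distant
  partners than a typical one. A bound h, uniform over the fixed point, on the probability of a
  distant partner controls them. The pair probability has order s^\<kappa> with \<kappa> = 2
  \<alpha> + (e - 1) / 2, where \<alpha> = (d - e) / 2 + \<beta> + 1: each squared norm close to 1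
  costs s^\<alpha>, and the angle close to \<pi> costs s^((e - 1) / 2). With one point fixed, h has
  order s^(\<alpha> + (e - 1) / 2) = s^(\<kappa> / 2 + (e - 1) / 4). As n^2 s^\<kappa> stays
  bounded, n h is at most of order s^((e - 1) / 4), which tends to 0 because e > 1; this removes the
  error term. The sequence b_n makes the mean number of distant pairs tend to t^\<kappa> for s = t /
  b_n. The passage from Z to the projection is deterministic for points of the ball, and its factor
  1 - A is the whole gap between the two bounds.\<close>

lemma (in prob_space) indep_vars_joint_distr:
  assumes ind: "indep_vars (\<lambda>_. N) X I" and ij: "i \<in> I" "j \<in> I" "i \<noteq> j"
  shows "distr M (N \<Otimes>\<^sub>M N) (\<lambda>\<omega>. (X i \<omega>, X j \<omega>)) = distr M N (X i) \<Otimes>\<^sub>M distr M N (X j)"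
proof -
  have "indep_var N (X i) N (X j)"
    using indep_var_compose[OF indep_var_restrict[OF ind, of "{i}" "{j}"], of "\<lambda>f. f i" N "\<lambda>f. f j" N] ij
    by (simp add: comp_def)
  then show ?thesis
    by (simp add: indep_var_distribution_eq)
qed

text \<open>A random graph on the sample points, with \<open>E\<close> as adjacency relation. The
  bound \<open>h\<close> is uniform over the fixed endpoint of an edge; the average edge probability
  alone would not control two edges that meet in a point.\<close>

locale iid_relation = prob_space M for M :: "'w measure" +
  fixes X :: "nat \<Rightarrow> 'w \<Rightarrow> 'b" and N D :: "'b measure" and E :: "('b \<times> 'b) set" and h :: real
  assumes indep: "indep_vars (\<lambda>_. N) X {1..}"
    and law: "\<And>i. i \<ge> 1 \<Longrightarrow> distr M N (X i) = D"
    and E_sets: "E \<in> sets (N \<Otimes>\<^sub>M N)"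
    and E_sym: "\<And>x y. (x, y) \<in> E \<Longrightarrow> (y, x) \<in> E"
    and slice_le: "\<And>x. x \<in> space N \<Longrightarrow> measure D (Pair x -` E) \<le> h"
begin

lemma X_measurable: "i \<ge> 1 \<Longrightarrow> X i \<in> measurable M N"
  using indep unfolding indep_vars_def by auto

lemma prob_space_D: "prob_space D"
  using law[of 1] prob_space_distr[OF X_measurable[of 1]] by simp

lemma sets_D: "sets D = sets N"
  using law[of 1] by (metis order_refl sets_distr)

lemma space_D: "space D = space N"
  by (rule sets_eq_imp_space_eq[OF sets_D])

definition edge :: "nat \<Rightarrow> nat \<Rightarrow> 'w \<Rightarrow> real" where
  "edge i j \<omega> = indicator E (X i \<omega>, X j \<omega>)"

definition p :: real where "p = measure (D \<Otimes>\<^sub>M D) E"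

lemma edge_measurable [measurable]:
  assumes "i \<ge> 1" "j \<ge> 1"
  shows "edge i j \<in> borel_measurable M"
proof -
  have [measurable]: "X i \<in> measurable M N" "X j \<in> measurable M N"
    using X_measurable assms by auto
  have [measurable]: "E \<in> sets (N \<Otimes>\<^sub>M N)" by (rule E_sets)
  show ?thesis unfolding edge_def by measurable
qed

lemma edge_01: "edge i j \<omega> = 0 \<or> edge i j \<omega> = 1"
  by (simp add: edge_def indicator_def)

lemma edge_bounds: "0 \<le> edge i j \<omega>" "edge i j \<omega> \<le> 1"
  by (simp_all add: edge_def indicator_def)

lemma edge_sym: "edge i j \<omega> = edge j i \<omega>"
  using E_sym by (auto simp add: edge_def indicator_def)

lemma edge_integrable: "i \<ge> 1 \<Longrightarrow> j \<ge> 1 \<Longrightarrow> integrable M (edge i j)"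
  by (rule integrable_const_bound[where B=1]) (auto simp: edge_bounds)

lemma expectation_edge:
  assumes "i \<ge> 1" "j \<ge> 1" "i \<noteq> j"
  shows "expectation (edge i j) = p"
proof -
  have [measurable]: "X i \<in> measurable M N" "X j \<in> measurable M N"
    using X_measurable assms by auto
  have [measurable]: "E \<in> sets (N \<Otimes>\<^sub>M N)" by (rule E_sets)
  have J: "distr M (N \<Otimes>\<^sub>M N) (\<lambda>\<omega>. (X i \<omega>, X j \<omega>)) = D \<Otimes>\<^sub>M D"
    using indep_vars_joint_distr[OF indep, of i j] assms law by simp
  have "expectation (edge i j) = integral\<^sup>L (distr M (N \<Otimes>\<^sub>M N) (\<lambda>\<omega>. (X i \<omega>, X j \<omega>))) (indicator E)"
    unfolding edge_def by (subst integral_distr) auto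
  also have "\<dots> = p"
    unfolding J p_def using sets.sets_into_space[OF E_sets]
    by (simp add: space_pair_measure space_D Int_absorb1 Int_absorb2)
  finally show ?thesis .
qed

lemma p_nonneg: "0 \<le> p" by (simp add: p_def)

lemma slice_sets: "Pair x -` E \<in> sets D"
  using sets_Pair1[OF E_sets] sets_D by blast

lemma emeasure_pair_D:
  assumes "A \<in> sets (D \<Otimes>\<^sub>M D)"
  shows "emeasure (D \<Otimes>\<^sub>M D) A = (\<integral>\<^sup>+ x. emeasure D (Pair x -` A) \<partial>D)"
proof -
  interpret D: prob_space D by (rule prob_space_D)
  show ?thesis by (rule D.emeasure_pair_measure_alt[OF assms])
qed

text \<open>\<open>p\<close> is the average of the slice measures over the first point, and each of
  them is at most \<open>h\<close>. Together with \<open>p_nonneg\<close> this also supplies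
  \<open>0 \<le> h\<close> later on.\<close>

lemma p_le: "p \<le> h"
proof -
  interpret D: prob_space D by (rule prob_space_D)
  interpret DD: pair_prob_space D D ..
  have h0: "0 \<le> h"
  proof -
    obtain x where "x \<in> space N" using D.not_empty space_D by auto
    then show ?thesis using slice_le[of x] measure_nonneg order_trans by blast
  qed
  have EE: "E \<in> sets (D \<Otimes>\<^sub>M D)"
    using E_sets sets_pair_measure_cong[OF sets_D sets_D] by simp
  have "emeasure (D \<Otimes>\<^sub>M D) E = (\<integral>\<^sup>+ x. emeasure D (Pair x -` E) \<partial>D)"
    by (rule emeasure_pair_D[OF EE])
  also have "\<dots> \<le> (\<integral>\<^sup>+ x. ennreal h \<partial>D)"
    by (intro nn_integral_mono) (use slice_le space_D in \<open>auto simp: D.emeasure_eq_measure intro!: ennreal_leI\<close>)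
  also have "\<dots> = ennreal h"
    by (simp add: D.emeasure_space_1)
  finally show ?thesis
    unfolding p_def using h0 by (simp add: DD.emeasure_eq_measure)
qed

text \<open>The point with index \<open>k\<close> is independent of those with indices
  \<open>i\<close> and \<open>j\<close>, and it is joined to the then fixed \<open>X i\<close> with
  probability at most \<open>h\<close>. Independence enters through the joint law of the
  restrictions of the family to \<open>{i, j}\<close> and to \<open>{k}\<close>.\<close>

lemma expectation_edge_edge:
  assumes ijk: "i \<ge> 1" "j \<ge> 1" "k \<ge> 1" "i \<noteq> j" "i \<noteq> k" "j \<noteq> k"
  shows "expectation (\<lambda>\<omega>. edge i j \<omega> * edge i k \<omega>) \<le> p * h"
proof -
  interpret D: prob_space D by (rule prob_space_D)
  have E [measurable]: "E \<in> sets (N \<Otimes>\<^sub>M N)" by (rule E_sets)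
  have Xm [measurable]: "X i \<in> measurable M N" "X j \<in> measurable M N" "X k \<in> measurable M N"
    using X_measurable ijk by auto
  have h0: "0 \<le> h"
    using p_le p_nonneg by linarith
  define R where "R = (\<lambda>A \<omega>. restrict (\<lambda>i. X i \<omega>) A)"
  define L where "L = (\<lambda>A. distr M (\<Pi>\<^sub>M i\<in>A. N) (R A))"
  have Rm [measurable]: "R A \<in> measurable M (\<Pi>\<^sub>M i\<in>A. N)" if "A \<subseteq> {1..}" for A
    unfolding R_def using that X_measurable by (intro measurable_restrict) auto
  have Rm1 [measurable]: "R {i,j} \<in> measurable M (\<Pi>\<^sub>M i\<in>{i,j}. N)"
    and Rm2 [measurable]: "R {k} \<in> measurable M (\<Pi>\<^sub>M i\<in>{k}. N)"
    using ijk by (auto intro: Rm)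
  interpret L1: prob_space "L {i,j}" unfolding L_def by (rule prob_space_distr) (use Rm ijk in auto)
  interpret L2: prob_space "L {k}" unfolding L_def by (rule prob_space_distr) (use Rm ijk in auto)
  have J: "distr M ((\<Pi>\<^sub>M i\<in>{i,j}. N) \<Otimes>\<^sub>M (\<Pi>\<^sub>M i\<in>{k}. N)) (\<lambda>\<omega>. (R {i,j} \<omega>, R {k} \<omega>)) = L {i,j} \<Otimes>\<^sub>M L {k}"
    using indep_var_restrict[OF indep, of "{i,j}" "{k}"] ijk
    unfolding indep_var_distribution_eq R_def L_def by auto
  define g where "g = (\<lambda>(f,z). indicator E (f i, f j) * indicator E (f i, z k) :: ennreal)"
  have gm [measurable]: "g \<in> borel_measurable ((\<Pi>\<^sub>M i\<in>{i,j}. N) \<Otimes>\<^sub>M (\<Pi>\<^sub>M i\<in>{k}. N))"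
    unfolding g_def by measurable
  have gm': "g \<in> borel_measurable (L {i,j} \<Otimes>\<^sub>M L {k})"
    using gm unfolding J[symmetric] by simp
  have EE: "E \<in> sets (D \<Otimes>\<^sub>M D)"
    using E_sets sets_pair_measure_cong[OF sets_D sets_D] by simp
  have "ennreal (expectation (\<lambda>\<omega>. edge i j \<omega> * edge i k \<omega>)) = (\<integral>\<^sup>+\<omega>. g (R {i,j} \<omega>, R {k} \<omega>) \<partial>M)"
  proof (subst nn_integral_eq_integral[symmetric])
    show "integrable M (\<lambda>\<omega>. edge i j \<omega> * edge i k \<omega>)"
      by (rule integrable_const_bound[where B=1])
         (use ijk in \<open>auto simp: edge_def indicator_def\<close>)
  qed (auto simp: edge_bounds g_def R_def edge_def indicator_def intro!: nn_integral_cong)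
  also have "\<dots> = (\<integral>\<^sup>+w. g w \<partial>(L {i,j} \<Otimes>\<^sub>M L {k}))"
    unfolding J[symmetric] by (subst nn_integral_distr) simp_all
  also have "\<dots> = (\<integral>\<^sup>+f. (\<integral>\<^sup>+z. g (f, z) \<partial>L {k}) \<partial>L {i,j})"
    using L2.nn_integral_fst[OF gm'] by simp
  also have "\<dots> \<le> (\<integral>\<^sup>+f. ennreal h * indicator E (f i, f j) \<partial>L {i,j})"
  proof (rule nn_integral_mono)
    fix f assume f: "f \<in> space (L {i,j})"
    then have fi: "f i \<in> space N" by (auto simp: L_def space_PiM)
    have "(\<integral>\<^sup>+z. g (f, z) \<partial>L {k}) = (\<integral>\<^sup>+\<omega>. indicator E (f i, f j) * indicator (Pair (f i) -` E) (X k \<omega>) \<partial>M)"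
    proof -
      have "(\<lambda>z. g (f, z)) \<in> borel_measurable (\<Pi>\<^sub>M i\<in>{k}. N)"
        using f by (simp add: L_def)
      then show ?thesis
        unfolding L_def by (subst nn_integral_distr) (auto simp: g_def R_def indicator_def intro!: nn_integral_cong Rm2[unfolded R_def])
    qed
    also have "\<dots> = (\<integral>\<^sup>+z. indicator E (f i, f j) * indicator (Pair (f i) -` E) z \<partial>distr M N (X k))"
      by (subst nn_integral_distr) (use sets_Pair1[OF E_sets] in \<open>auto intro!: borel_measurable_times_ennreal borel_measurable_indicator\<close>)
    also have "\<dots> = (\<integral>\<^sup>+z. indicator E (f i, f j) * indicator (Pair (f i) -` E) z \<partial>D)"
      using law ijk by simp
    also have "\<dots> = indicator E (f i, f j) * emeasure D (Pair (f i) -` E)"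
      by (subst nn_integral_cmult_indicator) (use slice_sets in auto)
    also have "\<dots> \<le> indicator E (f i, f j) * ennreal h"
      using slice_le[OF fi] by (intro mult_left_mono) (auto simp: D.emeasure_eq_measure intro!: ennreal_leI)
    finally show "(\<integral>\<^sup>+z. g (f, z) \<partial>L {k}) \<le> ennreal h * indicator E (f i, f j)" by (simp add: mult.commute)
  qed
  also have "\<dots> = (\<integral>\<^sup>+\<omega>. ennreal h * ennreal (edge i j \<omega>) \<partial>M)"
    unfolding L_def by (subst nn_integral_distr) (auto simp: R_def edge_def intro!: nn_integral_cong Rm1[unfolded R_def] split: split_indicator)
  also have "\<dots> = ennreal h * (\<integral>\<^sup>+\<omega>. ennreal (edge i j \<omega>) \<partial>M)"
    by (rule nn_integral_cmult) (use ijk in auto)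
  also have "(\<integral>\<^sup>+\<omega>. ennreal (edge i j \<omega>) \<partial>M) = ennreal p"
    using expectation_edge[OF ijk(1,2,4)] edge_integrable[OF ijk(1,2)]
    by (subst nn_integral_eq_integral) (auto simp: edge_bounds)
  also have "ennreal h * ennreal p = ennreal (p * h)"
    using h0 p_nonneg by (simp add: ennreal_mult mult.commute)
  finally show ?thesis
    using h0 p_nonneg by (simp add: ennreal_le_iff)
qed


section \<open>Edge counts over sets of index pairs\<close>

definition cnt :: "(nat \<times> nat) set \<Rightarrow> 'w \<Rightarrow> nat" where
  "cnt S \<omega> = card {(i, j) \<in> S. (X i \<omega>, X j \<omega>) \<in> E}"

definition pairs :: "nat \<Rightarrow> (nat \<times> nat) set" where
  "pairs n = {(i, j). 1 \<le> i \<and> i < j \<and> j \<le> n}"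

lemma real_cnt:
  assumes "finite S"
  shows "real (cnt S \<omega>) = (\<Sum>(i,j)\<in>S. edge i j \<omega>)"
proof -
  have "(\<Sum>(i,j)\<in>S. edge i j \<omega>) = (\<Sum>x\<in>S. if x \<in> {(i, j) \<in> S. (X i \<omega>, X j \<omega>) \<in> E} then 1 else 0)"
    by (intro sum.cong) (auto simp: edge_def indicator_def)
  also have "\<dots> = real (cnt S \<omega>)"
    using assms by (subst sum.inter_restrict[symmetric]) (auto simp: cnt_def Int_def intro!: arg_cong[where f=card])
  finally show ?thesis by simp
qed

lemma cnt_le_card: "finite S \<Longrightarrow> cnt S \<omega> \<le> card S"
  unfolding cnt_def by (rule card_mono) auto

lemma cnt_Un_disjoint:
  "finite S \<Longrightarrow> finite T \<Longrightarrow> S \<inter> T = {} \<Longrightarrow> cnt (S \<union> T) \<omega> = cnt S \<omega> + cnt T \<omega>"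
proof -
  assume ST: "finite S" "finite T" "S \<inter> T = {}"
  have "real (cnt (S \<union> T) \<omega>) = real (cnt S \<omega>) + real (cnt T \<omega>)"
    unfolding real_cnt[OF ST(1)] real_cnt[OF ST(2)] real_cnt[OF finite_UnI[OF ST(1,2)]]
    by (rule sum.union_disjoint[OF ST])
  then show ?thesis by linarith
qed

lemma finite_pairs: "finite (pairs n)"
  by (rule finite_subset[of _ "{1..n} \<times> {1..n}"]) (auto simp: pairs_def)

lemma pairs_ge: "(i, j) \<in> pairs n \<Longrightarrow> 1 \<le> i \<and> 1 \<le> j \<and> i \<noteq> j"
  by (auto simp: pairs_def)

lemma cnt_measurable [measurable]:
  assumes "S \<subseteq> pairs n"
  shows "cnt S \<in> measurable M (count_space UNIV)"
proof -
  have fin: "finite S" using assms finite_pairs finite_subset by blast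
  have "(\<lambda>\<omega>. real (cnt S \<omega>)) \<in> borel_measurable M"
    unfolding real_cnt[OF fin] case_prod_beta
    by (intro borel_measurable_sum edge_measurable) (use assms in \<open>auto simp: pairs_def\<close>)
  then have "(\<lambda>\<omega>. nat \<lfloor>real (cnt S \<omega>)\<rfloor>) \<in> measurable M (count_space UNIV)"
    by measurable
  then show ?thesis by simp
qed

lemma cnt_integrable:
  assumes "S \<subseteq> pairs n"
  shows "integrable M (\<lambda>\<omega>. f (cnt S \<omega>) :: real)"
proof (rule integrable_const_bound)
  have fin: "finite S" using assms finite_pairs finite_subset by blast
  show "AE \<omega> in M. norm (f (cnt S \<omega>)) \<le> Max ((\<lambda>k. \<bar>f k\<bar>) ` {..card S})"
    by (intro AE_I2) (auto intro!: Max_ge cnt_le_card fin)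
  show "(\<lambda>\<omega>. f (cnt S \<omega>)) \<in> borel_measurable M"
    using cnt_measurable[OF assms] by measurable
qed

text \<open>The count takes finitely many values, so \<open>f\<close> may be arbitrary. It is used
  for \<open>u ^ k\<close> and for \<open>real k * u ^ (k - 1)\<close>, which exhibits the
  generating function and its derivative as polynomials.\<close>

lemma expectation_cnt:
  assumes "S \<subseteq> pairs n"
  shows "expectation (\<lambda>\<omega>. f (cnt S \<omega>) :: real) = (\<Sum>k\<le>card S. prob {\<omega>\<in>space M. cnt S \<omega> = k} * f k)"
proof -
  have fin: "finite S" using assms finite_pairs finite_subset by blast
  have [measurable]: "cnt S \<in> measurable M (count_space UNIV)" by (rule cnt_measurable[OF assms])
  have "f (cnt S \<omega>) = (\<Sum>k\<le>card S. indicator {\<omega>\<in>space M. cnt S \<omega> = k} \<omega> * f k)" if "\<omega> \<in> space M" for \<omega>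
  proof -
    have "(\<Sum>k\<le>card S. indicator {\<omega>\<in>space M. cnt S \<omega> = k} \<omega> * f k) = (\<Sum>k\<le>card S. if k = cnt S \<omega> then f k else 0)"
      using that by (intro sum.cong) (auto simp: indicator_def)
    then show ?thesis using cnt_le_card[OF fin, of \<omega>] by simp
  qed
  then have "expectation (\<lambda>\<omega>. f (cnt S \<omega>)) = expectation (\<lambda>\<omega>. \<Sum>k\<le>card S. indicator {\<omega>\<in>space M. cnt S \<omega> = k} \<omega> * f k)"
    by (intro Bochner_Integration.integral_cong) auto
  also have "\<dots> = (\<Sum>k\<le>card S. expectation (\<lambda>\<omega>. indicator {\<omega>\<in>space M. cnt S \<omega> = k} \<omega> * f k))"
    by (subst Bochner_Integration.integral_sum) (auto intro!: integrable_mult_left integrable_real_indicator simp: emeasure_eq_measure)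
  also have "\<dots> = (\<Sum>k\<le>card S. prob {\<omega>\<in>space M. cnt S \<omega> = k} * f k)"
    by (intro sum.cong refl) (auto simp: Int_def conj_commute)
  finally show ?thesis .
qed

text \<open>Index pairs are increasing, so two different pairs that meet share exactly one index.
  Symmetry of the edges brings it to the first place, where \<open>expectation_edge_edge\<close>
  applies.\<close>

lemma expectation_edge_edge_le:
  assumes "(i, j) \<in> pairs n" "(k, l) \<in> pairs n" "(i, j) \<noteq> (k, l)" "{i, j} \<inter> {k, l} \<noteq> {}"
  shows "expectation (\<lambda>\<omega>. edge i j \<omega> * edge k l \<omega>) \<le> p * h"
proof -
  consider "i = k" "j \<noteq> l" "i \<noteq> l" | "i = l" "j \<noteq> k" "i \<noteq> k" | "j = k" "i \<noteq> l" "j \<noteq> l" | "j = l" "i \<noteq> k" "j \<noteq> k"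
    using assms by (auto simp: pairs_def)
  then show ?thesis
  proof cases
    case 1 then show ?thesis using expectation_edge_edge[of i j l] assms by (auto simp: pairs_def)
  next
    case 2 then show ?thesis using expectation_edge_edge[of i j k] assms
      by (auto simp: pairs_def edge_sym[of k l])
  next
    case 3 then show ?thesis using expectation_edge_edge[of j i l] assms
      by (auto simp: pairs_def edge_sym[of i k])
  next
    case 4 then show ?thesis using expectation_edge_edge[of j i k] assms
      by (auto simp: pairs_def edge_sym[of i l] edge_sym[of k l])
  qed
qed

text \<open>The count over \<open>S\<close> is a function of the points with indices outside
  \<open>{i, j}\<close>, hence independent of the edge indicator.\<close>

lemma expectation_edge_power:
  assumes ij: "(i, j) \<in> pairs n" and S: "S \<subseteq> pairs n" "\<And>k l. (k, l) \<in> S \<Longrightarrow> {i, j} \<inter> {k, l} = {}"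
  shows "expectation (\<lambda>\<omega>. edge i j \<omega> * u ^ cnt S \<omega>) = p * expectation (\<lambda>\<omega>. u ^ cnt S \<omega>)"
proof -
  have fin: "finite S" using S finite_pairs finite_subset by blast
  have [measurable]: "E \<in> sets (N \<Otimes>\<^sub>M N)" by (rule E_sets)
  let ?B = "{1..n} - {i, j}"
  define f where "f = (\<lambda>x. indicator E (x i, x j) :: real)"
  define c where "c = (\<lambda>x::nat \<Rightarrow> 'b. \<Sum>(k,l)\<in>S. indicator E (x k, x l) :: real)"
  \<comment> \<open>The floor turns the real sum of indicators back into the natural number that
    serves as exponent.\<close>
  define g where "g = (\<lambda>x. u ^ nat \<lfloor>c x\<rfloor>)"
  have cm [measurable]: "c \<in> borel_measurable (\<Pi>\<^sub>M i\<in>?B. N)"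
    unfolding c_def case_prod_beta
  proof (intro borel_measurable_sum)
    fix x assume x: "x \<in> S"
    then have "fst x \<in> ?B" "snd x \<in> ?B" using S(1) S(2)[of "fst x" "snd x"] by (auto simp: pairs_def)
    then show "(\<lambda>y. indicat_real E (y (fst x), y (snd x))) \<in> borel_measurable (\<Pi>\<^sub>M i\<in>?B. N)"
      by measurable
  qed
  have "indep_var borel (f \<circ> (\<lambda>\<omega>. restrict (\<lambda>i. X i \<omega>) {i,j})) borel (g \<circ> (\<lambda>\<omega>. restrict (\<lambda>i. X i \<omega>) ?B))"
  proof (intro indep_var_compose[OF indep_var_restrict[OF indep]])
    show "f \<in> borel_measurable (\<Pi>\<^sub>M i\<in>{i, j}. N)" unfolding f_def by measurable
    show "g \<in> borel_measurable (\<Pi>\<^sub>M i\<in>?B. N)" unfolding g_def by measurable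
  qed (use ij in \<open>auto simp: pairs_def\<close>)
  moreover have "f \<circ> (\<lambda>\<omega>. restrict (\<lambda>i. X i \<omega>) {i,j}) = edge i j"
    by (auto simp: f_def edge_def)
  moreover have "g \<circ> (\<lambda>\<omega>. restrict (\<lambda>i. X i \<omega>) ?B) = (\<lambda>\<omega>. u ^ cnt S \<omega>)"
  proof
    fix \<omega>
    have "c (restrict (\<lambda>i. X i \<omega>) ?B) = (\<Sum>(k,l)\<in>S. edge k l \<omega>)"
      unfolding c_def
    proof (intro sum.cong refl)
      fix x assume x: "x \<in> S"
      then have "fst x \<in> ?B" "snd x \<in> ?B" using S(1) S(2)[of "fst x" "snd x"] by (auto simp: pairs_def)
      then show "(case x of (k, l) \<Rightarrow> indicat_real E ((\<lambda>i\<in>?B. X i \<omega>) k, (\<lambda>i\<in>?B. X i \<omega>) l)) = (case x of (k, l) \<Rightarrow> edge k l \<omega>)"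
        by (auto simp: edge_def split: prod.split)
    qed
    then show "(g \<circ> (\<lambda>\<omega>. restrict (\<lambda>i. X i \<omega>) ?B)) \<omega> = u ^ cnt S \<omega>"
      by (simp add: g_def real_cnt[OF fin, symmetric])
  qed
  ultimately have "indep_var borel (edge i j) borel (\<lambda>\<omega>. u ^ cnt S \<omega>)" by simp
  from indep_var_lebesgue_integral[OF this edge_integrable cnt_integrable[OF S(1)]]
  show ?thesis using expectation_edge[of i j] ij by (auto simp: pairs_def)
qed

text \<open>Both powers lie in \<open>[0, 1]\<close>, so they differ by at most 1, which suffices as
  soon as \<open>a\<close> is positive. In this form, dropping edges from the exponent is paid for
  by their number.\<close>

lemma power_diff_le_of_nat:
  fixes u :: real assumes "0 \<le> u" "u \<le> 1"
  shows "\<bar>u ^ (a + b) - u ^ b\<bar> \<le> real a"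
proof (cases "a = 0")
  case False
  have "0 \<le> u ^ (a+b)" "u^(a+b) \<le> 1" "0 \<le> u^b" "u^b \<le> 1" using assms by (auto intro: power_le_one)
  then show ?thesis using False by (auto simp: abs_le_iff)
qed simp

text \<open>Split the other pairs into \<open>B\<close>, those meeting \<open>{i, j}\<close>, and \<open>C\<close>, those
  independent of the pair \<open>(i, j)\<close>: dropping \<open>B\<close> and the pair itself from the count costs little.\<close>

lemma stein_term:
  assumes ij: "(i, j) \<in> pairs n" and u: "0 \<le> u" "u \<le> 1"
  shows "\<bar>expectation (\<lambda>\<omega>. edge i j \<omega> * u ^ (cnt (pairs n) \<omega> - 1)) - p * expectation (\<lambda>\<omega>. u ^ cnt (pairs n) \<omega>)\<bar>
     \<le> (8 * real n + 1) * p * h"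
proof -
  define B where "B = {(k, l) \<in> pairs n. (k, l) \<noteq> (i, j) \<and> {i, j} \<inter> {k, l} \<noteq> {}}"
  define C where "C = {(k, l) \<in> pairs n. {i, j} \<inter> {k, l} = {}}"
  have sub: "B \<subseteq> pairs n" "C \<subseteq> pairs n" "{(i,j)} \<subseteq> pairs n" "insert (i,j) B \<subseteq> pairs n"
    using ij by (auto simp: B_def C_def)
  have fin: "finite B" "finite C" using sub finite_subset[OF _ finite_pairs] by blast+
  have split: "pairs n = insert (i,j) B \<union> C" "insert (i,j) B \<inter> C = {}" "{(i,j)} \<inter> B = {}"
    using ij by (auto simp: B_def C_def)
  have W: "cnt (pairs n) \<omega> = cnt {(i,j)} \<omega> + cnt B \<omega> + cnt C \<omega>" for \<omega>
    using fin cnt_Un_disjoint[of "{(i,j)}" B \<omega>] cnt_Un_disjoint[of "insert (i,j) B" C \<omega>] split by simp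
  have c1: "real (cnt {(i,j)} \<omega>) = edge i j \<omega>" for \<omega> by (simp add: real_cnt)
  \<comment> \<open>On the event of an edge at \<open>(i, j)\<close> the \<open>- 1\<close> cancels
    exactly this edge; off the event both sides vanish.\<close>
  have e1: "edge i j \<omega> * u ^ (cnt (pairs n) \<omega> - 1) = edge i j \<omega> * u ^ (cnt B \<omega> + cnt C \<omega>)" for \<omega>
  proof (cases "edge i j \<omega> = 0")
    case False
    then have "cnt {(i,j)} \<omega> = 1" using c1[of \<omega>] edge_01[of i j \<omega>] by simp
    then show ?thesis using W[of \<omega>] by simp
  qed simp
  have ijge: "i \<ge> 1" "j \<ge> 1" "i \<noteq> j" using ij by (auto simp: pairs_def)
  have [measurable]: "edge i j \<in> borel_measurable M" using ijge by simp
  have [measurable]: "cnt B \<in> measurable M (count_space UNIV)" "cnt C \<in> measurable M (count_space UNIV)"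
     "cnt (pairs n) \<in> measurable M (count_space UNIV)"
    using cnt_measurable sub by blast+
  have int_ec: "integrable M (\<lambda>\<omega>. edge i j \<omega> * f (cnt S \<omega>))" if "S \<subseteq> pairs n" for S and f :: "nat \<Rightarrow> real"
    by (rule Bochner_Integration.integrable_bound[OF integrable_abs[OF cnt_integrable[OF that, of f]]])
       (use cnt_measurable[OF that] edge_bounds in \<open>auto simp: abs_mult intro!: mult_left_le_one_le\<close>)
  have int_ebc: "integrable M (\<lambda>\<omega>. edge i j \<omega> * u ^ (cnt B \<omega> + cnt C \<omega>))"
    using int_ec[OF order_refl, of "\<lambda>k. u ^ (k - 1)"] unfolding e1 .
  \<comment> \<open>A pair in \<open>B\<close> has \<open>i\<close> or \<open>j\<close> in one of
    its two positions, which gives four lines of length \<open>n\<close>.\<close>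
  have card_B: "real (card B) \<le> 4 * real n"
  proof -
    have "B \<subseteq> ({i} \<times> {1..n} \<union> {j} \<times> {1..n}) \<union> ({1..n} \<times> {i} \<union> {1..n} \<times> {j})"
      by (auto simp: B_def pairs_def)
    then have "card B \<le> card (({i} \<times> {1..n} \<union> {j} \<times> {1..n}) \<union> ({1..n} \<times> {i} \<union> {1..n} \<times> {j}))"
      by (intro card_mono) auto
    also have "\<dots> \<le> (n + n) + (n + n)"
      using card_Un_le[of "{i} \<times> {1..n} \<union> {j} \<times> {1..n}" "{1..n} \<times> {i} \<union> {1..n} \<times> {j}"]
        card_Un_le[of "{i} \<times> {1..n}" "{j} \<times> {1..n}"] card_Un_le[of "{1..n} \<times> {i}" "{1..n} \<times> {j}"]
      by (simp add: card_cartesian_product)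
    finally show ?thesis by simp
  qed
  have h0: "0 \<le> h" using p_le p_nonneg by linarith
  have EB: "expectation (\<lambda>\<omega>. real (cnt B \<omega>)) = real (card B) * p"
  proof -
    have "expectation (\<lambda>\<omega>. real (cnt B \<omega>)) = (\<Sum>x\<in>B. expectation (edge (fst x) (snd x)))"
      unfolding real_cnt[OF fin(1)] case_prod_beta
      by (subst Bochner_Integration.integral_sum) (use sub pairs_ge in \<open>auto intro!: edge_integrable\<close>)
    also have "\<dots> = (\<Sum>x\<in>B. p)"
      by (intro sum.cong expectation_edge) (use sub pairs_ge in auto)
    finally show ?thesis by simp
  qed
  have EeB: "expectation (\<lambda>\<omega>. edge i j \<omega> * real (cnt B \<omega>)) \<le> real (card B) * (p * h)"
  proof -
    have "expectation (\<lambda>\<omega>. edge i j \<omega> * real (cnt B \<omega>)) = (\<Sum>x\<in>B. expectation (\<lambda>\<omega>. edge i j \<omega> * edge (fst x) (snd x) \<omega>))"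
      unfolding real_cnt[OF fin(1)] case_prod_beta sum_distrib_left
    proof (subst Bochner_Integration.integral_sum)
      fix x assume x: "x \<in> B"
      then have ge: "1 \<le> fst x" "1 \<le> snd x" using sub(1) pairs_ge[of "fst x" "snd x" n] by auto
      then have [measurable]: "edge (fst x) (snd x) \<in> borel_measurable M" by simp
      show "integrable M (\<lambda>\<omega>. edge i j \<omega> * edge (fst x) (snd x) \<omega>)"
        by (rule integrable_const_bound[where B=1]) (auto simp: abs_mult edge_bounds intro!: mult_le_one)
    qed simp
    also have "\<dots> \<le> (\<Sum>x\<in>B. p * h)"
    proof (intro sum_mono)
      fix x assume x: "x \<in> B"
      then show "expectation (\<lambda>\<omega>. edge i j \<omega> * edge (fst x) (snd x) \<omega>) \<le> p * h"
        by (intro expectation_edge_edge_le[OF ij, of "fst x" "snd x"]) (auto simp: B_def)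
    qed
    finally show ?thesis by simp
  qed
  have d1: "\<bar>expectation (\<lambda>\<omega>. edge i j \<omega> * u ^ (cnt B \<omega> + cnt C \<omega>)) - expectation (\<lambda>\<omega>. edge i j \<omega> * u ^ cnt C \<omega>)\<bar>
     \<le> real (card B) * (p * h)"
  proof -
    have "\<bar>expectation (\<lambda>\<omega>. edge i j \<omega> * u ^ (cnt B \<omega> + cnt C \<omega>)) - expectation (\<lambda>\<omega>. edge i j \<omega> * u ^ cnt C \<omega>)\<bar>
      = \<bar>expectation (\<lambda>\<omega>. edge i j \<omega> * u ^ (cnt B \<omega> + cnt C \<omega>) - edge i j \<omega> * u ^ cnt C \<omega>)\<bar>"
      using int_ebc int_ec[OF sub(2)] by simp
    also have "\<dots> \<le> expectation (\<lambda>\<omega>. \<bar>edge i j \<omega> * u ^ (cnt B \<omega> + cnt C \<omega>) - edge i j \<omega> * u ^ cnt C \<omega>\<bar>)"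
      by (rule integral_abs_bound)
    also have "\<dots> \<le> expectation (\<lambda>\<omega>. edge i j \<omega> * real (cnt B \<omega>))"
    proof (rule integral_mono)
      show "\<bar>edge i j \<omega> * u ^ (cnt B \<omega> + cnt C \<omega>) - edge i j \<omega> * u ^ cnt C \<omega>\<bar> \<le> edge i j \<omega> * real (cnt B \<omega>)" for \<omega>
        using power_diff_le_of_nat[OF u, of "cnt B \<omega>" "cnt C \<omega>"] edge_bounds(1)[of i j \<omega>]
        by (metis abs_mult abs_of_nonneg mult_left_mono right_diff_distrib)
    qed (use int_ebc int_ec[OF sub(2)] int_ec[OF sub(1)] in auto)
    finally show ?thesis using EeB by linarith
  qed
  have d2: "\<bar>expectation (\<lambda>\<omega>. u ^ cnt (pairs n) \<omega>) - expectation (\<lambda>\<omega>. u ^ cnt C \<omega>)\<bar> \<le> p + real (card B) * p"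
  proof -
    have "\<bar>expectation (\<lambda>\<omega>. u ^ cnt (pairs n) \<omega>) - expectation (\<lambda>\<omega>. u ^ cnt C \<omega>)\<bar>
      = \<bar>expectation (\<lambda>\<omega>. u ^ cnt (pairs n) \<omega> - u ^ cnt C \<omega>)\<bar>"
      using cnt_integrable[OF sub(2)] cnt_integrable[OF order_refl] by simp
    also have "\<dots> \<le> expectation (\<lambda>\<omega>. \<bar>u ^ cnt (pairs n) \<omega> - u ^ cnt C \<omega>\<bar>)"
      by (rule integral_abs_bound)
    also have "\<dots> \<le> expectation (\<lambda>\<omega>. edge i j \<omega> + real (cnt B \<omega>))"
    proof (rule integral_mono)
      show "\<bar>u ^ cnt (pairs n) \<omega> - u ^ cnt C \<omega>\<bar> \<le> edge i j \<omega> + real (cnt B \<omega>)" for \<omega>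
        using power_diff_le_of_nat[OF u, of "cnt {(i,j)} \<omega> + cnt B \<omega>" "cnt C \<omega>"] c1[of \<omega>] W[of \<omega>] by simp
    qed (use cnt_integrable[OF sub(2)] cnt_integrable[OF order_refl] edge_integrable ijge cnt_integrable[OF sub(1)] in auto)
    also have "\<dots> = p + real (card B) * p"
      using edge_integrable ijge cnt_integrable[OF sub(1)] EB expectation_edge by simp
    finally show ?thesis .
  qed
  have d3: "expectation (\<lambda>\<omega>. edge i j \<omega> * u ^ cnt C \<omega>) = p * expectation (\<lambda>\<omega>. u ^ cnt C \<omega>)"
    by (rule expectation_edge_power[OF ij sub(2)]) (auto simp: C_def)
  \<comment> \<open>In the product with \<open>p\<close>, passing from the full count to the count
    over \<open>C\<close> costs \<open>p\<close> times a multiple of \<open>p\<close>. Bounding one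
    \<open>p\<close> by \<open>h\<close> gives this error the same form as that of
    \<open>d1\<close>.\<close>
  have "\<bar>p * expectation (\<lambda>\<omega>. u ^ cnt (pairs n) \<omega>) - p * expectation (\<lambda>\<omega>. u ^ cnt C \<omega>)\<bar> \<le> p * (p + real (card B) * p)"
    using d2 p_nonneg by (metis abs_mult abs_of_nonneg mult_left_mono right_diff_distrib)
  also have "\<dots> \<le> p * (h + real (card B) * h)"
    using p_le p_nonneg by (intro mult_left_mono add_mono) auto
  finally have "\<bar>expectation (\<lambda>\<omega>. edge i j \<omega> * u ^ (cnt (pairs n) \<omega> - 1)) - p * expectation (\<lambda>\<omega>. u ^ cnt (pairs n) \<omega>)\<bar>
     \<le> real (card B) * (p * h) + p * (h + real (card B) * h)"
    using d1 d3 unfolding e1 by linarith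
  also have "\<dots> = (2 * real (card B) + 1) * (p * h)" by (simp add: algebra_simps)
  also have "\<dots> \<le> (8 * real n + 1) * (p * h)"
    using card_B h0 p_nonneg by (intro mult_right_mono) auto
  finally show ?thesis by (simp add: mult.assoc)
qed

text \<open>For a Poisson variable the generating function solves
  \<open>\<phi>' = l * \<phi>\<close> exactly. Here each index pair contributes one error from
  \<open>stein_term\<close>, which explains the factor \<open>card (pairs n)\<close>; the
  exponential in the derivative of the damped function is at most 1 and adds nothing.\<close>

theorem poisson_bound:
  shows "\<bar>prob {\<omega>\<in>space M. cnt (pairs n) \<omega> = 0} - exp (- (real (card (pairs n)) * p))\<bar>
     \<le> real (card (pairs n)) * ((8 * real n + 1) * p * h)"
proof -
  define W where "W = cnt (pairs n)"
  define K where "K = card (pairs n)"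
  define l where "l = real K * p"
  define \<pi> where "\<pi> k = prob {\<omega>\<in>space M. W \<omega> = k}" for k
  define \<phi> where "\<phi> u = (\<Sum>k\<le>K. \<pi> k * u ^ k)" for u :: real
  define \<phi>' where "\<phi>' u = (\<Sum>k\<le>K. \<pi> k * (real k * u ^ (k - 1)))" for u :: real
  have Ephi: "expectation (\<lambda>\<omega>. u ^ W \<omega>) = \<phi> u" for u
    unfolding W_def \<phi>_def \<pi>_def K_def by (rule expectation_cnt[OF order_refl])
  have Ephi': "expectation (\<lambda>\<omega>. real (W \<omega>) * u ^ (W \<omega> - 1)) = \<phi>' u" for u
    unfolding W_def \<phi>'_def \<pi>_def K_def
    using expectation_cnt[OF order_refl, of "\<lambda>k. real k * u ^ (k-1)" n] by simp
  have deriv: "(\<phi> has_real_derivative \<phi>' u) (at u)" for u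
    unfolding \<phi>_def[abs_def] \<phi>'_def
    by (auto intro!: derivative_eq_intros sum.cong)
  \<comment> \<open>Only the term \<open>k = 0\<close> survives, since
    \<open>0 ^ 0 = 1\<close>.\<close>
  have phi0: "\<phi> 0 = prob {\<omega>\<in>space M. W \<omega> = 0}"
    by (simp add: \<phi>_def \<pi>_def sum.atMost_shift)
  have phi1: "\<phi> 1 = 1"
    using Ephi[of 1] by (simp add: prob_space)
  have bound: "\<bar>\<phi>' u - l * \<phi> u\<bar> \<le> real K * ((8 * real n + 1) * p * h)" if u: "0 \<le> u" "u \<le> 1" for u
  proof -
    \<comment> \<open>The factor \<open>real (W \<omega>)\<close> is the sum of the edge indicators,
      so the derivative splits into one term per pair, each to be compared with
      \<open>p * \<phi> u\<close>.\<close>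
    have "\<phi>' u = expectation (\<lambda>\<omega>. \<Sum>x\<in>pairs n. edge (fst x) (snd x) \<omega> * u ^ (W \<omega> - 1))"
      unfolding Ephi'[symmetric] W_def
      by (intro Bochner_Integration.integral_cong refl)
         (simp add: real_cnt[OF finite_pairs] case_prod_beta sum_distrib_right)
    also have "\<dots> = (\<Sum>x\<in>pairs n. expectation (\<lambda>\<omega>. edge (fst x) (snd x) \<omega> * u ^ (W \<omega> - 1)))"
    proof (rule Bochner_Integration.integral_sum)
      fix x assume x: "x \<in> pairs n"
      then have [measurable]: "edge (fst x) (snd x) \<in> borel_measurable M"
        using pairs_ge[of "fst x" "snd x" n] by simp
      show "integrable M (\<lambda>\<omega>. edge (fst x) (snd x) \<omega> * u ^ (W \<omega> - 1))"
        unfolding W_def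
        by (rule Bochner_Integration.integrable_bound[OF integrable_abs[OF cnt_integrable[OF order_refl, of "\<lambda>k. u ^ (k - 1)" n]]])
         (use cnt_measurable[OF order_refl, of n] edge_bounds in \<open>auto simp: abs_mult intro!: mult_left_le_one_le\<close>)
    qed
    finally have "\<phi>' u - l * \<phi> u = (\<Sum>x\<in>pairs n. expectation (\<lambda>\<omega>. edge (fst x) (snd x) \<omega> * u ^ (W \<omega> - 1)) - p * \<phi> u)"
      by (simp add: sum_subtractf l_def K_def)
    also have "\<bar>\<dots>\<bar> \<le> (\<Sum>x\<in>pairs n. \<bar>expectation (\<lambda>\<omega>. edge (fst x) (snd x) \<omega> * u ^ (W \<omega> - 1)) - p * \<phi> u\<bar>)"
      by (rule sum_abs)
    also have "\<dots> \<le> (\<Sum>x\<in>pairs n. (8 * real n + 1) * p * h)"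
      by (intro sum_mono) (use stein_term u in \<open>auto simp: Ephi[symmetric] W_def\<close>)
    finally show ?thesis by (simp add: K_def)
  qed
  have "\<exists>z. 0 < z \<and> z < 1 \<and> \<phi> 1 * exp (- (l * 1)) - \<phi> 0 * exp (- (l * 0))
    = (1 - 0) * ((\<phi>' z - l * \<phi> z) * exp (- (l * z)))"
    by (rule MVT2) (auto intro!: derivative_eq_intros deriv simp: algebra_simps)
  then obtain z where z: "0 < z" "z < 1" "exp (- l) - prob {\<omega>\<in>space M. W \<omega> = 0} = (\<phi>' z - l * \<phi> z) * exp (- (l * z))"
    using phi0 phi1 by auto
  have "\<bar>prob {\<omega>\<in>space M. W \<omega> = 0} - exp (- l)\<bar> = \<bar>\<phi>' z - l * \<phi> z\<bar> * exp (- (l * z))"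
    using z(3) by (metis abs_exp_cancel abs_minus_commute abs_mult)
  also have "\<dots> \<le> \<bar>\<phi>' z - l * \<phi> z\<bar> * 1"
    using z p_nonneg by (intro mult_left_mono) (auto simp: l_def)
  also have "\<dots> \<le> real K * ((8 * real n + 1) * p * h)" using bound[of z] z by simp
  finally show ?thesis by (simp add: l_def K_def W_def)
qed

lemma card_pairs: "real (card (pairs n)) = real n * (real n - 1) / 2"
proof (induction n)
  case 0 have "pairs 0 = {}" by (auto simp: pairs_def) then show ?case by simp
next
  case (Suc n)
  have "pairs (Suc n) = pairs n \<union> {1..n} \<times> {Suc n}" by (auto simp: pairs_def)
  moreover have "pairs n \<inter> {1..n} \<times> {Suc n} = {}" by (auto simp: pairs_def)
  ultimately have "card (pairs (Suc n)) = card (pairs n) + n"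
    using card_Un_disjoint[OF finite_pairs, of "{1..n} \<times> {Suc n}" n] by simp
  then show ?case using Suc by (simp add: field_simps)
qed

end

section \<open>Blockwise radial coordinates\<close>

text \<open>Density of the squared Euclidean norm under Lebesgue measure on R^k: the derivative in
  \<open>q\<close> of the volume of the ball of radius \<open>sqrt q\<close>. Its total mass is
  infinite.\<close>

definition sq_dens :: "nat \<Rightarrow> real \<Rightarrow> ennreal" where
  "sq_dens k q = ennreal (pi powr (real k / 2) / Gamma (real k / 2) * q powr (real k / 2 - 1)) * indicator {0<..} q"

lemma sq_dens_measurable [measurable]: "sq_dens k \<in> borel_measurable borel"
  unfolding sq_dens_def by measurable

lemma nn_integral_powr_Ioc:
  fixes s r :: real assumes "s > 0" "r \<ge> 0"
  shows "(\<integral>\<^sup>+q. ennreal (q powr (s - 1)) * indicator {0<..r} q \<partial>lborel) = ennreal (r powr s / s)"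
proof -
  have "((\<lambda>q. q powr (s - 1)) has_integral (r powr s / s)) {0..r}"
    using has_integral_powr_from_0[of "s - 1" r] assms by simp
  from nn_integral_has_integral_lebesgue[OF _ this]
  have "(\<integral>\<^sup>+q. ennreal (indicator {0..r} q * q powr (s - 1)) \<partial>lborel) = ennreal (r powr s / s)"
    by (simp add: nn_integral_completion)
  also have "(\<integral>\<^sup>+q. ennreal (indicator {0..r} q * q powr (s - 1)) \<partial>lborel) =
      (\<integral>\<^sup>+q. ennreal (q powr (s - 1)) * indicator {0<..r} q \<partial>lborel)"
    by (intro nn_integral_cong) (auto simp: indicator_def)
  finally show ?thesis .
qed

text \<open>Both sides give \<open>{..r}\<close> the volume of the ball of radius
  \<open>sqrt r\<close>, and these half-lines form an intersection stable generator on which the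
  measures are finite.\<close>

lemma distr_sum_squares:
  assumes I: "finite I" "I \<noteq> {}"
  shows "distr (PiM I (\<lambda>_. lborel)) borel (\<lambda>f. \<Sum>i\<in>I. (f i)\<^sup>2) = density lborel (sq_dens (card I))"
    (is "?A = ?B")
proof (rule measure_eqI_generator_eq)
  let ?E = "range (\<lambda>a::real. {..a})"
  have [measurable]: "(\<lambda>f. \<Sum>i\<in>I. (f i)\<^sup>2) \<in> borel_measurable (PiM I (\<lambda>_. lborel :: real measure))"
    by measurable
  have k: "card I > 0" using I by (simp add: card_gt_0_iff)
  have A: "emeasure ?A {..r} = ennreal (unit_ball_vol (real (card I)) * r powr (real (card I) / 2))" if "r \<ge> 0" for r
  proof -
    have *: "emeasure ?A {..r} = ennreal (unit_ball_vol (real (card I)) * r powr (real (card I) / 2))" if "r > 0" for r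
    proof -
      have "emeasure ?A {..r} = emeasure (Pi\<^sub>M I (\<lambda>_. lborel))
           ({f. sqrt (\<Sum>i\<in>I. (f i)\<^sup>2) \<le> sqrt r} \<inter> space (Pi\<^sub>M I (\<lambda>_. lborel)))"
        by (subst emeasure_distr) (auto intro!: arg_cong[where f="emeasure _"])
      also have "\<dots> = ennreal (unit_ball_vol (real (card I)) * sqrt r ^ card I)"
        using that by (intro emeasure_cball_aux I) auto
      also have "sqrt r ^ card I = r powr (real (card I) / 2)"
        using that by (simp add: powr_half_sqrt[symmetric] powr_realpow[symmetric] powr_powr)
      finally show ?thesis .
    qed
    show ?thesis
    proof (cases "r = 0")
      case True
      \<comment> \<open>The volume formula above is for positive \<open>r\<close>; the value at 0
        follows by continuity from above along \<open>1 / Suc n\<close>.\<close>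
      have e: "emeasure ?A {..1 / real (Suc n)} = ennreal (unit_ball_vol (real (card I)) * (1 / real (Suc n)) powr (real (card I) / 2))" for n
        by (rule *) simp
      have "(\<lambda>n. emeasure ?A {..1 / real (Suc n)}) \<longlonglongrightarrow> emeasure ?A (\<Inter>n. {..1 / real (Suc n)})"
        using *[of 1] by (intro Lim_emeasure_decseq) (auto simp: decseq_def * intro!: frac_le)
      moreover have "(\<Inter>n. {..1 / real (Suc n)}) = {..0}"
      proof (intro equalityI subsetI)
        fix x :: real assume x: "x \<in> (\<Inter>n. {..1 / real (Suc n)})"
        show "x \<in> {..0}"
          using x reals_Archimedean[of x] by (force simp: inverse_eq_divide not_less[symmetric])
      qed (auto intro: order_trans)
      ultimately have l1: "(\<lambda>n. emeasure ?A {..1 / real (Suc n)}) \<longlonglongrightarrow> emeasure ?A {..0}" by simp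
      have "(\<lambda>n. (1 / real (Suc n)) powr (real (card I) / 2)) \<longlonglongrightarrow> 0 powr (real (card I) / 2)"
        using k LIMSEQ_Suc[OF lim_1_over_n] by (intro tendsto_powr') auto
      then have l2: "(\<lambda>n. emeasure ?A {..1 / real (Suc n)}) \<longlonglongrightarrow> ennreal (unit_ball_vol (real (card I)) * 0)"
        unfolding e by (intro tendsto_ennrealI tendsto_mult tendsto_const) simp
      show ?thesis using LIMSEQ_unique[OF l1 l2] True by simp
    qed (use * that in auto)
  qed
  have B: "emeasure ?B {..r} = ennreal (unit_ball_vol (real (card I)) * r powr (real (card I) / 2))" if "r \<ge> 0" for r
  proof -
    have "emeasure ?B {..r} = (\<integral>\<^sup>+q. sq_dens (card I) q * indicator {..r} q \<partial>lborel)"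
      by (rule emeasure_density) auto
    also have "\<dots> = (\<integral>\<^sup>+q. ennreal (pi powr (real (card I) / 2) / Gamma (real (card I) / 2)) *
         (ennreal (q powr (real (card I) / 2 - 1)) * indicator {0<..r} q) \<partial>lborel)"
      using k by (intro nn_integral_cong) (auto simp: sq_dens_def indicator_def ennreal_mult'[symmetric])
    also have "\<dots> = ennreal (pi powr (real (card I) / 2) / Gamma (real (card I) / 2)) *
         ennreal (r powr (real (card I) / 2) / (real (card I) / 2))"
      using k that by (subst nn_integral_cmult) (simp_all add: nn_integral_powr_Ioc)
    also have "\<dots> = ennreal (unit_ball_vol (real (card I)) * r powr (real (card I) / 2))"
    proof -
      define x where "x = real (card I) / 2"
      have x: "x > 0" using k by (simp add: x_def)
      then have "Gamma (x + 1) = x * Gamma x" by (intro Gamma_plus1) auto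
      then have "pi powr x / Gamma x * (r powr x / x) = unit_ball_vol (real (card I)) * r powr x"
        using x by (simp add: unit_ball_vol_def x_def[symmetric] field_simps)
      then show ?thesis
        using x by (subst ennreal_mult'[symmetric]) (auto simp: x_def[symmetric] Gamma_real_pos less_imp_le)
    qed
    finally show ?thesis .
  qed
  have neg: "emeasure ?A {..r} = 0" "emeasure ?B {..r} = 0" if "r < 0" for r
  proof -
    have "emeasure ?A {..r} \<le> emeasure ?A {..0}" "emeasure ?B {..r} \<le> emeasure ?B {..0}"
      using that by (auto intro!: emeasure_mono)
    then show "emeasure ?A {..r} = 0" "emeasure ?B {..r} = 0" using A[of 0] B[of 0] by auto
  qed
  show "Int_stable ?E" by (auto simp: Int_stable_def)
  show "?E \<subseteq> Pow UNIV" by simp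
  show "emeasure ?A X = emeasure ?B X" if "X \<in> ?E" for X
  proof -
    obtain r where r: "X = {..r}" using \<open>X \<in> ?E\<close> by auto
    show ?thesis using A[of r] B[of r] neg[of r] r by (cases "r \<ge> 0") auto
  qed
  show "sets ?A = sigma_sets UNIV ?E" "sets ?B = sigma_sets UNIV ?E"
    by (simp_all add: borel_eq_atMost)
  show "range (\<lambda>n::nat. {..real n}) \<subseteq> ?E" by auto
  show "(\<Union>n::nat. {..real n}) = UNIV"
    using real_arch_simple by fastforce
  show "emeasure ?A {..real n} \<noteq> \<infinity>" for n by (simp add: A)
qed

lemma nn_integral_sum_squares:
  assumes I: "finite I" "I \<noteq> {}" and F [measurable]: "F \<in> borel_measurable borel"
  shows "(\<integral>\<^sup>+f. F (\<Sum>i\<in>I. (f i)\<^sup>2) \<partial>PiM I (\<lambda>_. lborel)) = (\<integral>\<^sup>+q. sq_dens (card I) q * F q \<partial>lborel)"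
proof -
  have "(\<integral>\<^sup>+f. F (\<Sum>i\<in>I. (f i)\<^sup>2) \<partial>PiM I (\<lambda>_. lborel)) =
     (\<integral>\<^sup>+q. F q \<partial>distr (PiM I (\<lambda>_. lborel)) borel (\<lambda>f. \<Sum>i\<in>I. (f i)\<^sup>2))"
    by (subst nn_integral_distr) auto
  also have "\<dots> = (\<integral>\<^sup>+q. sq_dens (card I) q * F q \<partial>lborel)"
    unfolding distr_sum_squares[OF I] by (subst nn_integral_density) auto
  finally show ?thesis .
qed

text \<open>Boxes are products of intervals, and their volumes determine Lebesgue measure. The
  product form gives access to Fubini over arbitrary blocks of coordinates.\<close>

lemma lborel_vec_eq:
  "(lborel :: (real ^ 'd::finite) measure) = distr (PiM UNIV (\<lambda>_. lborel)) borel (\<lambda>f. \<chi> k. f k)"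
proof (rule lborel_eqI)
  interpret product_sigma_finite "\<lambda>_::'d. lborel :: real measure" ..
  fix l u :: "real ^ 'd" assume le: "\<And>b. b \<in> Basis \<Longrightarrow> l \<bullet> b \<le> u \<bullet> b"
  have le': "l $ k \<le> u $ k" for k using le[of "axis k 1"] by (auto simp: Basis_vec_def inner_axis)
  have m: "(\<lambda>f. \<chi> k. f k) \<in> measurable (PiM UNIV (\<lambda>_. lborel)) (borel :: (real ^ 'd) measure)"
    by (subst borel_measurable_euclidean_space) (auto simp: Basis_vec_def inner_axis)
  have "emeasure (distr (PiM UNIV (\<lambda>_. lborel)) borel (\<lambda>f. \<chi> k. f k)) (box l u)
    = emeasure (PiM UNIV (\<lambda>_. lborel)) (\<Pi>\<^sub>E k\<in>UNIV. {l $ k<..<u $ k})"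
    using m by (subst emeasure_distr)
      (auto simp: space_PiM mem_box_cart PiE_def Pi_def extensional_def intro!: arg_cong[where f="emeasure _"])
  also have "\<dots> = (\<Prod>k\<in>UNIV. ennreal (u $ k - l $ k))"
    by (subst emeasure_PiM) (auto simp: le')
  also have "\<dots> = ennreal (\<Prod>k\<in>UNIV. (u - l) $ k)"
    using le' by (subst prod_ennreal) auto
  also have "(\<Prod>k\<in>UNIV. (u - l) $ k) = (\<Prod>b\<in>Basis. (u - l) \<bullet> b)"
  proof -
    have B: "(Basis :: (real ^ 'd) set) = range (\<lambda>k. axis k 1)" by (auto simp: Basis_vec_def)
    have "inj (\<lambda>k. axis k (1::real) :: real ^ 'd)" by (auto simp: inj_on_def axis_eq_axis)
    then show ?thesis unfolding B by (subst prod.reindex) (auto simp: inner_axis)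
  qed
  finally show "emeasure (distr (PiM UNIV (\<lambda>_. lborel)) borel (\<lambda>f. \<chi> k. f k)) (box l u) = (\<Prod>b\<in>Basis. (u - l) \<bullet> b)" .
qed simp

text \<open>Fubini splits off \<open>k0\<close> and then separates \<open>I\<close> from
  \<open>J\<close>; since only the sums of squares enter, each block collapses to one variable with
  density \<open>sq_dens\<close>. The coordinate \<open>k0\<close> is kept apart because it will
  carry the cosine of the angle.\<close>

lemma nn_integral_lborel_three_blocks:
  fixes F :: "real \<Rightarrow> real \<Rightarrow> real \<Rightarrow> ennreal" and I J :: "'d::finite set"
  assumes F [measurable]: "(\<lambda>(x,q,\<tau>). F x q \<tau>) \<in> borel_measurable (borel \<Otimes>\<^sub>M borel \<Otimes>\<^sub>M borel)"
    and IJ: "k0 \<notin> I" "k0 \<notin> J" "I \<inter> J = {}" "insert k0 (I \<union> J) = UNIV" "I \<noteq> {}" "J \<noteq> {}"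
  shows "(\<integral>\<^sup>+z. F (z $ k0) (\<Sum>i\<in>I. (z $ i)\<^sup>2) (\<Sum>j\<in>J. (z $ j)\<^sup>2) \<partial>lborel)
    = (\<integral>\<^sup>+x. \<integral>\<^sup>+q. sq_dens (card I) q * (\<integral>\<^sup>+\<tau>. sq_dens (card J) \<tau> * F x q \<tau> \<partial>lborel) \<partial>lborel \<partial>lborel)"
proof -
  interpret product_sigma_finite "\<lambda>_::'d. lborel :: real measure" ..
  have m: "(\<lambda>f. \<chi> k. f k) \<in> measurable (PiM UNIV (\<lambda>_. lborel)) (borel :: (real ^ 'd) measure)"
    by (subst borel_measurable_euclidean_space) (auto simp: Basis_vec_def inner_axis)
  have Fm: "(\<lambda>x. F (f x) (g x) (h x)) \<in> borel_measurable N"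
    if [measurable]: "f \<in> borel_measurable N" "g \<in> borel_measurable N" "h \<in> borel_measurable N" for f g h N
    using measurable_compose[OF _ F, of "\<lambda>x. (f x, g x, h x)" N] by simp
  have upd: "(\<Sum>i\<in>I. ((f(k0 := y)) i)\<^sup>2) = (\<Sum>i\<in>I. (f i)\<^sup>2)" "(\<Sum>i\<in>J. ((f(k0 := y)) i)\<^sup>2) = (\<Sum>i\<in>J. (f i)\<^sup>2)"
    for f and y :: real by (intro sum.cong; use IJ in auto)+
  have mrg: "(\<Sum>i\<in>I. (merge I J (f, g) i)\<^sup>2) = (\<Sum>i\<in>I. (f i)\<^sup>2)" "(\<Sum>i\<in>J. (merge I J (f, g) i)\<^sup>2) = (\<Sum>i\<in>J. (g i)\<^sup>2)"
    for f g :: "'d \<Rightarrow> real" by (intro sum.cong; use IJ in \<open>auto simp: merge_def\<close>)+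
  have cm [measurable]: "(\<lambda>z :: real ^ 'd. z $ i) \<in> borel_measurable borel" for i
    by (rule borel_measurable_continuous_onI) (intro continuous_intros)
  have "(\<integral>\<^sup>+z. F (z $ k0) (\<Sum>i\<in>I. (z $ i)\<^sup>2) (\<Sum>j\<in>J. (z $ j)\<^sup>2) \<partial>lborel)
     = (\<integral>\<^sup>+f. F (f k0) (\<Sum>i\<in>I. (f i)\<^sup>2) (\<Sum>j\<in>J. (f j)\<^sup>2) \<partial>PiM UNIV (\<lambda>_. lborel))"
    unfolding lborel_vec_eq by (subst nn_integral_distr) (auto intro!: m Fm)
  also have "(PiM UNIV (\<lambda>_. lborel)) = PiM (insert k0 (I \<union> J)) (\<lambda>_::'d. lborel :: real measure)" using IJ by simp
  also have "(\<integral>\<^sup>+f. F (f k0) (\<Sum>i\<in>I. (f i)\<^sup>2) (\<Sum>j\<in>J. (f j)\<^sup>2) \<partial>PiM (insert k0 (I \<union> J)) (\<lambda>_. lborel))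
    = (\<integral>\<^sup>+x. \<integral>\<^sup>+f. F x (\<Sum>i\<in>I. (f i)\<^sup>2) (\<Sum>j\<in>J. (f j)\<^sup>2) \<partial>PiM (I \<union> J) (\<lambda>_. lborel) \<partial>lborel)"
  proof (subst product_nn_integral_insert_rev)
    show "(\<integral>\<^sup>+ y. \<integral>\<^sup>+ x. F ((x(k0 := y)) k0) (\<Sum>i\<in>I. ((x(k0 := y)) i)\<^sup>2) (\<Sum>j\<in>J. ((x(k0 := y)) j)\<^sup>2) \<partial>Pi\<^sub>M (I \<union> J) (\<lambda>_. lborel) \<partial>lborel)
     = (\<integral>\<^sup>+x. \<integral>\<^sup>+f. F x (\<Sum>i\<in>I. (f i)\<^sup>2) (\<Sum>j\<in>J. (f j)\<^sup>2) \<partial>PiM (I \<union> J) (\<lambda>_. lborel) \<partial>lborel)"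
      by (simp only: upd fun_upd_same)
  qed (use IJ in \<open>auto intro!: Fm\<close>)
  also have "\<dots> = (\<integral>\<^sup>+x. \<integral>\<^sup>+f. \<integral>\<^sup>+g. F x (\<Sum>i\<in>I. (f i)\<^sup>2) (\<Sum>j\<in>J. (g j)\<^sup>2) \<partial>PiM J (\<lambda>_. lborel) \<partial>PiM I (\<lambda>_. lborel) \<partial>lborel)"
  proof (intro nn_integral_cong)
    fix x :: real
    show "(\<integral>\<^sup>+f. F x (\<Sum>i\<in>I. (f i)\<^sup>2) (\<Sum>j\<in>J. (f j)\<^sup>2) \<partial>PiM (I \<union> J) (\<lambda>_. lborel))
     = (\<integral>\<^sup>+f. \<integral>\<^sup>+g. F x (\<Sum>i\<in>I. (f i)\<^sup>2) (\<Sum>j\<in>J. (g j)\<^sup>2) \<partial>PiM J (\<lambda>_. lborel) \<partial>PiM I (\<lambda>_. lborel))"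
    proof (subst product_nn_integral_fold)
      show "(\<integral>\<^sup>+ f. \<integral>\<^sup>+ g. F x (\<Sum>i\<in>I. (merge I J (f, g) i)\<^sup>2) (\<Sum>j\<in>J. (merge I J (f, g) j)\<^sup>2) \<partial>Pi\<^sub>M J (\<lambda>_. lborel) \<partial>Pi\<^sub>M I (\<lambda>_. lborel))
        = (\<integral>\<^sup>+f. \<integral>\<^sup>+g. F x (\<Sum>i\<in>I. (f i)\<^sup>2) (\<Sum>j\<in>J. (g j)\<^sup>2) \<partial>PiM J (\<lambda>_. lborel) \<partial>PiM I (\<lambda>_. lborel))"
        by (simp only: mrg)
    qed (use IJ in \<open>auto intro!: Fm\<close>)
  qed
  also have "\<dots> = (\<integral>\<^sup>+x. \<integral>\<^sup>+f. (\<lambda>q. (\<integral>\<^sup>+\<tau>. sq_dens (card J) \<tau> * F x q \<tau> \<partial>lborel)) (\<Sum>i\<in>I. (f i)\<^sup>2) \<partial>PiM I (\<lambda>_. lborel) \<partial>lborel)"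
    using IJ by (intro nn_integral_cong) (auto simp: nn_integral_sum_squares[where F="F _ _"] Fm)
  also have "\<dots> = (\<integral>\<^sup>+x. \<integral>\<^sup>+q. sq_dens (card I) q * (\<integral>\<^sup>+\<tau>. sq_dens (card J) \<tau> * F x q \<tau> \<partial>lborel) \<partial>lborel \<partial>lborel)"
    using IJ by (intro nn_integral_cong nn_integral_sum_squares) (auto intro!: Fm)
  finally show ?thesis .
qed

lemma nn_integral_lborel_reflect:
  fixes f :: "'a::euclidean_space \<Rightarrow> ennreal"
  assumes [measurable]: "f \<in> borel_measurable borel"
  shows "(\<integral>\<^sup>+x. f (a - x) \<partial>lborel) = (\<integral>\<^sup>+x. f x \<partial>lborel)"
  by (subst (2) lborel_affine[of "-1" a]) (simp_all add: nn_integral_density nn_integral_distr)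

lemma nn_integral_lborel_translate:
  fixes f :: "'a::euclidean_space \<Rightarrow> ennreal"
  assumes [measurable]: "f \<in> borel_measurable borel"
  shows "(\<integral>\<^sup>+x. f (x + a) \<partial>lborel) = (\<integral>\<^sup>+x. f x \<partial>lborel)"
  by (subst (2) lborel_affine[of 1 a]) (simp_all add: nn_integral_density nn_integral_distr add.commute)

text \<open>The argument for uniqueness of Haar measure: the image of \<open>lborel\<close> under \<open>R\<close> is
  translation invariant, and it agrees with \<open>lborel\<close> on the unit ball. (The library's change of
  variables for orthogonal maps needs a well-ordered index type.)\<close>

lemma nn_integral_lborel_isometric_involution:
  fixes f :: "'a::euclidean_space \<Rightarrow> ennreal"
  assumes f [measurable]: "f \<in> borel_measurable borel"
    and R: "linear R" "\<And>x. norm (R x) = norm x" "\<And>x. R (R x) = x"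
  shows "(\<integral>\<^sup>+x. f (R x) \<partial>lborel) = (\<integral>\<^sup>+x. f x \<partial>lborel)"
proof -
  have [measurable]: "R \<in> borel_measurable borel"
    using R(1) by (intro borel_measurable_continuous_onI linear_continuous_on linear_conv_bounded_linear[THEN iffD1])
  define g :: "'a \<Rightarrow> ennreal" where "g = indicator (ball 0 1)"
  have g [measurable]: "g \<in> borel_measurable borel"
    unfolding g_def by (intro borel_measurable_indicator borel_open open_ball)
  have gR: "g (R x) = g x" for x by (simp add: g_def indicator_def R(2))
  have gint: "(\<integral>\<^sup>+y. g y \<partial>lborel) = emeasure lborel (ball (0::'a) 1)" by (simp add: g_def)
  have "(\<integral>\<^sup>+x. f (R x) \<partial>lborel) * (\<integral>\<^sup>+y. g y \<partial>lborel) = (\<integral>\<^sup>+x. f (R x) * (\<integral>\<^sup>+y. g y \<partial>lborel) \<partial>lborel)"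
    by (rule nn_integral_multc[symmetric]) simp
  also have "\<dots> = (\<integral>\<^sup>+x. f (R x) * (\<integral>\<^sup>+y. g (y + R x) \<partial>lborel) \<partial>lborel)"
    by (simp add: nn_integral_lborel_translate)
  also have "\<dots> = (\<integral>\<^sup>+x. (\<integral>\<^sup>+y. f (R x) * g (y + R x) \<partial>lborel) \<partial>lborel)"
    by (intro nn_integral_cong nn_integral_cmult[symmetric]) simp
  also have "\<dots> = (\<integral>\<^sup>+y. (\<integral>\<^sup>+x. f (R x) * g (y + R x) \<partial>lborel) \<partial>lborel)"
    by (rule lborel_pair.Fubini') simp
  also have "\<dots> = (\<integral>\<^sup>+y. (\<integral>\<^sup>+x. f (R x - y) * g (R x) \<partial>lborel) \<partial>lborel)"
  proof (rule nn_integral_cong)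
    fix y
    \<comment> \<open>A translation by \<open>R y\<close> becomes one by \<open>y\<close> after
      applying \<open>R\<close>, because \<open>R (R y) = y\<close>. This moves \<open>y\<close>
      from the argument of \<open>f\<close> to that of \<open>g\<close>.\<close>
    have "(\<integral>\<^sup>+x. f (R x - y) * g (R x) \<partial>lborel) = (\<integral>\<^sup>+x. f (R (x + R y) - y) * g (R (x + R y)) \<partial>lborel)"
      by (rule nn_integral_lborel_translate[symmetric]) simp
    also have "\<dots> = (\<integral>\<^sup>+x. f (R x) * g (y + R x) \<partial>lborel)"
      by (simp add: linear_add[OF R(1)] R(3) add.commute)
    finally show "(\<integral>\<^sup>+x. f (R x) * g (y + R x) \<partial>lborel) = (\<integral>\<^sup>+x. f (R x - y) * g (R x) \<partial>lborel)" ..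
  qed
  also have "\<dots> = (\<integral>\<^sup>+x. (\<integral>\<^sup>+y. f (R x - y) * g (R x) \<partial>lborel) \<partial>lborel)"
    by (rule lborel_pair.Fubini'[symmetric]) simp
  also have "\<dots> = (\<integral>\<^sup>+x. (\<integral>\<^sup>+y. f y \<partial>lborel) * g x \<partial>lborel)"
    by (intro nn_integral_cong) (simp add: nn_integral_multc nn_integral_lborel_reflect gR)
  also have "\<dots> = (\<integral>\<^sup>+y. f y \<partial>lborel) * (\<integral>\<^sup>+y. g y \<partial>lborel)"
    by (rule nn_integral_cmult) simp
  finally have "(\<integral>\<^sup>+x. f (R x) \<partial>lborel) * emeasure lborel (ball (0::'a) 1) = (\<integral>\<^sup>+x. f x \<partial>lborel) * emeasure lborel (ball (0::'a) 1)"
    by (simp only: gint)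
  moreover have "emeasure lborel (ball (0::'a) 1) \<noteq> 0" "emeasure lborel (ball (0::'a) 1) \<noteq> \<top>"
    using content_ball_pos[of 1 "0::'a"] emeasure_lborel_ball_finite[of "0::'a" 1]
    by (auto simp: measure_def)
  ultimately show ?thesis
    by (metis ennreal_mult_cancel_left mult.commute)
qed

text \<open>Substituting \<open>r * x\<close> reduces to Euler's integral over
  \<open>(0, 1)\<close>. The length \<open>r\<close> is kept free for iterated integrals, where the
  upper end depends on the outer variables.\<close>

lemma nn_integral_Beta:
  fixes a b r :: real assumes ab: "a > 0" "b > 0" and r: "r > 0"
  shows "(\<integral>\<^sup>+x. ennreal (x powr (a - 1) * (r - x) powr (b - 1)) * indicator {0<..<r} x \<partial>lborel)
     = ennreal (Beta a b * r powr (a + b - 1))"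
proof -
  have "(\<integral>\<^sup>+x. ennreal (x powr (a - 1) * (1 - x) powr (b - 1)) * indicator {0<..<1} x \<partial>lborel)
     = (\<integral>\<^sup>+x. ennreal (indicator {0..1} x * (x powr (a - 1) * (1 - x) powr (b - 1))) \<partial>lborel)"
    by (intro nn_integral_cong) (auto simp: indicator_def)
  also have "\<dots> = ennreal (Beta a b)"
    using nn_integral_has_integral_lebesgue[OF _ has_integral_Beta_real[OF ab]]
    by (simp add: nn_integral_completion)
  finally have B: "(\<integral>\<^sup>+x. ennreal (x powr (a - 1) * (1 - x) powr (b - 1)) * indicator {0<..<1} x \<partial>lborel) = ennreal (Beta a b)" .
  have "(\<integral>\<^sup>+x. ennreal (x powr (a - 1) * (r - x) powr (b - 1)) * indicator {0<..<r} x \<partial>lborel)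
     = ennreal r * (\<integral>\<^sup>+x. ennreal ((0 + r * x) powr (a - 1) * (r - (0 + r * x)) powr (b - 1)) * indicator {0<..<r} (0 + r * x) \<partial>lborel)"
    using r by (subst nn_integral_real_affine[where t=0 and c=r]) auto
  also have "(\<integral>\<^sup>+x. ennreal ((0 + r * x) powr (a - 1) * (r - (0 + r * x)) powr (b - 1)) * indicator {0<..<r} (0 + r * x) \<partial>lborel)
     = (\<integral>\<^sup>+x. ennreal (r powr (a + b - 2)) * (ennreal (x powr (a - 1) * (1 - x) powr (b - 1)) * indicator {0<..<1} x) \<partial>lborel)"
  proof (intro nn_integral_cong)
    fix x :: real
    have iff: "0 + r * x \<in> {0<..<r} \<longleftrightarrow> x \<in> {0<..<1}" using r by (auto simp: zero_less_mult_iff)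
    show "ennreal ((0 + r * x) powr (a - 1) * (r - (0 + r * x)) powr (b - 1)) * indicator {0<..<r} (0 + r * x)
      = ennreal (r powr (a + b - 2)) * (ennreal (x powr (a - 1) * (1 - x) powr (b - 1)) * indicator {0<..<1} x)"
    proof (cases "x \<in> {0<..<1}")
      case True
      have "r - (0 + r * x) = r * (1 - x)" by (simp add: algebra_simps)
      moreover have "r powr (a + b - 2) = r powr (a - 1) * r powr (b - 1)"
        using r by (simp add: powr_add[symmetric] algebra_simps)
      ultimately show ?thesis using True r iff
        by (simp add: powr_mult ennreal_mult'[symmetric] mult_ac)
    qed (use iff in \<open>auto simp: indicator_def\<close>)
  qed
  also have "\<dots> = ennreal (r powr (a + b - 2)) * ennreal (Beta a b)"
    by (subst nn_integral_cmult) (simp_all add: B)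
  also have "ennreal r * \<dots> = ennreal (Beta a b * r powr (a + b - 1))"
  proof -
    have "r powr (a + b - 1) = r * r powr (a + b - 2)"
      using r powr_add[of r 1 "a + b - 2"] by simp
    then show ?thesis using r by (simp add: ennreal_mult'[symmetric] ennreal_mult''[symmetric] mult_ac)
  qed
  finally show ?thesis .
qed

section \<open>The Pearson law on the unit ball\<close>

text \<open>Everything in this locale lives on the unit ball. \<open>I0\<close> holds the
  coordinates kept by the projection, and \<open>k0\<close> is one of them, chosen as reference axis
  for angles.\<close>

locale pearson_ball =
  fixes I0 :: "'d::finite set" and k0 :: 'd and \<beta> :: real
  assumes k0: "k0 \<in> I0" and card_I0: "card I0 \<ge> 2" and I0_neq: "I0 \<noteq> UNIV" and beta: "\<beta> > -1"
begin

definition e :: real where "e = real (card I0)"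
definition d :: real where "d = real CARD('d)"
definition \<alpha> :: real where "\<alpha> = (d - e) / 2 + \<beta> + 1"

definition Q :: "real ^ 'd \<Rightarrow> real" where "Q z = (\<Sum>i\<in>I0. (z $ i)\<^sup>2)"
definition B :: "real ^ 'd \<Rightarrow> real ^ 'd \<Rightarrow> real" where "B y z = (\<Sum>i\<in>I0. y $ i * z $ i)"

text \<open>\<open>c0\<close> normalises \<open>(1 - (norm z)\<^sup>2) powr \<beta>\<close> on the
  unit ball. \<open>CB\<close> is \<open>1 / Beta (e / 2) \<alpha>\<close>, and \<open>Ck\<close> is
  \<open>1 / Beta (1 / 2) ((e - 1) / 2)\<close>.\<close>

definition c0 :: real where "c0 = Gamma (d / 2 + \<beta> + 1) / (Gamma (\<beta> + 1) * pi powr (d / 2))"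
definition CB :: real where "CB = Gamma (d / 2 + \<beta> + 1) / (Gamma (e / 2) * Gamma \<alpha>)"
definition Ck :: real where "Ck = Gamma (e / 2) / (sqrt pi * Gamma ((e - 1) / 2))"

definition f0 :: "real ^ 'd \<Rightarrow> ennreal" where
  "f0 z = ennreal (c0 * (1 - (norm z)\<^sup>2) powr \<beta>) * indicator {z. norm z < 1} z"

text \<open>The beta density with parameters \<open>e / 2\<close> and \<open>\<alpha>\<close>, which
  is the law of \<open>Q z\<close> under \<open>f0\<close>.\<close>

definition wB :: "real \<Rightarrow> ennreal" where
  "wB \<rho> = ennreal (CB * \<rho> powr (e / 2 - 1) * (1 - \<rho>) powr (\<alpha> - 1)) * indicator {0<..<1} \<rho>"

text \<open>The law of the cosine of the angle between a fixed axis and a uniform direction in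
  dimension \<open>e\<close>.\<close>

definition wk :: "real \<Rightarrow> ennreal" where
  "wk c = ennreal (Ck * (1 - c\<^sup>2) powr ((e - 3) / 2)) * indicator {-1<..<1} c"

lemma e_ge: "e \<ge> 2" using card_I0 by (simp add: e_def)

lemma e_less_d: "e + 1 \<le> d"
proof -
  have "card I0 < CARD('d)" using I0_neq by (intro psubset_card_mono) auto
  then show ?thesis by (simp add: e_def d_def)
qed

lemma alpha_pos: "\<alpha> > 0" using e_less_d beta by (simp add: \<alpha>_def field_simps)

lemma measurable_f0 [measurable]: "f0 \<in> borel_measurable borel"
  unfolding f0_def by measurable

lemma measurable_wB [measurable]: "wB \<in> borel_measurable borel"
  unfolding wB_def by measurable

lemma measurable_wk [measurable]: "wk \<in> borel_measurable borel"
  unfolding wk_def by measurable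

lemma measurable_component [measurable]: "(\<lambda>z :: real ^ 'd. z $ i) \<in> borel_measurable borel"
  by (rule borel_measurable_continuous_onI) (intro continuous_intros)

lemma measurable_Q [measurable]: "Q \<in> borel_measurable borel"
  unfolding Q_def by measurable

lemma measurable_B [measurable]: "B y \<in> borel_measurable borel"
  unfolding B_def by measurable

text \<open>With the long coordinates fixed, \<open>m\<close> is what they leave to the squared norm
  of the short ones, and integrating the latter is a beta integral with exponent
  \<open>(d - e) / 2 + \<beta> = \<alpha> - 1\<close>. The constant is written so that it cancels
  against \<open>sq_dens\<close> of the block \<open>I0 - {k0}\<close> and leaves
  \<open>CB * Ck\<close>.\<close>

lemma nn_integral_last_block:
  "(\<integral>\<^sup>+\<tau>. sq_dens (CARD('d) - card I0) \<tau> * (ennreal (c0 * (m - \<tau>) powr \<beta>) * indicator {..<m} \<tau>) \<partial>lborel)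
    = ennreal (CB * Ck / pi powr ((e - 1) / 2) * Gamma ((e - 1) / 2) * m powr (\<alpha> - 1)) * indicator {0<..} m"
proof (cases "m > 0")
  case False
  then have "(\<integral>\<^sup>+\<tau>. sq_dens (CARD('d) - card I0) \<tau> * (ennreal (c0 * (m - \<tau>) powr \<beta>) * indicator {..<m} \<tau>) \<partial>lborel) = (\<integral>\<^sup>+\<tau>. 0 \<partial>(lborel :: real measure))"
    by (intro nn_integral_cong) (auto simp: sq_dens_def indicator_def)
  then show ?thesis using False by simp
next
  case True
  define k where "k = real (CARD('d) - card I0)"
  have "card I0 < CARD('d)" using I0_neq by (intro psubset_card_mono) auto
  then have k: "k = d - e" by (simp add: k_def d_def e_def of_nat_diff)
  have k0: "k > 0" using e_less_d k by simp
  have al: "\<alpha> - 1 = k / 2 + (\<beta> + 1) - 1" by (simp add: \<alpha>_def k)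
  have dd: "d = e + k" by (simp add: k)
  have G: "Gamma (\<beta> + 1) > 0" "Gamma (k / 2) > 0" "Gamma (e / 2) > 0" "Gamma ((e - 1) / 2) > 0"
     "Gamma \<alpha> > 0" "Gamma (d / 2 + \<beta> + 1) > 0"
    using beta k0 e_ge alpha_pos e_less_d by (auto intro!: Gamma_real_pos)
  have c0: "c0 \<ge> 0" using G by (simp add: c0_def)
  have "(\<integral>\<^sup>+\<tau>. sq_dens (CARD('d) - card I0) \<tau> * (ennreal (c0 * (m - \<tau>) powr \<beta>) * indicator {..<m} \<tau>) \<partial>lborel)
    = (\<integral>\<^sup>+\<tau>. ennreal (c0 * (pi powr (k / 2) / Gamma (k / 2))) *
        (ennreal (\<tau> powr (k / 2 - 1) * (m - \<tau>) powr (\<beta> + 1 - 1)) * indicator {0<..<m} \<tau>) \<partial>lborel)"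
    unfolding sq_dens_def k_def[symmetric] using c0 G
    by (intro nn_integral_cong) (auto simp: indicator_def ennreal_mult'[symmetric] mult_ac)
  also have "\<dots> = ennreal (c0 * (pi powr (k / 2) / Gamma (k / 2))) * ennreal (Beta (k / 2) (\<beta> + 1) * m powr (k / 2 + (\<beta> + 1) - 1))"
    using k0 beta True by (subst nn_integral_cmult) (simp_all add: nn_integral_Beta[of "k/2" "\<beta> + 1" m, simplified])
  also have "\<dots> = ennreal (c0 * (pi powr (k / 2) / Gamma (k / 2)) * Beta (k / 2) (\<beta> + 1) * m powr (\<alpha> - 1))"
    unfolding al using c0 G by (subst ennreal_mult'[symmetric]) (auto simp: mult_ac)
  also have "c0 * (pi powr (k / 2) / Gamma (k / 2)) * Beta (k / 2) (\<beta> + 1) = CB * Ck / pi powr ((e - 1) / 2) * Gamma ((e - 1) / 2)"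
  proof -
    have p: "pi powr (d / 2) = pi powr (k / 2) * (pi powr ((e - 1) / 2) * sqrt pi)"
      by (simp add: powr_half_sqrt[symmetric] powr_add[symmetric] dd field_simps)
    have a: "k / 2 + (\<beta> + 1) = \<alpha>" by (simp add: \<alpha>_def k)
    show ?thesis
      unfolding Beta_def a c0_def CB_def Ck_def p using G by (simp add: field_simps)
  qed
  finally show ?thesis using True by simp
qed

lemma measurable_case_prod_compose:
  assumes "(\<lambda>(x, y). F x y) \<in> borel_measurable (borel \<Otimes>\<^sub>M borel)" "f \<in> borel_measurable N" "g \<in> borel_measurable N"
  shows "(\<lambda>z. F (f z) (g z)) \<in> borel_measurable N"
  using measurable_compose[OF measurable_Pair[OF assms(2,3)] assms(1)] by simp

text \<open>Squared norm and cosine separate because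
  \<open>\<rho> - x\<^sup>2 = \<rho> * (1 - c\<^sup>2)\<close> for
  \<open>x = sqrt \<rho> * c\<close>, so the density of the remaining long coordinates
  factorises.\<close>

lemma nn_integral_f0_polar:
  fixes F :: "real \<Rightarrow> real \<Rightarrow> ennreal"
  assumes F: "(\<lambda>(\<rho>, x). F \<rho> x) \<in> borel_measurable (borel \<Otimes>\<^sub>M borel)"
  shows "(\<integral>\<^sup>+z. f0 z * F (Q z) (z $ k0) \<partial>lborel)
     = (\<integral>\<^sup>+\<rho>. wB \<rho> * (\<integral>\<^sup>+c. wk c * F \<rho> (sqrt \<rho> * c) \<partial>lborel) \<partial>lborel)"
proof -
  note Fm [measurable (raw)] = measurable_case_prod_compose[OF F]
  define I where "I = I0 - {k0}"
  define J where "J = - I0"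
  have cI: "card I = card I0 - 1" "real (card I) = e - 1" and cJ: "card J = CARD('d) - card I0"
    using k0 card_I0 by (auto simp: I_def J_def Compl_eq_Diff_UNIV card_Diff_subset card_Diff_singleton e_def)
  have I_ne: "I \<noteq> {}" using cI card_I0 by auto
  have J_ne: "J \<noteq> {}" using I0_neq by (auto simp: J_def)
  have Qeq: "Q z = (z $ k0)\<^sup>2 + (\<Sum>i\<in>I. (z $ i)\<^sup>2)" for z
    unfolding Q_def I_def by (rule sum.remove) (use k0 in auto)
  have normeq: "(norm z)\<^sup>2 = (z $ k0)\<^sup>2 + (\<Sum>i\<in>I. (z $ i)\<^sup>2) + (\<Sum>i\<in>J. (z $ i)\<^sup>2)" for z
  proof -
    have "(norm z)\<^sup>2 = (\<Sum>i\<in>UNIV. (z $ i)\<^sup>2)"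
      by (simp add: norm_vec_def L2_set_def sum_nonneg)
    also have "\<dots> = Q z + (\<Sum>i\<in>J. (z $ i)\<^sup>2)"
      unfolding Q_def J_def by (subst sum.union_disjoint[symmetric]) auto
    finally show ?thesis by (simp add: Qeq)
  qed
  have normlt: "norm z < 1 \<longleftrightarrow> (z $ k0)\<^sup>2 + (\<Sum>i\<in>I. (z $ i)\<^sup>2) + (\<Sum>i\<in>J. (z $ i)\<^sup>2) < 1" for z :: "real ^ 'd"
    using normeq[of z] abs_square_less_1[of "norm z"] by simp
  define W where "W m = ennreal (CB * Ck / pi powr ((e - 1) / 2) * Gamma ((e - 1) / 2) * m powr (\<alpha> - 1)) * indicator {0<..} m" for m :: real
  have [measurable]: "W \<in> borel_measurable borel" unfolding W_def by measurable
  have "(\<integral>\<^sup>+z. f0 z * F (Q z) (z $ k0) \<partial>lborel)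
    = (\<integral>\<^sup>+z. (\<lambda>x q \<tau>. F (x\<^sup>2 + q) x * (ennreal (c0 * ((1 - x\<^sup>2 - q) - \<tau>) powr \<beta>) * indicator {..<1 - x\<^sup>2 - q} \<tau>))
        (z $ k0) (\<Sum>i\<in>I. (z $ i)\<^sup>2) (\<Sum>j\<in>J. (z $ j)\<^sup>2) \<partial>lborel)"
    unfolding f0_def normeq Qeq
    by (intro nn_integral_cong) (auto simp: indicator_def normlt algebra_simps)
  also have "\<dots> = (\<integral>\<^sup>+x. \<integral>\<^sup>+q. sq_dens (card I) q * (\<integral>\<^sup>+\<tau>. sq_dens (card J) \<tau> *
      (F (x\<^sup>2 + q) x * (ennreal (c0 * ((1 - x\<^sup>2 - q) - \<tau>) powr \<beta>) * indicator {..<1 - x\<^sup>2 - q} \<tau>)) \<partial>lborel) \<partial>lborel \<partial>lborel)"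
  proof (rule nn_integral_lborel_three_blocks)
    show "insert k0 (I \<union> J) = UNIV" "k0 \<notin> I" "k0 \<notin> J" "I \<inter> J = {}" using k0 by (auto simp: I_def J_def)
    show "(\<lambda>(x, q, \<tau>). F (x\<^sup>2 + q) x * (ennreal (c0 * ((1 - x\<^sup>2 - q) - \<tau>) powr \<beta>) * indicator {..<1 - x\<^sup>2 - q} \<tau>))
      \<in> borel_measurable (borel \<Otimes>\<^sub>M borel \<Otimes>\<^sub>M borel)"
      unfolding case_prod_beta indicator_def lessThan_def mem_Collect_eq of_bool_def by measurable
  qed (use I_ne J_ne in auto)
  also have "\<dots> = (\<integral>\<^sup>+x. \<integral>\<^sup>+q. sq_dens (card I) q * (F (x\<^sup>2 + q) x * W (1 - x\<^sup>2 - q)) \<partial>lborel \<partial>lborel)"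
  proof (intro nn_integral_cong)
    fix x q :: real
    have "(\<integral>\<^sup>+\<tau>. sq_dens (card J) \<tau> * (F (x\<^sup>2 + q) x * (ennreal (c0 * ((1 - x\<^sup>2 - q) - \<tau>) powr \<beta>) * indicator {..<1 - x\<^sup>2 - q} \<tau>)) \<partial>lborel)
      = (\<integral>\<^sup>+\<tau>. F (x\<^sup>2 + q) x * (sq_dens (card J) \<tau> * (ennreal (c0 * ((1 - x\<^sup>2 - q) - \<tau>) powr \<beta>) * indicator {..<1 - x\<^sup>2 - q} \<tau>)) \<partial>lborel)"
      by (simp only: mult_ac)
    also have "\<dots> = F (x\<^sup>2 + q) x * W (1 - x\<^sup>2 - q)"
      by (subst nn_integral_cmult) (auto simp: cJ nn_integral_last_block W_def)
    finally show "sq_dens (card I) q * (\<integral>\<^sup>+\<tau>. sq_dens (card J) \<tau> * (F (x\<^sup>2 + q) x * (ennreal (c0 * ((1 - x\<^sup>2 - q) - \<tau>) powr \<beta>) * indicator {..<1 - x\<^sup>2 - q} \<tau>)) \<partial>lborel)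
      = sq_dens (card I) q * (F (x\<^sup>2 + q) x * W (1 - x\<^sup>2 - q))" by simp
  qed
  \<comment> \<open>For fixed \<open>x\<close> the variable is shifted to
    \<open>\<rho> = x\<^sup>2 + q\<close>, the squared norm of the projected point.\<close>
  also have "\<dots> = (\<integral>\<^sup>+x. \<integral>\<^sup>+\<rho>. sq_dens (card I) (\<rho> - x\<^sup>2) * (F \<rho> x * W (1 - \<rho>)) \<partial>lborel \<partial>lborel)"
  proof (rule nn_integral_cong)
    fix x :: real
    show "(\<integral>\<^sup>+q. sq_dens (card I) q * (F (x\<^sup>2 + q) x * W (1 - x\<^sup>2 - q)) \<partial>lborel)
      = (\<integral>\<^sup>+\<rho>. sq_dens (card I) (\<rho> - x\<^sup>2) * (F \<rho> x * W (1 - \<rho>)) \<partial>lborel)"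
      by (subst nn_integral_real_affine[where t="-x\<^sup>2" and c=1]) simp_all
  qed
  also have "\<dots> = (\<integral>\<^sup>+\<rho>. \<integral>\<^sup>+x. sq_dens (card I) (\<rho> - x\<^sup>2) * (F \<rho> x * W (1 - \<rho>)) \<partial>lborel \<partial>lborel)"
    by (rule lborel_pair.Fubini') simp
  also have "\<dots> = (\<integral>\<^sup>+\<rho>. wB \<rho> * (\<integral>\<^sup>+c. wk c * F \<rho> (sqrt \<rho> * c) \<partial>lborel) \<partial>lborel)"
  proof (intro nn_integral_cong)
    fix \<rho> :: real
    show "(\<integral>\<^sup>+x. sq_dens (card I) (\<rho> - x\<^sup>2) * (F \<rho> x * W (1 - \<rho>)) \<partial>lborel) = wB \<rho> * (\<integral>\<^sup>+c. wk c * F \<rho> (sqrt \<rho> * c) \<partial>lborel)"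
    proof (cases "0 < \<rho> \<and> \<rho> < 1")
      case False
      have "sq_dens (card I) (\<rho> - x\<^sup>2) * (F \<rho> x * W (1 - \<rho>)) = 0" for x
      proof (cases "x\<^sup>2 < \<rho>")
        case True
        then have "\<rho> > 0" by (rule le_less_trans[OF zero_le_power2])
        then show ?thesis using False by (simp add: W_def)
      qed (simp add: sq_dens_def)
      then have "(\<integral>\<^sup>+x. sq_dens (card I) (\<rho> - x\<^sup>2) * (F \<rho> x * W (1 - \<rho>)) \<partial>lborel) = 0"
        by (simp only: nn_integral_const) simp
      moreover have "wB \<rho> = 0" using False by (auto simp: wB_def indicator_def)
      ultimately show ?thesis by simp
    next
      case True
      have G: "Gamma (e / 2) > 0" "Gamma ((e - 1) / 2) > 0" "Gamma \<alpha> > 0" "Gamma (d / 2 + \<beta> + 1) > 0"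
        using beta e_ge alpha_pos e_less_d by (auto intro!: Gamma_real_pos)
      have CBk: "CB \<ge> 0" "Ck \<ge> 0" using G by (simp_all add: CB_def Ck_def)
      \<comment> \<open>Substitution of \<open>sqrt \<rho> * c\<close> for \<open>x\<close>; the
        Jacobian \<open>sqrt \<rho>\<close> raises the exponent \<open>(e - 3) / 2\<close> of
        \<open>\<rho>\<close> to the \<open>e / 2 - 1\<close> in \<open>wB\<close>.\<close>
      have "(\<integral>\<^sup>+x. sq_dens (card I) (\<rho> - x\<^sup>2) * (F \<rho> x * W (1 - \<rho>)) \<partial>lborel)
        = ennreal (sqrt \<rho>) * (\<integral>\<^sup>+c. sq_dens (card I) (\<rho> - (0 + sqrt \<rho> * c)\<^sup>2) * (F \<rho> (0 + sqrt \<rho> * c) * W (1 - \<rho>)) \<partial>lborel)"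
        using True by (subst nn_integral_real_affine[where t=0 and c="sqrt \<rho>"]) auto
      also have "\<dots> = (\<integral>\<^sup>+c. ennreal (sqrt \<rho>) * (sq_dens (card I) (\<rho> - (0 + sqrt \<rho> * c)\<^sup>2) * (F \<rho> (0 + sqrt \<rho> * c) * W (1 - \<rho>))) \<partial>lborel)"
        by (rule nn_integral_cmult[symmetric]) simp
      also have "\<dots> = (\<integral>\<^sup>+c. wB \<rho> * (wk c * F \<rho> (sqrt \<rho> * c)) \<partial>lborel)"
      proof (intro nn_integral_cong)
        fix c :: real
        have r: "\<rho> - (0 + sqrt \<rho> * c)\<^sup>2 = \<rho> * (1 - c\<^sup>2)"
          using True by (simp add: power_mult_distrib algebra_simps)
        have iff: "\<rho> * (1 - c\<^sup>2) > 0 \<longleftrightarrow> c \<in> {-1<..<1}"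
          using True by (auto simp: zero_less_mult_iff power2_less_1_iff abs_less_iff abs_square_less_1)
        have "ennreal (sqrt \<rho>) * (sq_dens (card I) (\<rho> * (1 - c\<^sup>2)) * W (1 - \<rho>)) = wB \<rho> * wk c"
        proof (cases "c \<in> {-1<..<1}")
          case c: True
          have c1: "1 - c\<^sup>2 > 0" using iff c True by (simp add: zero_less_mult_iff)
          have p1: "\<rho> powr (e / 2 - 1) = sqrt \<rho> * \<rho> powr ((e - 3) / 2)"
            using True by (simp add: powr_half_sqrt[symmetric] powr_add[symmetric] field_simps)
          have p2: "(e - 1) / 2 - 1 = (e - 3) / 2" by (simp add: field_simps)
          define g where "g = Gamma ((e - 1) / 2)"
          define pp where "pp = pi powr ((e - 1) / 2)"
          have gp: "g > 0" "pp > 0" using G by (simp_all add: g_def pp_def)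
          have S: "sq_dens (card I) (\<rho> * (1 - c\<^sup>2)) = ennreal (pp / g * (\<rho> powr ((e - 3) / 2) * (1 - c\<^sup>2) powr ((e - 3) / 2)))"
            using iff c True c1 by (simp add: sq_dens_def cI(2) p2 powr_mult g_def pp_def)
          have W': "W (1 - \<rho>) = ennreal (CB * Ck / pp * g * (1 - \<rho>) powr (\<alpha> - 1))"
            using True by (simp add: W_def g_def pp_def)
          have wB': "wB \<rho> = ennreal (CB * (sqrt \<rho> * \<rho> powr ((e - 3) / 2)) * (1 - \<rho>) powr (\<alpha> - 1))"
            using True by (simp add: wB_def p1)
          have wk': "wk c = ennreal (Ck * (1 - c\<^sup>2) powr ((e - 3) / 2))"
            using c by (simp add: wk_def)
          show ?thesis
            unfolding S W' wB' wk' using gp CBk True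
            by (simp add: ennreal_mult'[symmetric] ennreal_mult''[symmetric])
        next
          case False
          then show ?thesis using iff by (auto simp: sq_dens_def wk_def indicator_def)
        qed
        then show "ennreal (sqrt \<rho>) * (sq_dens (card I) (\<rho> - (0 + sqrt \<rho> * c)\<^sup>2) * (F \<rho> (0 + sqrt \<rho> * c) * W (1 - \<rho>)))
           = wB \<rho> * (wk c * F \<rho> (sqrt \<rho> * c))"
          unfolding r by (simp add: mult_ac) (metis mult.assoc mult.commute)
      qed
      also have "\<dots> = wB \<rho> * (\<integral>\<^sup>+c. wk c * F \<rho> (sqrt \<rho> * c) \<partial>lborel)"
        by (rule nn_integral_cmult) simp
      finally show ?thesis .
    qed
  qed
  finally show ?thesis .
qed


section \<open>Projection to the coordinates in \<open>I0\<close> and rotation to the reference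
  axis\<close>

definition P :: "real ^ 'd \<Rightarrow> real ^ 'd" where "P z = (\<chi> k. if k \<in> I0 then z $ k else 0)"

lemma inner_P: "P y \<bullet> z = B y z"
proof -
  have "P y \<bullet> z = (\<Sum>i\<in>UNIV. if i \<in> I0 then y $ i * z $ i else 0)"
    unfolding P_def inner_vec_def by (intro sum.cong) auto
  also have "\<dots> = B y z" unfolding B_def by (simp add: sum.If_cases)
  finally show ?thesis .
qed

lemma B_self: "B y y = Q y" by (simp add: B_def Q_def power2_eq_square)

lemma norm_P: "(norm (P y))\<^sup>2 = Q y"
proof -
  have "P (P y) = P y" by (simp add: P_def vec_eq_iff)
  then have "(norm (P y))\<^sup>2 = P y \<bullet> P y" "P y \<bullet> P y = B (P y) (P y)"
    using inner_P[of "P y" "P y"] by (simp_all add: power2_norm_eq_inner)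
  moreover have "B (P y) (P y) = B y y" unfolding B_def by (intro sum.cong) (auto simp: P_def)
  ultimately show ?thesis by (simp add: B_self)
qed

lemma Q_nonneg: "0 \<le> Q y" by (simp add: Q_def sum_nonneg)

lemma Q_diff: "Q (y - z) = Q y + Q z - 2 * B y z"
  unfolding Q_def B_def sum_distrib_left sum.distrib[symmetric] sum_subtractf[symmetric]
  by (intro sum.cong) (auto simp: power2_eq_square algebra_simps)

lemma Q_le_norm: "Q y \<le> (norm y)\<^sup>2"
proof -
  have "Q y \<le> (\<Sum>i\<in>UNIV. (y $ i)\<^sup>2)" unfolding Q_def by (intro sum_mono2) auto
  then show ?thesis by (simp add: norm_vec_def L2_set_def sum_nonneg)
qed

text \<open>The Householder reflection exchanging \<open>P y\<close> with a multiple of the coordinate vector \<open>k0\<close>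
  reduces the joint law of \<open>Q z\<close> and \<open>B y z\<close> to that of \<open>Q z\<close> and \<open>z $ k0\<close>.\<close>

lemma nn_integral_f0_rotate:
  fixes F :: "real \<Rightarrow> real \<Rightarrow> ennreal"
  assumes F: "(\<lambda>(\<rho>, x). F \<rho> x) \<in> borel_measurable (borel \<Otimes>\<^sub>M borel)"
  shows "(\<integral>\<^sup>+z. f0 z * F (Q z) (B y z) \<partial>lborel) = (\<integral>\<^sup>+z. f0 z * F (Q z) (- sqrt (Q y) * z $ k0) \<partial>lborel)"
proof -
  note Fm [measurable (raw)] = measurable_case_prod_compose[OF F]
  \<comment> \<open>The plus sign makes the reflection send \<open>P y\<close> to
    \<open>- sqrt (Q y)\<close> times the axis. If \<open>u = 0\<close>, then \<open>P y\<close> is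
    already that vector and \<open>R\<close> is the identity.\<close>
  define u where "u = P y + sqrt (Q y) *\<^sub>R axis k0 1"
  define R where "R z = z - (2 * (z \<bullet> u) / (u \<bullet> u)) *\<^sub>R u" for z
  have Pu: "P u = u" using k0 by (auto simp: u_def P_def vec_eq_iff axis_def)
  have Pzu: "P z \<bullet> u = z \<bullet> u" for z
    using inner_P[of z u] inner_P[of u z] by (simp add: Pu B_def inner_commute mult.commute)
  have linP: "P (a - t *\<^sub>R b) = P a - t *\<^sub>R P b" for a b t by (simp add: P_def vec_eq_iff)
  have lin: "linear R"
  proof -
    define w where "w = (2 / (u \<bullet> u)) *\<^sub>R u"
    have "R = (\<lambda>z. z - (z \<bullet> w) *\<^sub>R u)" by (rule ext) (simp add: R_def w_def)
    then show ?thesis by (auto intro!: linearI simp: inner_add_left scaleR_add_left scaleR_diff_right)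
  qed
  have nrm: "norm (R z) = norm z" for z
  proof (cases "u = 0")
    case False
    then have "R z \<bullet> R z = z \<bullet> z"
      by (simp add: R_def inner_diff_left inner_diff_right inner_commute[of u z] field_simps power2_eq_square)
    then show ?thesis by (simp add: norm_eq_sqrt_inner)
  qed (simp add: R_def)
  have inv: "R (R z) = z" for z
  proof (cases "u = 0")
    case False
    then have "R z \<bullet> u = - (z \<bullet> u)" by (simp add: R_def inner_diff_left field_simps)
    then show ?thesis by (simp add: R_def[of "R z"]) (simp add: R_def)
  qed (simp add: R_def)
  have QR: "Q (R z) = Q z" for z
  proof -
    \<comment> \<open>Since \<open>u\<close> lies in the range of \<open>P\<close>, the reflection
      commutes with \<open>P\<close>, and being an isometry it preserves the norm of the projected
      vector.\<close>
    have "P (R z) = R (P z)" by (simp add: R_def linP Pu Pzu)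
    then show ?thesis using nrm[of "P z"] norm_P by metis
  qed
  have BR: "B y (R z) = - sqrt (Q y) * z $ k0" for z
  proof (cases "u = 0")
    case True
    then have "P y = - sqrt (Q y) *\<^sub>R axis k0 1" by (simp add: u_def eq_neg_iff_add_eq_0)
    then have "P y \<bullet> z = - sqrt (Q y) * z $ k0" by (simp add: inner_axis')
    then show ?thesis using True by (simp add: inner_P R_def)
  next
    case False
    have sq: "sqrt (Q y) * sqrt (Q y) = Q y" using Q_nonneg by simp
    have PyPy: "P y \<bullet> P y = Q y" using norm_P[of y] by (simp add: power2_norm_eq_inner)
    have a: "P y \<bullet> u = Q y + sqrt (Q y) * P y $ k0"
      by (simp add: u_def inner_add_right PyPy inner_axis)
    \<comment> \<open>Both summands of \<open>u\<close> have length \<open>sqrt (Q y)\<close>. With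
      this identity, pairing \<open>P y\<close> with the reflected vector subtracts exactly
      \<open>z \<bullet> u\<close>.\<close>
    have "u \<bullet> u = 2 * (P y \<bullet> u)"
      unfolding a by (simp add: u_def inner_add_right inner_add_left PyPy inner_axis inner_axis' sq Q_nonneg algebra_simps)
    moreover have "u \<bullet> u \<noteq> 0" using False by simp
    ultimately have "P y \<bullet> R z = P y \<bullet> z - z \<bullet> u" by (simp add: R_def inner_diff_right)
    also have "\<dots> = - sqrt (Q y) * z $ k0" by (simp add: u_def inner_add_right inner_axis inner_commute)
    finally show ?thesis by (simp add: inner_P)
  qed
  have f0R: "f0 (R z) = f0 z" for z by (simp add: f0_def nrm indicator_def)
  have "(\<integral>\<^sup>+z. f0 z * F (Q z) (B y z) \<partial>lborel) = (\<integral>\<^sup>+z. f0 (R z) * F (Q (R z)) (B y (R z)) \<partial>lborel)"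
    by (rule nn_integral_lborel_isometric_involution[symmetric]) (use lin nrm inv in auto)
  then show ?thesis by (simp add: QR BR f0R)
qed

section \<open>Distant pairs and the measures of their slices\<close>

definition U_law :: "(real ^ 'd) measure" where "U_law = density lborel f0"

text \<open>The norm conditions exclude only a null set of pairs. With them the slice at a point
  outside the open ball is empty, so that slice bounds hold at every point and not just almost
  everywhere.\<close>

definition far :: "real \<Rightarrow> ((real ^ 'd) \<times> (real ^ 'd)) set" where
  "far s = {(y, z). norm y < 1 \<and> norm z < 1 \<and> (2 - s)\<^sup>2 \<le> Q (y - z)}"

text \<open>By rotation invariance the slice of \<open>far s\<close> at a point \<open>y\<close> of
  the open ball has a measure depending only on \<open>r = Q y\<close>. The plus sign before the
  cosine comes from the minus sign in the reflection.\<close>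

definition slice :: "real \<Rightarrow> real \<Rightarrow> ennreal" where
  "slice s r = (\<integral>\<^sup>+\<rho>. wB \<rho> * (\<integral>\<^sup>+c. wk c * of_bool ((2 - s)\<^sup>2 \<le> r + \<rho> + 2 * sqrt r * (sqrt \<rho> * c)) \<partial>lborel) \<partial>lborel)"

lemma sets_U_law [measurable_cong]: "sets U_law = sets borel" by (simp add: U_law_def)

lemma far_sets [measurable]: "far s \<in> sets (borel \<Otimes>\<^sub>M borel)"
proof -
  have "closed {x :: (real ^ 'd) \<times> (real ^ 'd). (2 - s)\<^sup>2 \<le> Q (fst x - snd x)}"
    unfolding Q_def by (intro closed_Collect_le continuous_intros)
  moreover have "open {x :: (real ^ 'd) \<times> (real ^ 'd). norm (fst x) < 1 \<and> norm (snd x) < 1}"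
    by (intro open_Collect_conj open_Collect_less continuous_intros)
  moreover have "far s = {x. (2 - s)\<^sup>2 \<le> Q (fst x - snd x)} \<inter> {x. norm (fst x) < 1 \<and> norm (snd x) < 1}"
    by (auto simp: far_def)
  ultimately show ?thesis by (simp add: borel_prod)
qed

lemma far_sym: "(y, z) \<in> far s \<Longrightarrow> (z, y) \<in> far s"
  by (auto simp: far_def Q_diff B_def mult.commute)

lemma emeasure_slice:
  assumes y: "norm y < 1"
  shows "emeasure U_law (Pair y -` far s) = slice s (Q y)"
proof -
  define F where "F \<rho> x = (of_bool ((2 - s)\<^sup>2 \<le> Q y + \<rho> - 2 * x) :: ennreal)" for \<rho> x
  have Fm: "(\<lambda>(\<rho>, x). F \<rho> x) \<in> borel_measurable (borel \<Otimes>\<^sub>M borel)"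
    unfolding F_def case_prod_beta of_bool_def by measurable
  have Fm': "(\<lambda>(\<rho>, x). F \<rho> (- sqrt (Q y) * x)) \<in> borel_measurable (borel \<Otimes>\<^sub>M borel)"
    unfolding F_def case_prod_beta of_bool_def by measurable
  have [measurable]: "Pair y -` far s \<in> sets borel" using sets_Pair1[OF far_sets] by simp
  have "emeasure U_law (Pair y -` far s) = (\<integral>\<^sup>+z. f0 z * indicator (Pair y -` far s) z \<partial>lborel)"
    unfolding U_law_def by (rule emeasure_density) auto
  also have "\<dots> = (\<integral>\<^sup>+z. f0 z * F (Q z) (B y z) \<partial>lborel)"
    using y by (intro nn_integral_cong) (auto simp: f0_def far_def F_def Q_diff indicator_def)
  also have "\<dots> = (\<integral>\<^sup>+z. f0 z * F (Q z) (- sqrt (Q y) * z $ k0) \<partial>lborel)"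
    by (rule nn_integral_f0_rotate[OF Fm])
  also have "\<dots> = (\<integral>\<^sup>+\<rho>. wB \<rho> * (\<integral>\<^sup>+c. wk c * F \<rho> (- sqrt (Q y) * (sqrt \<rho> * c)) \<partial>lborel) \<partial>lborel)"
    by (rule nn_integral_f0_polar[OF Fm'])
  also have "\<dots> = slice s (Q y)"
    unfolding slice_def F_def by (simp add: mult_ac)
  finally show ?thesis .
qed

lemma slice_measurable [measurable]: "slice s \<in> borel_measurable borel"
  unfolding slice_def of_bool_def by measurable

lemma CB_pos: "CB > 0" and Ck_pos: "Ck > 0" and c0_pos: "c0 > 0"
proof -
  have "Gamma (e / 2) > 0" "Gamma ((e - 1) / 2) > 0" "Gamma \<alpha> > 0" "Gamma (d / 2 + \<beta> + 1) > 0" "Gamma (\<beta> + 1) > 0"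
    using beta e_ge alpha_pos e_less_d by (auto intro!: Gamma_real_pos)
  then show "CB > 0" "Ck > 0" "c0 > 0" by (simp_all add: CB_def Ck_def c0_def)
qed

lemma nn_integral_wB: "(\<integral>\<^sup>+\<rho>. wB \<rho> \<partial>lborel) = 1"
proof -
  have "(\<integral>\<^sup>+\<rho>. wB \<rho> \<partial>lborel) = (\<integral>\<^sup>+\<rho>. ennreal CB * (ennreal (\<rho> powr (e / 2 - 1) * (1 - \<rho>) powr (\<alpha> - 1)) * indicator {0<..<1} \<rho>) \<partial>lborel)"
    using CB_pos by (intro nn_integral_cong) (simp add: wB_def indicator_def ennreal_mult'[symmetric] mult_ac)
  also have "\<dots> = ennreal CB * ennreal (Beta (e / 2) \<alpha>)"
    using nn_integral_Beta[of "e / 2" \<alpha> 1] e_ge alpha_pos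
    by (subst nn_integral_cmult) simp_all
  also have "CB * Beta (e / 2) \<alpha> = 1"
  proof -
    have "e / 2 + \<alpha> = d / 2 + \<beta> + 1" by (simp add: \<alpha>_def field_simps)
    moreover have "Gamma (e / 2) > 0" "Gamma \<alpha> > 0" "Gamma (d / 2 + \<beta> + 1) > 0"
      using beta e_ge alpha_pos e_less_d by (auto intro!: Gamma_real_pos)
    ultimately show ?thesis by (simp add: CB_def Beta_def)
  qed
  then have "ennreal CB * ennreal (Beta (e / 2) \<alpha>) = 1"
    using CB_pos by (simp add: ennreal_mult'[symmetric])
  finally show ?thesis .
qed

text \<open>No integral is evaluated: the polar formula for the constant function 1 identifies this
  mass with that of \<open>U_law\<close>, which is 1 once \<open>U_law\<close> is known to be the
  law of a random vector.\<close>

lemma nn_integral_wk: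
  assumes "emeasure U_law UNIV = 1"
  shows "(\<integral>\<^sup>+c. wk c \<partial>lborel) = 1"
proof -
  have "1 = (\<integral>\<^sup>+z. f0 z * (\<lambda>_ _. 1) (Q z) (z $ k0) \<partial>lborel)"
    using assms by (simp add: U_law_def emeasure_density)
  also have "\<dots> = (\<integral>\<^sup>+\<rho>. wB \<rho> * (\<integral>\<^sup>+c. wk c \<partial>lborel) \<partial>lborel)"
    by (subst nn_integral_f0_polar) auto
  also have "\<dots> = (\<integral>\<^sup>+c. wk c \<partial>lborel)"
    by (subst nn_integral_multc) (simp_all add: nn_integral_wB)
  finally show ?thesis ..
qed

text \<open>The slice at \<open>y\<close> enters through \<open>Q y\<close> only, so the polar
  formula applies a second time, now with an integrand in which the cosine does not occur.\<close>

lemma emeasure_far: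
  assumes 1: "emeasure U_law UNIV = 1"
  shows "emeasure (U_law \<Otimes>\<^sub>M U_law) (far s) = (\<integral>\<^sup>+\<rho>. wB \<rho> * slice s \<rho> \<partial>lborel)"
proof -
  interpret U: prob_space U_law by standard (use 1 in \<open>simp add: U_law_def\<close>)
  have "far s \<in> sets (U_law \<Otimes>\<^sub>M U_law)"
    using far_sets sets_pair_measure_cong[OF sets_U_law sets_U_law] by simp
  then have "emeasure (U_law \<Otimes>\<^sub>M U_law) (far s) = (\<integral>\<^sup>+y. emeasure U_law (Pair y -` far s) \<partial>U_law)"
    by (rule U.emeasure_pair_measure_alt)
  also have "\<dots> = (\<integral>\<^sup>+y. (if norm y < 1 then slice s (Q y) else 0) \<partial>U_law)"
  proof (rule nn_integral_cong)
    fix y :: "real ^ 'd"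
    have "Pair y -` far s = {}" if "\<not> norm y < 1" using that by (auto simp: far_def)
    then show "emeasure U_law (Pair y -` far s) = (if norm y < 1 then slice s (Q y) else 0)"
      by (cases "norm y < 1") (simp_all add: emeasure_slice)
  qed
  also have "\<dots> = (\<integral>\<^sup>+y. f0 y * (if norm y < 1 then slice s (Q y) else 0) \<partial>lborel)"
    unfolding U_law_def by (rule nn_integral_density) auto
  also have "\<dots> = (\<integral>\<^sup>+y. f0 y * (\<lambda>\<rho> _. slice s \<rho>) (Q y) (y $ k0) \<partial>lborel)"
    by (intro nn_integral_cong) (auto simp: f0_def)
  also have "\<dots> = (\<integral>\<^sup>+\<rho>. wB \<rho> * (\<integral>\<^sup>+c. wk c * slice s \<rho> \<partial>lborel) \<partial>lborel)"
    by (subst nn_integral_f0_polar) auto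
  also have "\<dots> = (\<integral>\<^sup>+\<rho>. wB \<rho> * slice s \<rho> \<partial>lborel)"
    by (simp add: nn_integral_multc nn_integral_wk[OF 1])
  finally show ?thesis .
qed

end

section \<open>Asymptotics of the pair probability\<close>

lemma nn_integral_triple:
  fixes f :: "real \<times> real \<times> real \<Rightarrow> ennreal"
  assumes [measurable]: "f \<in> borel_measurable (borel \<Otimes>\<^sub>M borel \<Otimes>\<^sub>M borel)"
  shows "(\<integral>\<^sup>+y. \<integral>\<^sup>+x. \<integral>\<^sup>+w. f (y, x, w) \<partial>lborel \<partial>lborel \<partial>lborel) = (\<integral>\<^sup>+v. f v \<partial>(lborel \<Otimes>\<^sub>M lborel \<Otimes>\<^sub>M lborel))"
proof -
  have LL: "sigma_finite_measure (lborel \<Otimes>\<^sub>M lborel :: (real \<times> real) measure)"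
    by (simp add: lborel_prod sigma_finite_lborel)
  have "(\<integral>\<^sup>+v. f v \<partial>(lborel \<Otimes>\<^sub>M lborel \<Otimes>\<^sub>M lborel)) = (\<integral>\<^sup>+y. \<integral>\<^sup>+v. f (y, v) \<partial>(lborel \<Otimes>\<^sub>M lborel) \<partial>lborel)"
    by (rule sigma_finite_measure.nn_integral_fst[OF LL, symmetric]) simp
  also have "\<dots> = (\<integral>\<^sup>+y. \<integral>\<^sup>+x. \<integral>\<^sup>+w. f (y, x, w) \<partial>lborel \<partial>lborel \<partial>lborel)"
  proof (rule nn_integral_cong)
    fix y :: real
    show "(\<integral>\<^sup>+v. f (y, v) \<partial>(lborel \<Otimes>\<^sub>M lborel)) = (\<integral>\<^sup>+x. \<integral>\<^sup>+w. f (y, x, w) \<partial>lborel \<partial>lborel)"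
      by (rule lborel.nn_integral_fst[symmetric, of "\<lambda>v. f (y, v)" lborel, simplified])
  qed
  finally show ?thesis ..
qed

text \<open>Each line in the direction of \<open>w\<close> meets the plane in one point. This plane
  bounds the limit region, and pointwise convergence of the integrands is claimed only off
  it.\<close>

lemma AE_lborel_triple_plane:
  "AE v in lborel \<Otimes>\<^sub>M lborel \<Otimes>\<^sub>M lborel. fst v + fst (snd v) + snd (snd v) / 2 \<noteq> (1::real)"
proof (rule AE_I')
  define N where "N = {v. fst v + fst (snd v) + snd (snd v) / 2 = (1::real)}"
  have "closed N" unfolding N_def by (intro closed_Collect_eq continuous_intros) auto
  then have [measurable]: "N \<in> sets (borel \<Otimes>\<^sub>M borel \<Otimes>\<^sub>M borel)"
    using borel_closed[of N] unfolding borel_prod by blast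
  have "(\<integral>\<^sup>+v. indicator N v \<partial>(lborel \<Otimes>\<^sub>M lborel \<Otimes>\<^sub>M lborel)) = (\<integral>\<^sup>+y. \<integral>\<^sup>+x. \<integral>\<^sup>+w. indicator N (y, x, w) \<partial>lborel \<partial>lborel \<partial>lborel)"
    by (rule nn_integral_triple[symmetric]) simp
  also have "\<dots> = (\<integral>\<^sup>+y. \<integral>\<^sup>+x. \<integral>\<^sup>+w. indicator {2 * (1 - y - x)} (w::real) \<partial>lborel \<partial>lborel \<partial>lborel)"
    by (intro nn_integral_cong) (auto simp: N_def indicator_def field_simps)
  also have "\<dots> = 0" by simp
  finally have "(\<integral>\<^sup>+v. indicator N v \<partial>(lborel \<Otimes>\<^sub>M lborel \<Otimes>\<^sub>M lborel)) = 0" .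
  then show "N \<in> null_sets (lborel \<Otimes>\<^sub>M lborel \<Otimes>\<^sub>M lborel)"
    by (subst (asm) nn_integral_indicator) (auto simp: null_sets_def)
  show "{v \<in> space (lborel \<Otimes>\<^sub>M lborel \<Otimes>\<^sub>M lborel). \<not> fst v + fst (snd v) + snd (snd v) / 2 \<noteq> (1::real)} \<subseteq> N"
    by (auto simp: N_def)
qed

text \<open>The condition that two projected points of squared norms \<open>r\<close> and \<open>\<rho>\<close> enclosing an
  angle with cosine \<open>- (1 - s * w)\<close> have distance at least \<open>2 - s\<close>.\<close>

definition far_cond :: "real \<Rightarrow> real \<Rightarrow> real \<Rightarrow> real \<Rightarrow> bool" where
  "far_cond s r \<rho> w \<longleftrightarrow> (2 - s)\<^sup>2 \<le> r + \<rho> + 2 * sqrt r * (sqrt \<rho> * (1 - s * w))"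

text \<open>The condition forces \<open>2 - s \<le> sqrt r + sqrt \<rho>\<close>, so both roots are
  at least \<open>1 - s\<close>; what remains of the inequality bounds the loss due to the angle. In
  the rescaled variables the integrand is thereby confined to a region independent of
  \<open>s\<close>, as domination requires.\<close>

lemma far_cond_localize:
  assumes s: "0 < s" "s \<le> 1/8" and r: "0 \<le> r" "r \<le> 1" "0 \<le> \<rho>" "\<rho> \<le> 1" and w: "0 \<le> w"
    and c: "far_cond s r \<rho> w"
  shows "r \<ge> 1 - 2 * s" "\<rho> \<ge> 1 - 2 * s" "w \<le> 8"
proof -
  define a b where "a = sqrt r" and "b = sqrt \<rho>"
  have ab: "0 \<le> a" "a \<le> 1" "0 \<le> b" "b \<le> 1" "r = a\<^sup>2" "\<rho> = b\<^sup>2" using r by (auto simp: a_def b_def)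
  have c': "(2 - s)\<^sup>2 \<le> a\<^sup>2 + b\<^sup>2 + 2 * a * b * (1 - s * w)"
    using c unfolding far_cond_def a_def[symmetric] b_def[symmetric] ab(5,6)[symmetric] by (simp add: mult.assoc)
  have nn: "0 \<le> a * b * (s * w)" using ab s w by simp
  have "(2 - s)\<^sup>2 \<le> (a + b)\<^sup>2" using c' nn by (simp add: power2_eq_square algebra_simps)
  then have "2 - s \<le> a + b" using ab by (intro power2_le_imp_le[of "2 - s"]) auto
  then have 1: "a \<ge> 1 - s" "b \<ge> 1 - s" using ab by auto
  have "(1 - s)\<^sup>2 \<le> a\<^sup>2" "(1 - s)\<^sup>2 \<le> b\<^sup>2" using 1 s by (auto intro!: power_mono)
  moreover have "1 - 2 * s \<le> (1 - s)\<^sup>2" by (simp add: power2_eq_square algebra_simps)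
  ultimately show "r \<ge> 1 - 2 * s" "\<rho> \<ge> 1 - 2 * s" unfolding ab by linarith+
  have "(a + b)\<^sup>2 \<le> 2\<^sup>2" using ab by (intro power_mono) auto
  then have "2 * (a * b) * (s * w) \<le> 4 * s"
  proof -
    have "a\<^sup>2 + b\<^sup>2 + 2 * a * b * (1 - s * w) = (a + b)\<^sup>2 - 2 * (a * b) * (s * w)" "(2 - s)\<^sup>2 = 4 - 4 * s + s\<^sup>2"
      by (simp_all add: power2_eq_square algebra_simps)
    moreover have "(2::real)\<^sup>2 = 4" by simp
    ultimately show ?thesis using c' zero_le_power2[of s] \<open>(a + b)\<^sup>2 \<le> 2\<^sup>2\<close> by linarith
  qed
  \<comment> \<open>For \<open>s \<le> 1/8\<close> the crude bounds \<open>a \<ge> 1/2\<close> and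
    \<open>b \<ge> 1/2\<close> suffice; they produce the 8 in the conclusion.\<close>
  moreover have "1/4 \<le> a * b"
  proof -
    have "(1/2) * (1/2) \<le> a * b" using 1 s by (intro mult_mono) auto
    then show ?thesis by simp
  qed
  then have "2 * (1/4) * (s * w) \<le> 2 * (a * b) * (s * w)" using s w by (intro mult_right_mono) auto
  ultimately have "(1/2) * (s * w) \<le> 4 * s" by linarith
  then show "w \<le> 8" using s by (simp add: field_simps)
qed

text \<open>The difference \<open>\<psi>\<close> of the two sides of \<open>far_cond\<close>
  vanishes at \<open>s = 0\<close> and has derivative \<open>D = 4 * (1 - y - x - w / 2)\<close>
  there. Off the plane \<open>D\<close> is nonzero, so \<open>\<psi> (s n)\<close> eventually has
  the sign of \<open>D\<close>.\<close>

lemma far_cond_eventually: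
  fixes s :: "nat \<Rightarrow> real"
  assumes s: "s \<longlonglongrightarrow> 0" "\<And>n. s n > 0" and ne: "y + x + w / 2 \<noteq> 1"
  shows "eventually (\<lambda>n. far_cond (s n) (1 - 2 * s n * y) (1 - 2 * s n * x) w \<longleftrightarrow> y + x + w / 2 \<le> 1) sequentially"
proof -
  define \<psi> where "\<psi> s = (1 - 2 * s * y) + (1 - 2 * s * x) + 2 * sqrt (1 - 2 * s * y) * (sqrt (1 - 2 * s * x) * (1 - s * w)) - (2 - s)\<^sup>2" for s
  define D where "D = 4 - 4 * (y + x) - 2 * w"
  have "(\<psi> has_real_derivative D) (at 0)"
    unfolding \<psi>_def D_def by (auto intro!: derivative_eq_intros simp: field_simps)
  then have "((\<lambda>h. \<psi> h / h) \<longlongrightarrow> D) (at 0)"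
    unfolding DERIV_def by (simp add: \<psi>_def)
  moreover have "filterlim s (at 0) sequentially"
    using s by (auto simp: filterlim_at less_imp_neq[symmetric])
  ultimately have lim: "(\<lambda>n. \<psi> (s n) / s n) \<longlonglongrightarrow> D" by (rule filterlim_compose)
  have iff: "far_cond (s n) (1 - 2 * s n * y) (1 - 2 * s n * x) w \<longleftrightarrow> 0 \<le> \<psi> (s n)" for n
    by (auto simp: far_cond_def \<psi>_def)
  show ?thesis
  proof (cases "D > 0")
    case True
    then have "eventually (\<lambda>n. \<psi> (s n) / s n > 0) sequentially" using order_tendstoD(1)[OF lim] by simp
    then show ?thesis
      by eventually_elim (use s(2) True in \<open>auto simp: iff D_def zero_less_divide_iff dest: less_imp_not_less less_imp_le\<close>)
  next
    case False
    then have "D < 0" using ne by (auto simp: D_def)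
    then have "eventually (\<lambda>n. \<psi> (s n) / s n < 0) sequentially" using order_tendstoD(2)[OF lim] by simp
    then show ?thesis
    proof eventually_elim
      case (elim n)
      then have "\<psi> (s n) < 0" using s(2)[of n] by (simp add: divide_less_0_iff)
      then show ?case using \<open>D < 0\<close> unfolding iff by (simp add: D_def)
    qed
  qed
qed

section \<open>Rescaled densities and their majorants\<close>

context pearson_ball begin

text \<open>The exponent of \<open>s\<close> in the pair probability: \<open>\<alpha>\<close> for
  each of the two squared norms and \<open>(e - 1) / 2\<close> for the cosine.\<close>

definition \<kappa> :: real where "\<kappa> = 2 * \<alpha> + (e - 1) / 2"

text \<open>\<open>gB\<close> and \<open>gk\<close> are \<open>wB\<close> and \<open>wk\<close> in
  the variables \<open>x\<close> and \<open>w\<close>, stripped of constants and powers of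
  \<open>s\<close>. The functions \<open>hB\<close> and \<open>hk\<close> majorise them on the
  region from \<open>far_cond_localize\<close>, uniformly in \<open>s \<le> 1/8\<close>.\<close>

definition gB :: "real \<Rightarrow> real \<Rightarrow> real" where
  "gB s x = x powr (\<alpha> - 1) * (1 - 2 * s * x) powr (e / 2 - 1) * indicator {0<..<1 / (2 * s)} x"

definition gk :: "real \<Rightarrow> real \<Rightarrow> real" where
  "gk s w = w powr ((e - 3) / 2) * (2 - s * w) powr ((e - 3) / 2) * indicator {0<..<2 / s} w"

definition hB :: "real \<Rightarrow> real" where "hB x = x powr (\<alpha> - 1) * indicator {0<..1} x"
definition hk :: "real \<Rightarrow> real" where "hk w = 2 powr e * w powr ((e - 3) / 2) * indicator {0<..8} w"

lemma measurable_g [measurable]: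
  "gB s \<in> borel_measurable borel" "gk s \<in> borel_measurable borel"
  "hB \<in> borel_measurable borel" "hk \<in> borel_measurable borel"
  unfolding gB_def gk_def hB_def hk_def by measurable

lemma g_nonneg: "0 \<le> gB s x" "0 \<le> gk s w" "0 \<le> hB x" "0 \<le> hk w"
  by (auto simp: gB_def gk_def hB_def hk_def indicator_def)

lemma wB_scaled:
  assumes "s > 0"
  shows "ennreal (2 * s) * wB (1 - 2 * s * x) = ennreal (CB * (2 * s) powr \<alpha>) * ennreal (gB s x)"
proof -
  have "1 - 2 * s * x \<in> {0<..<1} \<longleftrightarrow> x \<in> {0<..<1 / (2 * s)}"
    using assms by (auto simp: field_simps zero_less_mult_iff)
  moreover have "2 * s * (2 * s * x) powr (\<alpha> - 1) = (2 * s) powr \<alpha> * x powr (\<alpha> - 1)" if "x > 0"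
    using assms that powr_add[of "2 * s" 1 "\<alpha> - 1"] by (simp add: powr_mult)
  ultimately show ?thesis
    using assms CB_pos by (cases "x \<in> {0<..<1 / (2 * s)}")
      (auto simp: wB_def gB_def ennreal_mult'[symmetric] mult_ac)
qed

text \<open>Here \<open>1 - c\<^sup>2 = s * w * (2 - s * w)\<close>, so the density yields
  \<open>s powr ((e - 3) / 2)\<close>, and the Jacobian adds one more factor
  \<open>s\<close>.\<close>

lemma wk_scaled:
  assumes "s > 0"
  shows "ennreal s * wk (1 - s * w) = ennreal (Ck * s powr ((e - 1) / 2)) * ennreal (gk s w)"
proof -
  have iff: "1 - s * w \<in> {-1<..<1} \<longleftrightarrow> w \<in> {0<..<2 / s}"
    using assms by (auto simp: field_simps zero_less_mult_iff)
  have "s * (1 - (1 - s * w)\<^sup>2) powr ((e - 3) / 2) = s powr ((e - 1) / 2) * (w powr ((e - 3) / 2) * (2 - s * w) powr ((e - 3) / 2))"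
    if "w \<in> {0<..<2 / s}"
  proof -
    have "1 - (1 - s * w)\<^sup>2 = s * w * (2 - s * w)" by (simp add: power2_eq_square algebra_simps)
    moreover have "s powr ((e - 1) / 2) = s * s powr ((e - 3) / 2)"
      using assms powr_add[of s 1 "(e - 3) / 2"] by (simp add: field_simps)
    moreover have "2 - s * w > 0" using that assms by (simp add: field_simps)
    ultimately show ?thesis using assms that by (simp add: powr_mult)
  qed
  then show ?thesis
    using assms Ck_pos iff by (cases "w \<in> {0<..<2 / s}")
      (auto simp: wk_def gk_def ennreal_mult'[symmetric] mult_ac)
qed

lemma slice_scaled:
  assumes s: "s > 0"
  shows "slice s r = ennreal (CB * (2 * s) powr \<alpha> * (Ck * s powr ((e - 1) / 2))) *
    (\<integral>\<^sup>+x. \<integral>\<^sup>+w. ennreal (gB s x * gk s w * of_bool (far_cond s r (1 - 2 * s * x) w)) \<partial>lborel \<partial>lborel)"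
proof -
  define A where "A = ennreal (CB * (2 * s) powr \<alpha>)"
  define A' where "A' = ennreal (Ck * s powr ((e - 1) / 2))"
  have inner: "(\<integral>\<^sup>+c. wk c * of_bool ((2 - s)\<^sup>2 \<le> r + \<rho> + 2 * sqrt r * (sqrt \<rho> * c)) \<partial>lborel)
     = A' * (\<integral>\<^sup>+w. ennreal (gk s w) * of_bool (far_cond s r \<rho> w) \<partial>lborel)" for \<rho>
  proof -
    have "(\<integral>\<^sup>+c. wk c * of_bool ((2 - s)\<^sup>2 \<le> r + \<rho> + 2 * sqrt r * (sqrt \<rho> * c)) \<partial>lborel)
      = ennreal s * (\<integral>\<^sup>+w. wk (1 + (- s) * w) * of_bool (far_cond s r \<rho> w) \<partial>lborel)"
      using s unfolding far_cond_def of_bool_def by (subst nn_integral_real_affine[where t=1 and c="-s"]) simp_all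
    also have "\<dots> = (\<integral>\<^sup>+w. ennreal s * (wk (1 + (- s) * w) * of_bool (far_cond s r \<rho> w)) \<partial>lborel)"
      unfolding far_cond_def of_bool_def by (rule nn_integral_cmult[symmetric]) measurable
    also have "\<dots> = (\<integral>\<^sup>+w. A' * (ennreal (gk s w) * of_bool (far_cond s r \<rho> w)) \<partial>lborel)"
      using wk_scaled[OF s] by (intro nn_integral_cong) (simp add: A'_def mult.assoc[symmetric])
    also have "\<dots> = A' * (\<integral>\<^sup>+w. ennreal (gk s w) * of_bool (far_cond s r \<rho> w) \<partial>lborel)"
      unfolding far_cond_def of_bool_def by (rule nn_integral_cmult) measurable
    finally show ?thesis .
  qed
  define T where "T \<rho> = (\<integral>\<^sup>+w. ennreal (gk s w) * of_bool (far_cond s r \<rho> w) \<partial>lborel)" for \<rho>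
  have [measurable]: "T \<in> borel_measurable borel"
    unfolding T_def far_cond_def of_bool_def by measurable
  have "slice s r = (\<integral>\<^sup>+\<rho>. wB \<rho> * (A' * T \<rho>) \<partial>lborel)"
    unfolding slice_def inner T_def ..
  also have "\<dots> = ennreal (2 * s) * (\<integral>\<^sup>+x. wB (1 + (- (2 * s)) * x) * (A' * T (1 + (- (2 * s)) * x)) \<partial>lborel)"
    using s by (subst nn_integral_real_affine[where t=1 and c="- (2 * s)"]) simp_all
  also have "\<dots> = (\<integral>\<^sup>+x. ennreal (2 * s) * (wB (1 + (- (2 * s)) * x) * (A' * T (1 + (- (2 * s)) * x))) \<partial>lborel)"
    by (rule nn_integral_cmult[symmetric]) measurable
  also have "\<dots> = (\<integral>\<^sup>+x. (A * A') * (ennreal (gB s x) * T (1 - 2 * s * x)) \<partial>lborel)"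
  proof (rule nn_integral_cong)
    fix x :: real
    have "ennreal (2 * s) * (wB (1 + (- (2 * s)) * x) * (A' * T (1 + (- (2 * s)) * x)))
      = (ennreal (2 * s) * wB (1 - 2 * s * x)) * (A' * T (1 - 2 * s * x))" by (simp add: mult.assoc)
    then show "ennreal (2 * s) * (wB (1 + (- (2 * s)) * x) * (A' * T (1 + (- (2 * s)) * x))) = (A * A') * (ennreal (gB s x) * T (1 - 2 * s * x))"
      unfolding wB_scaled[OF s] by (simp add: A_def mult_ac)
  qed
  also have "\<dots> = (A * A') * (\<integral>\<^sup>+x. ennreal (gB s x) * T (1 - 2 * s * x) \<partial>lborel)"
    by (rule nn_integral_cmult) measurable
  also have "(\<integral>\<^sup>+x. ennreal (gB s x) * T (1 - 2 * s * x) \<partial>lborel)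
    = (\<integral>\<^sup>+x. \<integral>\<^sup>+w. ennreal (gB s x * gk s w * of_bool (far_cond s r (1 - 2 * s * x) w)) \<partial>lborel \<partial>lborel)"
  proof (rule nn_integral_cong)
    fix x :: real
    have "ennreal (gB s x) * T (1 - 2 * s * x) = (\<integral>\<^sup>+w. ennreal (gB s x) * (ennreal (gk s w) * of_bool (far_cond s r (1 - 2 * s * x) w)) \<partial>lborel)"
      unfolding T_def far_cond_def of_bool_def by (rule nn_integral_cmult[symmetric]) measurable
    also have "\<dots> = (\<integral>\<^sup>+w. ennreal (gB s x * gk s w * of_bool (far_cond s r (1 - 2 * s * x) w)) \<partial>lborel)"
      by (intro nn_integral_cong) (auto simp: ennreal_mult g_nonneg)
    finally show "ennreal (gB s x) * T (1 - 2 * s * x) = (\<integral>\<^sup>+w. ennreal (gB s x * gk s w * of_bool (far_cond s r (1 - 2 * s * x) w)) \<partial>lborel)" .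
  qed
  also have "A * A' = ennreal (CB * (2 * s) powr \<alpha> * (Ck * s powr ((e - 1) / 2)))"
    unfolding A_def A'_def using CB_pos Ck_pos by (simp add: ennreal_mult)
  finally show ?thesis .
qed

text \<open>Localisation gives \<open>x \<le> 1\<close> and \<open>w \<le> 8\<close>. On this range
  the correction factor in \<open>gB\<close> is at most 1 and the one in \<open>gk\<close> is at
  most \<open>2 powr e\<close>.\<close>

lemma g_le_h:
  assumes s: "0 < s" "s \<le> 1/8" and r: "0 \<le> r" "r \<le> 1"
  shows "gB s x * gk s w * of_bool (far_cond s r (1 - 2 * s * x) w) \<le> hB x * hk w"
proof (cases "x \<in> {0<..<1 / (2 * s)} \<and> w \<in> {0<..<2 / s} \<and> far_cond s r (1 - 2 * s * x) w")
  case False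
  then show ?thesis using g_nonneg(3)[of x] g_nonneg(4)[of w] by (auto simp: gB_def gk_def)
next
  case True
  then have xw: "0 < x" "2 * s * x < 1" "0 < w" "s * w < 2" using s by (auto simp: field_simps)
  have sx: "0 < s * x" using s xw by simp
  have "1 - 2 * s * x \<ge> 1 - 2 * s" "w \<le> 8"
    using far_cond_localize[OF s r, of "1 - 2 * s * x" w] xw sx True by auto
  then have x1: "x \<le> 1" "w \<le> 8" using s by auto
  have "gB s x \<le> hB x * 1"
    unfolding gB_def hB_def using xw x1 True e_ge sx by (auto intro!: mult_left_le powr_le1)
  moreover have "gk s w \<le> hk w"
  proof -
    have "s * w \<le> (1/8) * 8" using s x1 xw by (intro mult_mono) auto
    then have b: "1 \<le> 2 - s * w" "2 - s * w \<le> 2" using s xw by auto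
    \<comment> \<open>Enlarging the exponent to \<open>e\<close> covers the case
      \<open>e = 2\<close>, where \<open>(e - 3) / 2\<close> is negative; this is why the base had
      to be at least 1.\<close>
    have "(2 - s * w) powr ((e - 3) / 2) \<le> (2 - s * w) powr e" using b e_ge by (intro powr_mono) auto
    also have "\<dots> \<le> 2 powr e" using b e_ge by (intro powr_mono2) auto
    finally show ?thesis unfolding gk_def hk_def using xw x1 True by (auto simp: mult.commute intro!: mult_right_mono)
  qed
  ultimately show ?thesis using True g_nonneg(1)[of s x] g_nonneg(2)[of s w] g_nonneg(3)[of x] by (auto intro!: mult_mono)
qed

lemma nn_integral_hB: "(\<integral>\<^sup>+x. ennreal (hB x) \<partial>lborel) = ennreal (1 / \<alpha>)"
proof -
  have "(\<integral>\<^sup>+x. ennreal (hB x) \<partial>lborel) = (\<integral>\<^sup>+x. ennreal (x powr (\<alpha> - 1)) * indicator {0<..1} x \<partial>lborel)"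
    by (intro nn_integral_cong) (auto simp: hB_def indicator_def)
  then show ?thesis using nn_integral_powr_Ioc[of \<alpha> 1] alpha_pos by simp
qed

text \<open>The singularity at 0 is integrable because \<open>(e - 3) / 2 > -1\<close>.\<close>

lemma nn_integral_hk_finite: "(\<integral>\<^sup>+w. ennreal (hk w) \<partial>lborel) < \<infinity>"
proof -
  have "(\<integral>\<^sup>+w. ennreal (hk w) \<partial>lborel) = (\<integral>\<^sup>+w. ennreal (2 powr e) * (ennreal (w powr ((e - 1) / 2 - 1)) * indicator {0<..8} w) \<partial>lborel)"
    by (intro nn_integral_cong) (auto simp: hk_def indicator_def ennreal_mult'[symmetric] field_simps)
  also have "\<dots> = ennreal (2 powr e) * ennreal (8 powr ((e - 1) / 2) / ((e - 1) / 2))"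
    using e_ge by (subst nn_integral_cmult) (simp_all add: nn_integral_powr_Ioc[of "(e - 1) / 2" 8, simplified])
  finally show ?thesis by (simp add: ennreal_mult_less_top)
qed

text \<open>With one point fixed, only one squared norm and the cosine are integrated, so one factor
  \<open>s powr \<alpha>\<close> of the pair probability is missing. Uniformity in \<open>r\<close>
  up to the value 1 is what makes this usable as the bound \<open>h\<close>.\<close>

lemma slice_le:
  "\<exists>C\<ge>0. \<forall>s r. 0 < s \<longrightarrow> s \<le> 1/8 \<longrightarrow> 0 \<le> r \<longrightarrow> r \<le> 1 \<longrightarrow> slice s r \<le> ennreal (C * s powr (\<alpha> + (e - 1) / 2))"
proof -
  define H where "H = enn2real (\<integral>\<^sup>+w. ennreal (hk w) \<partial>lborel)"
  have H: "(\<integral>\<^sup>+w. ennreal (hk w) \<partial>lborel) = ennreal H" "H \<ge> 0" using nn_integral_hk_finite by (simp_all add: H_def)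
  define C where "C = CB * Ck * 2 powr \<alpha> * (H / \<alpha>)"
  have C0: "C \<ge> 0" using CB_pos Ck_pos H alpha_pos by (simp add: C_def)
  have "slice s r \<le> ennreal (C * s powr (\<alpha> + (e - 1) / 2))" if s: "0 < s" "s \<le> 1/8" and r: "0 \<le> r" "r \<le> 1" for s r
  proof -
    have "(\<integral>\<^sup>+x. \<integral>\<^sup>+w. ennreal (gB s x * gk s w * of_bool (far_cond s r (1 - 2 * s * x) w)) \<partial>lborel \<partial>lborel)
      \<le> (\<integral>\<^sup>+x. \<integral>\<^sup>+w. ennreal (hB x * hk w) \<partial>lborel \<partial>lborel)"
      by (intro nn_integral_mono ennreal_leI g_le_h s r)
    also have "\<dots> = (\<integral>\<^sup>+x. ennreal (hB x) * (\<integral>\<^sup>+w. ennreal (hk w) \<partial>lborel) \<partial>lborel)"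
      by (simp add: ennreal_mult g_nonneg nn_integral_cmult)
    also have "\<dots> = ennreal (1 / \<alpha>) * ennreal H"
      by (subst nn_integral_multc) (simp_all add: nn_integral_hB H)
    also have "\<dots> = ennreal (H / \<alpha>)" using alpha_pos H by (simp add: ennreal_mult'[symmetric])
    finally have "slice s r \<le> ennreal (CB * (2 * s) powr \<alpha> * (Ck * s powr ((e - 1) / 2))) * ennreal (H / \<alpha>)"
      unfolding slice_scaled[OF s(1)] by (intro mult_left_mono) auto
    also have "\<dots> = ennreal (C * s powr (\<alpha> + (e - 1) / 2))"
      using s CB_pos Ck_pos H alpha_pos
      by (simp add: ennreal_mult'[symmetric] C_def powr_mult powr_add mult_ac)
    finally show ?thesis .
  qed
  then show ?thesis using C0 by blast
qed


section \<open>The limiting integral and its value\<close>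

definition lim_integrand :: "real \<times> real \<times> real \<Rightarrow> real" where
  "lim_integrand v = (case v of (y, x, w) \<Rightarrow>
     (y powr (\<alpha> - 1) * indicator {0<..} y) * (x powr (\<alpha> - 1) * indicator {0<..} x) *
     (2 powr ((e - 3) / 2) * w powr ((e - 3) / 2) * indicator {0<..} w) * of_bool (y + x + w / 2 \<le> 1))"

definition lim_const :: real where
  "lim_const = 2 powr (e - 2) / ((e - 1) / 2) * Beta \<alpha> ((e - 1) / 2 + 1) * Beta \<alpha> (\<alpha> + (e - 1) / 2 + 1)"

lemma measurable_lim_integrand [measurable]: "lim_integrand \<in> borel_measurable (borel \<Otimes>\<^sub>M borel \<Otimes>\<^sub>M borel)"
  unfolding lim_integrand_def of_bool_def case_prod_beta by measurable

text \<open>Integrating \<open>w\<close> up to \<open>2 * (1 - y - x)\<close> leaves the power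
  \<open>q\<close> of \<open>1 - y - x\<close>; the integrals over \<open>x\<close> and then over
  \<open>y\<close> are the two beta values in \<open>lim_const\<close>.\<close>

lemma nn_integral_lim_integrand:
  "(\<integral>\<^sup>+v. ennreal (lim_integrand v) \<partial>(lborel \<Otimes>\<^sub>M lborel \<Otimes>\<^sub>M lborel)) = ennreal lim_const"
proof -
  define q where "q = (e - 1) / 2"
  have q: "q > 0" "(e - 3) / 2 = q - 1" using e_ge by (simp_all add: q_def field_simps)
  define c where "c = 2 powr (e - 2) / q"
  have c: "c \<ge> 0" using q by (simp add: c_def)
  \<comment> \<open>The powers of 2 from the integrand and from the upper end \<open>2 * m\<close>
    combine because \<open>2 * q - 1 = e - 2\<close>.\<close>
  have c_eq: "2 powr (q - 1) * (2 powr q / q) = c"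
  proof -
    have "q - 1 + q = e - 2" by (simp add: q_def field_simps)
    moreover have "2 powr (q - 1) * 2 powr q = 2 powr (q - 1 + q)" by (rule powr_add[symmetric])
    ultimately have "2 powr (q - 1) * 2 powr q = 2 powr (e - 2)" by (simp only:)
    then show ?thesis by (simp add: c_def)
  qed
  have inner: "(\<integral>\<^sup>+w. ennreal (lim_integrand (y, x, w)) \<partial>lborel)
      = ennreal (y powr (\<alpha> - 1) * c) * indicator {0<..} y * (ennreal (x powr (\<alpha> - 1) * ((1 - y) - x) powr (q + 1 - 1)) * indicator {0<..<1 - y} x)"
    for y x
  proof (cases "y > 0 \<and> x > 0")
    case False
    then show ?thesis by (auto simp: lim_integrand_def)
  next
    case True
    define m where "m = 1 - y - x"
    have m_iff: "y + x + w / 2 \<le> 1 \<longleftrightarrow> w \<le> 2 * m" for w by (auto simp: m_def)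
    have "(\<integral>\<^sup>+w. ennreal (lim_integrand (y, x, w)) \<partial>lborel)
      = (\<integral>\<^sup>+w. ennreal (y powr (\<alpha> - 1) * x powr (\<alpha> - 1) * 2 powr (q - 1)) * (ennreal (w powr (q - 1)) * indicator {0<..2 * m} w) \<partial>lborel)"
      using True by (intro nn_integral_cong) (auto simp: lim_integrand_def m_iff q(2) indicator_def ennreal_mult'[symmetric] mult_ac)
    also have "\<dots> = ennreal (y powr (\<alpha> - 1) * x powr (\<alpha> - 1) * 2 powr (q - 1)) * (\<integral>\<^sup>+w. ennreal (w powr (q - 1)) * indicator {0<..2 * m} w \<partial>lborel)"
      by (rule nn_integral_cmult) measurable
    also have "\<dots> = ennreal (y powr (\<alpha> - 1) * c) * indicator {0<..} y * (ennreal (x powr (\<alpha> - 1) * ((1 - y) - x) powr (q + 1 - 1)) * indicator {0<..<1 - y} x)"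
    proof (cases "m > 0")
      case m: True
      have p: "(2 * m) powr q = 2 powr q * m powr q" by (rule powr_mult)
      have "y powr (\<alpha> - 1) * x powr (\<alpha> - 1) * 2 powr (q - 1) * ((2 * m) powr q / q)
        = y powr (\<alpha> - 1) * c * (x powr (\<alpha> - 1) * m powr q)"
        unfolding c_eq[symmetric] p by simp
      moreover have "x < 1 - y" using m by (simp add: m_def)
      ultimately show ?thesis
        using m True q c by (simp add: nn_integral_powr_Ioc ennreal_mult'[symmetric] ennreal_mult''[symmetric] m_def[symmetric])
    next
      case m: False
      then have "{0<..2 * m} = {}" "\<not> x < 1 - y" by (auto simp: m_def)
      then show ?thesis by simp
    qed
    finally show ?thesis .
  qed
  have mid: "(\<integral>\<^sup>+x. \<integral>\<^sup>+w. ennreal (lim_integrand (y, x, w)) \<partial>lborel \<partial>lborel)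
    = ennreal (c * Beta \<alpha> (q + 1)) * (ennreal (y powr (\<alpha> - 1) * (1 - y) powr ((\<alpha> + q + 1) - 1)) * indicator {0<..<1} y)" for y
  proof (cases "0 < y \<and> y < 1")
    case False
    then have "indicator {0<..} y * indicator {0<..<1 - y} x = (0 :: ennreal)" for x
      by (auto simp: indicator_def)
    then have "(\<integral>\<^sup>+x. \<integral>\<^sup>+w. ennreal (lim_integrand (y, x, w)) \<partial>lborel \<partial>lborel) = (\<integral>\<^sup>+x. 0 \<partial>(lborel :: real measure))"
      unfolding inner by (intro nn_integral_cong) (auto simp: indicator_def)
    then show ?thesis using False by simp
  next
    case True
    have "(\<integral>\<^sup>+x. \<integral>\<^sup>+w. ennreal (lim_integrand (y, x, w)) \<partial>lborel \<partial>lborel)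
      = ennreal (y powr (\<alpha> - 1) * c) * indicator {0<..} y * (\<integral>\<^sup>+x. ennreal (x powr (\<alpha> - 1) * ((1 - y) - x) powr (q + 1 - 1)) * indicator {0<..<1 - y} x \<partial>lborel)"
      unfolding inner by (rule nn_integral_cmult) measurable
    also have "\<dots> = ennreal (y powr (\<alpha> - 1) * c) * ennreal (Beta \<alpha> (q + 1) * (1 - y) powr (\<alpha> + (q + 1) - 1))"
      using True q alpha_pos by (subst nn_integral_Beta) auto
    also have "\<dots> = ennreal (c * Beta \<alpha> (q + 1)) * (ennreal (y powr (\<alpha> - 1) * (1 - y) powr ((\<alpha> + q + 1) - 1)) * indicator {0<..<1} y)"
      using True c q alpha_pos by (simp add: ennreal_mult'[symmetric] ennreal_mult''[symmetric] Beta_def Gamma_real_pos less_imp_le mult_ac add_ac)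
    finally show ?thesis .
  qed
  have "(\<integral>\<^sup>+v. ennreal (lim_integrand v) \<partial>(lborel \<Otimes>\<^sub>M lborel \<Otimes>\<^sub>M lborel))
     = (\<integral>\<^sup>+y. \<integral>\<^sup>+x. \<integral>\<^sup>+w. ennreal (lim_integrand (y, x, w)) \<partial>lborel \<partial>lborel \<partial>lborel)"
    by (rule nn_integral_triple[symmetric]) measurable
  also have "\<dots> = ennreal (c * Beta \<alpha> (q + 1)) * (\<integral>\<^sup>+y. ennreal (y powr (\<alpha> - 1) * (1 - y) powr ((\<alpha> + q + 1) - 1)) * indicator {0<..<1} y \<partial>lborel)"
    unfolding mid by (rule nn_integral_cmult) measurable
  also have "\<dots> = ennreal (c * Beta \<alpha> (q + 1)) * ennreal (Beta \<alpha> (\<alpha> + q + 1))"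
    using q alpha_pos nn_integral_Beta[of \<alpha> "\<alpha> + q + 1" 1] by simp
  also have "\<dots> = ennreal lim_const"
    using c q alpha_pos by (subst ennreal_mult'[symmetric]) (auto simp: lim_const_def c_def q_def[symmetric] Beta_def Gamma_real_pos less_imp_le)
  finally show ?thesis .
qed

definition far_integrand :: "real \<Rightarrow> real \<times> real \<times> real \<Rightarrow> real" where
  "far_integrand s v = (case v of (y, x, w) \<Rightarrow>
     gB s y * gB s x * gk s w * of_bool (far_cond s (1 - 2 * s * y) (1 - 2 * s * x) w))"

lemma measurable_far_integrand [measurable]: "far_integrand s \<in> borel_measurable (borel \<Otimes>\<^sub>M borel \<Otimes>\<^sub>M borel)"
  unfolding far_integrand_def of_bool_def case_prod_beta far_cond_def by measurable

text \<open>The substitutions for the squared norms contribute \<open>(2 * s) powr \<alpha>\<close>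
  twice, the one for the cosine \<open>s powr ((e - 1) / 2)\<close> once; together they give the
  power \<open>\<kappa>\<close>.\<close>

lemma emeasure_far_scaled:
  assumes 1: "emeasure U_law UNIV = 1" and s: "s > 0"
  shows "emeasure (U_law \<Otimes>\<^sub>M U_law) (far s) = ennreal (CB\<^sup>2 * Ck * 2 powr (2 * \<alpha>) * s powr \<kappa>) *
    (\<integral>\<^sup>+v. ennreal (far_integrand s v) \<partial>(lborel \<Otimes>\<^sub>M lborel \<Otimes>\<^sub>M lborel))"
proof -
  define A where "A = CB * (2 * s) powr \<alpha>"
  define A' where "A' = Ck * s powr ((e - 1) / 2)"
  have A0: "A \<ge> 0" "A' \<ge> 0" using CB_pos Ck_pos by (simp_all add: A_def A'_def)
  define S where "S y = (\<integral>\<^sup>+x. \<integral>\<^sup>+w. ennreal (gB s x * gk s w * of_bool (far_cond s (1 - 2 * s * y) (1 - 2 * s * x) w)) \<partial>lborel \<partial>lborel)" for y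
  have Sm [measurable]: "S \<in> borel_measurable borel" unfolding S_def far_cond_def of_bool_def by measurable
  have "emeasure (U_law \<Otimes>\<^sub>M U_law) (far s) = (\<integral>\<^sup>+\<rho>. wB \<rho> * slice s \<rho> \<partial>lborel)"
    by (rule emeasure_far[OF 1])
  also have "\<dots> = ennreal (2 * s) * (\<integral>\<^sup>+y. wB (1 + (- (2 * s)) * y) * slice s (1 + (- (2 * s)) * y) \<partial>lborel)"
    using s by (subst nn_integral_real_affine[where t=1 and c="- (2 * s)"]) simp_all
  also have "\<dots> = (\<integral>\<^sup>+y. ennreal (2 * s) * (wB (1 + (- (2 * s)) * y) * slice s (1 + (- (2 * s)) * y)) \<partial>lborel)"
    by (rule nn_integral_cmult[symmetric]) measurable
  also have "\<dots> = (\<integral>\<^sup>+y. ennreal (A * A * A') * (ennreal (gB s y) * S y) \<partial>lborel)"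
  proof (rule nn_integral_cong)
    fix y :: real
    have "ennreal (2 * s) * (wB (1 + (- (2 * s)) * y) * slice s (1 + (- (2 * s)) * y))
      = (ennreal (2 * s) * wB (1 - 2 * s * y)) * slice s (1 - 2 * s * y)" by (simp add: mult.assoc)
    also have "\<dots> = ennreal (A * A * A') * (ennreal (gB s y) * S y)"
      unfolding wB_scaled[OF s] slice_scaled[OF s] S_def[symmetric] A_def[symmetric] A'_def[symmetric]
      using A0 by (simp add: ennreal_mult mult_ac)
    finally show "ennreal (2 * s) * (wB (1 + (- (2 * s)) * y) * slice s (1 + (- (2 * s)) * y)) = ennreal (A * A * A') * (ennreal (gB s y) * S y)" .
  qed
  also have "\<dots> = ennreal (A * A * A') * (\<integral>\<^sup>+y. ennreal (gB s y) * S y \<partial>lborel)"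
    by (rule nn_integral_cmult) measurable
  also have "(\<integral>\<^sup>+y. ennreal (gB s y) * S y \<partial>lborel) = (\<integral>\<^sup>+y. \<integral>\<^sup>+x. \<integral>\<^sup>+w. ennreal (far_integrand s (y, x, w)) \<partial>lborel \<partial>lborel \<partial>lborel)"
  proof (rule nn_integral_cong)
    fix y :: real
    have "ennreal (gB s y) * S y = (\<integral>\<^sup>+x. ennreal (gB s y) * (\<integral>\<^sup>+w. ennreal (gB s x * gk s w * of_bool (far_cond s (1 - 2 * s * y) (1 - 2 * s * x) w)) \<partial>lborel) \<partial>lborel)"
      unfolding S_def far_cond_def of_bool_def by (rule nn_integral_cmult[symmetric]) measurable
    also have "\<dots> = (\<integral>\<^sup>+x. \<integral>\<^sup>+w. ennreal (gB s y) * ennreal (gB s x * gk s w * of_bool (far_cond s (1 - 2 * s * y) (1 - 2 * s * x) w)) \<partial>lborel \<partial>lborel)"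
      unfolding far_cond_def of_bool_def by (rule nn_integral_cong) (rule nn_integral_cmult[symmetric], measurable)
    also have "\<dots> = (\<integral>\<^sup>+x. \<integral>\<^sup>+w. ennreal (far_integrand s (y, x, w)) \<partial>lborel \<partial>lborel)"
      by (intro nn_integral_cong) (simp add: far_integrand_def ennreal_mult'[symmetric] g_nonneg mult.assoc)
    finally show "ennreal (gB s y) * S y = (\<integral>\<^sup>+x. \<integral>\<^sup>+w. ennreal (far_integrand s (y, x, w)) \<partial>lborel \<partial>lborel)" .
  qed
  also have "\<dots> = (\<integral>\<^sup>+v. ennreal (far_integrand s v) \<partial>(lborel \<Otimes>\<^sub>M lborel \<Otimes>\<^sub>M lborel))"
    by (rule nn_integral_triple) measurable
  also have "A * A * A' = CB\<^sup>2 * Ck * 2 powr (2 * \<alpha>) * s powr \<kappa>"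
    using s by (simp add: A_def A'_def \<kappa>_def powr_mult power2_eq_square powr_add[symmetric] field_simps)
  finally show ?thesis .
qed

text \<open>Localisation bounds \<open>y\<close>, and \<open>g_le_h\<close> with first squared norm
  \<open>1 - 2 * s * y\<close> takes care of \<open>x\<close> and \<open>w\<close>.\<close>

lemma far_integrand_le:
  assumes s: "0 < s" "s \<le> 1/8"
  shows "far_integrand s (y, x, w) \<le> hB y * (hB x * hk w)"
proof (cases "y \<in> {0<..<1 / (2 * s)} \<and> x \<in> {0<..<1 / (2 * s)} \<and> w \<in> {0<..<2 / s} \<and> far_cond s (1 - 2 * s * y) (1 - 2 * s * x) w")
  case False
  then show ?thesis using g_nonneg(3)[of x] g_nonneg(3)[of y] g_nonneg(4)[of w]
    by (auto simp: far_integrand_def gB_def gk_def)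
next
  case True
  then have xw: "0 < x" "2 * s * x < 1" "0 < y" "2 * s * y < 1" "0 < w" using s by (auto simp: field_simps)
  have sxy: "0 < s * x" "0 < s * y" using s xw by simp_all
  have "1 - 2 * s * y \<ge> 1 - 2 * s"
    using far_cond_localize(1)[OF s, of "1 - 2 * s * y" "1 - 2 * s * x" w] xw sxy True by auto
  then have y1: "y \<le> 1" using s by auto
  have "gB s y \<le> hB y * 1"
    unfolding gB_def hB_def using xw y1 True e_ge sxy by (auto intro!: mult_left_le powr_le1)
  moreover have "gB s x * gk s w * of_bool (far_cond s (1 - 2 * s * y) (1 - 2 * s * x) w) \<le> hB x * hk w"
    by (rule g_le_h[OF s]) (use xw sxy in auto)
  ultimately have "gB s y * (gB s x * gk s w * of_bool (far_cond s (1 - 2 * s * y) (1 - 2 * s * x) w)) \<le> hB y * (hB x * hk w)"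
    using g_nonneg(1,2)[of s] g_nonneg(3)[of y] by (intro mult_mono[where b="hB y"]) auto
  then show ?thesis by (simp add: far_integrand_def mult.assoc)
qed

text \<open>The cutoffs \<open>1 / (2 * s)\<close> and \<open>2 / s\<close> move off to infinity,
  the factors \<open>1 - 2 * s * x\<close> and \<open>2 - s * w\<close> tend to 1 and 2, and the
  truth value settles by \<open>far_cond_eventually\<close>.\<close>

lemma far_integrand_tendsto:
  fixes s :: "nat \<Rightarrow> real"
  assumes s: "s \<longlonglongrightarrow> 0" "\<And>n. s n > 0" and ne: "y + x + w / 2 \<noteq> 1"
  shows "(\<lambda>n. far_integrand (s n) (y, x, w)) \<longlonglongrightarrow> lim_integrand (y, x, w)"
proof -
  have gBlim: "(\<lambda>n. gB (s n) x) \<longlonglongrightarrow> x powr (\<alpha> - 1) * indicator {0<..} x" for x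
  proof (cases "x > 0")
    case True
    have l: "(\<lambda>n. 2 * s n * x) \<longlonglongrightarrow> 2 * 0 * x" by (intro tendsto_intros s)
    have l2: "(\<lambda>n. 1 - 2 * s n * x) \<longlonglongrightarrow> 1" using tendsto_diff[OF tendsto_const[of 1] l] by simp
    have "eventually (\<lambda>n. 2 * s n * x < 1) sequentially" using order_tendstoD(2)[OF l] by simp
    then have ev: "eventually (\<lambda>n. x powr (\<alpha> - 1) * (1 - 2 * s n * x) powr (e / 2 - 1) = gB (s n) x) sequentially"
      by eventually_elim (use s(2) True in \<open>auto simp: gB_def indicator_def field_simps\<close>)
    have "(\<lambda>n. x powr (\<alpha> - 1) * (1 - 2 * s n * x) powr (e / 2 - 1)) \<longlonglongrightarrow> x powr (\<alpha> - 1) * 1 powr (e / 2 - 1)"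
      by (intro tendsto_intros l2) auto
    from Lim_transform_eventually[OF this ev] show ?thesis using True by simp
  qed (auto simp: gB_def)
  have gklim: "(\<lambda>n. gk (s n) w) \<longlonglongrightarrow> 2 powr ((e - 3) / 2) * w powr ((e - 3) / 2) * indicator {0<..} w"
  proof (cases "w > 0")
    case True
    have l: "(\<lambda>n. s n * w) \<longlonglongrightarrow> 0 * w" by (intro tendsto_intros s)
    have l2: "(\<lambda>n. 2 - s n * w) \<longlonglongrightarrow> 2" using tendsto_diff[OF tendsto_const[of 2] l] by simp
    have "eventually (\<lambda>n. s n * w < 2) sequentially" using order_tendstoD(2)[OF l, of 2] by simp
    then have ev: "eventually (\<lambda>n. w powr ((e - 3) / 2) * (2 - s n * w) powr ((e - 3) / 2) = gk (s n) w) sequentially"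
      by eventually_elim (use s(2) True in \<open>auto simp: gk_def indicator_def field_simps\<close>)
    have "(\<lambda>n. w powr ((e - 3) / 2) * (2 - s n * w) powr ((e - 3) / 2)) \<longlonglongrightarrow> w powr ((e - 3) / 2) * 2 powr ((e - 3) / 2)"
      by (intro tendsto_intros l2) auto
    from Lim_transform_eventually[OF this ev] show ?thesis using True by (simp add: mult.commute)
  qed (auto simp: gk_def)
  have "eventually (\<lambda>n. of_bool (y + x + w / 2 \<le> 1) = (of_bool (far_cond (s n) (1 - 2 * s n * y) (1 - 2 * s n * x) w) :: real)) sequentially"
    using far_cond_eventually[OF s ne] by eventually_elim simp
  then have bl: "(\<lambda>n. of_bool (far_cond (s n) (1 - 2 * s n * y) (1 - 2 * s n * x) w) :: real) \<longlonglongrightarrow> of_bool (y + x + w / 2 \<le> 1)"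
    by (rule Lim_transform_eventually[OF tendsto_const])
  show ?thesis
    unfolding far_integrand_def lim_integrand_def prod.case
    by (intro tendsto_mult gBlim gklim bl)
qed

lemma nn_integral_far_integrand_tendsto:
  fixes s :: "nat \<Rightarrow> real"
  assumes s: "s \<longlonglongrightarrow> 0" "\<And>n. s n > 0" "\<And>n. s n \<le> 1/8"
  shows "(\<lambda>n. \<integral>\<^sup>+v. ennreal (far_integrand (s n) v) \<partial>(lborel \<Otimes>\<^sub>M lborel \<Otimes>\<^sub>M lborel)) \<longlonglongrightarrow> ennreal lim_const"
  unfolding nn_integral_lim_integrand[symmetric]
proof (rule nn_integral_dominated_convergence[where w="\<lambda>v. ennreal (hB (fst v) * (hB (fst (snd v)) * hk (snd (snd v))))"])
  show "AE v in lborel \<Otimes>\<^sub>M lborel \<Otimes>\<^sub>M lborel. ennreal (far_integrand (s n) v) \<le> ennreal (hB (fst v) * (hB (fst (snd v)) * hk (snd (snd v))))" for n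
    by (rule AE_I2) (use far_integrand_le[OF s(2) s(3)] in \<open>auto intro!: ennreal_leI\<close>)
  show "AE v in lborel \<Otimes>\<^sub>M lborel \<Otimes>\<^sub>M lborel. (\<lambda>n. ennreal (far_integrand (s n) v)) \<longlonglongrightarrow> ennreal (lim_integrand v)"
    using AE_lborel_triple_plane
  proof eventually_elim
    case (elim v)
    then show ?case using far_integrand_tendsto[OF s(1,2), of "fst v" "fst (snd v)" "snd (snd v)"] by (intro tendsto_ennrealI) simp
  qed
  have "(\<integral>\<^sup>+v. ennreal (hB (fst v) * (hB (fst (snd v)) * hk (snd (snd v)))) \<partial>(lborel \<Otimes>\<^sub>M lborel \<Otimes>\<^sub>M lborel))
    = (\<integral>\<^sup>+y. \<integral>\<^sup>+x. \<integral>\<^sup>+w. ennreal (hB y * (hB x * hk w)) \<partial>lborel \<partial>lborel \<partial>lborel)"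
    by (subst nn_integral_triple[symmetric]) simp_all
  also have "\<dots> = (\<integral>\<^sup>+w. ennreal (hk w) \<partial>lborel) * ennreal (1 / \<alpha>) * ennreal (1 / \<alpha>)"
    by (simp add: ennreal_mult g_nonneg nn_integral_cmult nn_integral_multc nn_integral_hB mult_ac)
  also have "\<dots> < \<infinity>" using nn_integral_hk_finite by (simp add: ennreal_mult_less_top)
  finally show "(\<integral>\<^sup>+v. ennreal (hB (fst v) * (hB (fst (snd v)) * hk (snd (snd v)))) \<partial>(lborel \<Otimes>\<^sub>M lborel \<Otimes>\<^sub>M lborel)) < \<infinity>" .
qed measurable

text \<open>The unit ball volume cancels the powers of \<pi> in \<open>a_const\<close>, which equals
  \<open>2 powr \<alpha> * CB / \<alpha>\<close>; multiplied by \<open>Gamma (\<alpha> + 1)\<close>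
  and squared, it accounts for \<open>CB\<close>, \<open>Gamma \<alpha>\<close> and the power of 2
  depending on \<open>\<alpha>\<close>. The two beta values share the factor
  \<open>Gamma (\<alpha> + (q + 1))\<close>, which cancels.\<close>

lemma sigma_const_eq: "CB\<^sup>2 * Ck * 2 powr (2 * \<alpha>) * lim_const = sigma_const CARD('d) (card I0) \<beta>"
proof -
  define q where "q = (e - 1) / 2"
  have q: "q > 0" using e_ge by (simp add: q_def)
  define A where "A = Gamma (d / 2 + \<beta> + 1)"
  have G: "Gamma (e / 2) > 0" "Gamma q > 0" "Gamma \<alpha> > 0" "A > 0" "Gamma (\<alpha> + (q + 1)) > 0" "Gamma (2 * \<alpha> + q + 1) > 0"
    unfolding A_def using q beta e_ge alpha_pos e_less_d by (auto intro!: Gamma_real_pos)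
  have al: "alpha_const CARD('d) (card I0) \<beta> = \<alpha>" by (simp add: alpha_const_def \<alpha>_def d_def e_def)
  have Ga: "Gamma (\<alpha> + 1) = \<alpha> * Gamma \<alpha>" using alpha_pos by (intro Gamma_plus1) auto
  have Gq: "Gamma (q + 1) = q * Gamma q" using q by (intro Gamma_plus1) auto
  have Ge: "Gamma (e / 2 + 1) = e / 2 * Gamma (e / 2)" using e_ge by (intro Gamma_plus1) auto
  have "a_const CARD('d) (card I0) \<beta> = A / (\<alpha> * Gamma \<alpha>) * pi powr (- (e / 2)) * e * (pi powr (e / 2) / (e / 2 * Gamma (e / 2))) * 2 powr (\<alpha> - 1)"
  proof -
    have *: "(d - e) / 2 + \<beta> + 2 = \<alpha> + 1" "(d - e) / 2 + \<beta> = \<alpha> - 1" by (simp_all add: \<alpha>_def)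
    show ?thesis
      unfolding a_const_def unit_ball_vol_def e_def[symmetric] d_def[symmetric] A_def *(1)
      unfolding *(2) Ga Ge by simp
  qed
  also have "\<dots> = A / (\<alpha> * Gamma \<alpha> * Gamma (e / 2)) * (2 * 2 powr (\<alpha> - 1))"
  proof -
    have "pi powr (- (e / 2)) * pi powr (e / 2) = 1" by (simp add: powr_add[symmetric])
    moreover have "A / (\<alpha> * Gamma \<alpha>) * pi powr (- (e / 2)) * e * (pi powr (e / 2) / (e / 2 * Gamma (e / 2))) * 2 powr (\<alpha> - 1)
      = A / (\<alpha> * Gamma \<alpha> * Gamma (e / 2)) * (2 * 2 powr (\<alpha> - 1)) * (pi powr (- (e / 2)) * pi powr (e / 2))"
      using e_ge G by (simp add: field_simps)
    ultimately show ?thesis by simp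
  qed
  also have "2 * 2 powr (\<alpha> - 1) = 2 powr \<alpha>" using powr_add[of 2 1 "\<alpha> - 1"] by simp
  finally have a: "a_const CARD('d) (card I0) \<beta> = A / (\<alpha> * Gamma \<alpha> * Gamma (e / 2)) * 2 powr \<alpha>" .
  have p2: "2 powr (2 * \<alpha>) = (2 powr \<alpha>)\<^sup>2" by (simp add: power2_eq_square powr_add[symmetric])
  have eq: "(real (card I0) + 1) / 2 + 2 * \<alpha> = 2 * \<alpha> + q + 1" by (simp add: q_def e_def field_simps)
  have BB: "Beta \<alpha> (q + 1) = Gamma \<alpha> * (q * Gamma q) / Gamma (\<alpha> + (q + 1))"
    "Beta \<alpha> (\<alpha> + q + 1) = Gamma \<alpha> * Gamma (\<alpha> + (q + 1)) / Gamma (2 * \<alpha> + q + 1)"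
    by (simp_all add: Beta_def Gq[unfolded add.commute[of q 1]] add_ac)
  have "sigma_const CARD('d) (card I0) \<beta> = 2 powr (e - 2) * Gamma (e / 2) * (A / (\<alpha> * Gamma \<alpha> * Gamma (e / 2)) * 2 powr \<alpha>)\<^sup>2 * (\<alpha> * Gamma \<alpha>)\<^sup>2
     / (sqrt pi * Gamma (2 * \<alpha> + q + 1))"
    unfolding sigma_const_def al a Ga eq by (simp add: e_def)
  also have "\<dots> = CB\<^sup>2 * Ck * 2 powr (2 * \<alpha>) * lim_const"
  proof -
    define g0 g1 g2 where "g0 = Gamma q" and "g1 = Gamma (\<alpha> + (q + 1))" and "g2 = Gamma (2 * \<alpha> + q + 1)"
    have "g0 > 0" "g1 > 0" "g2 > 0" using G by (simp_all add: g0_def g1_def g2_def)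
    then show ?thesis
      unfolding CB_def Ck_def lim_const_def q_def[symmetric] BB p2 A_def[symmetric] g0_def[symmetric] g1_def[symmetric] g2_def[symmetric]
      using G(1,3,4) q alpha_pos by (simp add: field_simps power2_eq_square)
  qed
  finally show ?thesis ..
qed

lemma measure_far_asymp:
  fixes s :: "nat \<Rightarrow> real"
  assumes 1: "emeasure U_law UNIV = 1" and s: "s \<longlonglongrightarrow> 0" "eventually (\<lambda>n. s n > 0) sequentially"
  shows "(\<lambda>n. measure (U_law \<Otimes>\<^sub>M U_law) (far (s n)) / s n powr \<kappa>) \<longlonglongrightarrow> sigma_const CARD('d) (card I0) \<beta>"
proof -
  \<comment> \<open>The convergence result asks for \<open>0 < S n \<le> 1/8\<close> at every
    \<open>n\<close>. \<open>S\<close> meets this throughout and agrees with \<open>s\<close> from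
    some index on.\<close>
  define S where "S n = (if 0 < s n \<and> s n \<le> 1/8 then s n else 1 / (8 + real n))" for n
  define c where "c = CB\<^sup>2 * Ck * 2 powr (2 * \<alpha>)"
  have c: "c \<ge> 0" using Ck_pos by (simp add: c_def)
  have S: "S n > 0" "S n \<le> 1/8" for n by (auto simp: S_def field_simps)
  have evS: "eventually (\<lambda>n. s n = S n) sequentially"
  proof -
    have "eventually (\<lambda>n. s n < 1/8) sequentially" using order_tendstoD(2)[OF s(1), of "1/8"] by simp
    with s(2) show ?thesis by eventually_elim (simp add: S_def)
  qed
  have S0: "S \<longlonglongrightarrow> 0" by (rule Lim_transform_eventually[OF s(1) evS])
  define I where "I n = (\<integral>\<^sup>+v. ennreal (far_integrand (S n) v) \<partial>(lborel \<Otimes>\<^sub>M lborel \<Otimes>\<^sub>M lborel))" for n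
  have "(\<lambda>n. I n) \<longlonglongrightarrow> ennreal lim_const"
    unfolding I_def by (rule nn_integral_far_integrand_tendsto[OF S0 S])
  moreover have l0: "lim_const \<ge> 0"
  proof -
    have "Gamma \<alpha> > 0" "Gamma ((e - 1) / 2 + 1) > 0" "Gamma (\<alpha> + (e - 1) / 2 + 1) > 0"
      "Gamma (\<alpha> + ((e - 1) / 2 + 1)) > 0" "Gamma (\<alpha> + (\<alpha> + (e - 1) / 2 + 1)) > 0"
      using e_ge alpha_pos by (auto intro!: Gamma_real_pos add_pos_nonneg)
    then show ?thesis using e_ge unfolding lim_const_def Beta_def by (intro mult_nonneg_nonneg divide_nonneg_nonneg) auto
  qed
  ultimately have "(\<lambda>n. enn2real (I n)) \<longlonglongrightarrow> lim_const"
    by (rule tendsto_enn2real)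
  then have l: "(\<lambda>n. c * enn2real (I n)) \<longlonglongrightarrow> c * lim_const" by (intro tendsto_mult tendsto_const)
  have "measure (U_law \<Otimes>\<^sub>M U_law) (far (S n)) / S n powr \<kappa> = c * enn2real (I n)" for n
  proof -
    have "measure (U_law \<Otimes>\<^sub>M U_law) (far (S n)) = c * S n powr \<kappa> * enn2real (I n)"
      unfolding measure_def emeasure_far_scaled[OF 1 S(1)] c_def[symmetric] I_def[symmetric]
      using c by (simp add: enn2real_mult)
    then show ?thesis using S(1)[of n] by simp
  qed
  then have ev: "eventually (\<lambda>n. c * enn2real (I n) = measure (U_law \<Otimes>\<^sub>M U_law) (far (s n)) / s n powr \<kappa>) sequentially"
    using evS by (auto elim!: eventually_mono)
  show ?thesis using Lim_transform_eventually[OF l ev] by (simp add: c_def sigma_const_eq)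
qed

end

section \<open>The Poisson limit for distant pairs\<close>

text \<open>The error in \<open>poisson_bound\<close> is at most a constant times
  \<open>(n\<^sup>2 * p) * (n * h)\<close>; the first factor converges, so \<open>n * h\<close>
  tending to 0 removes it. The relation varies with \<open>n\<close>, hence the locale is
  interpreted for one \<open>n\<close> at a time.\<close>

theorem poisson_limit_pairs:
  fixes X :: "nat \<Rightarrow> 'w \<Rightarrow> 'b" and E :: "nat \<Rightarrow> ('b \<times> 'b) set" and h :: "nat \<Rightarrow> real"
  assumes iid: "eventually (\<lambda>n. iid_relation M X N D (E n) (h n)) sequentially"
    and lam: "(\<lambda>n. (real n)\<^sup>2 / 2 * measure (D \<Otimes>\<^sub>M D) (E n)) \<longlonglongrightarrow> l"
    and h: "(\<lambda>n. real n * h n) \<longlonglongrightarrow> 0"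
  shows "(\<lambda>n. measure M {\<omega>\<in>space M. \<forall>i j. 1 \<le> i \<longrightarrow> i < j \<longrightarrow> j \<le> n \<longrightarrow> (X i \<omega>, X j \<omega>) \<notin> E n}) \<longlonglongrightarrow> exp (- l)"
proof -
  define p where "p n = measure (D \<Otimes>\<^sub>M D) (E n)" for n
  define K where "K n = real n * (real n - 1) / 2" for n
  define a where "a n = measure M {\<omega>\<in>space M. \<forall>i j. 1 \<le> i \<longrightarrow> i < j \<longrightarrow> j \<le> n \<longrightarrow> (X i \<omega>, X j \<omega>) \<notin> E n}" for n
  have bound: "eventually (\<lambda>n. \<bar>a n - exp (- (K n * p n))\<bar> \<le> 9 * ((real n)\<^sup>2 / 2 * p n) * (real n * h n)) sequentially"
    using iid eventually_ge_at_top[of 1]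
  proof eventually_elim
    case (elim n)
    interpret I: iid_relation M X N D "E n" "h n" by (rule elim)
    have h0: "0 \<le> h n" using I.p_le I.p_nonneg by linarith
    have p: "I.p = p n" by (simp add: I.p_def p_def)
    have "{\<omega>\<in>space M. I.cnt (I.pairs n) \<omega> = 0} = {\<omega>\<in>space M. \<forall>i j. 1 \<le> i \<longrightarrow> i < j \<longrightarrow> j \<le> n \<longrightarrow> (X i \<omega>, X j \<omega>) \<notin> E n}"
    proof -
      have "finite {(i, j) \<in> I.pairs n. (X i \<omega>, X j \<omega>) \<in> E n}" for \<omega>
        by (rule finite_subset[OF _ I.finite_pairs[of n]]) auto
      then have "I.cnt (I.pairs n) \<omega> = 0 \<longleftrightarrow> {(i, j) \<in> I.pairs n. (X i \<omega>, X j \<omega>) \<in> E n} = {}" for \<omega>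
        unfolding I.cnt_def by simp
      then show ?thesis by (auto simp: I.pairs_def)
    qed
    then have "\<bar>a n - exp (- (K n * p n))\<bar> \<le> K n * ((8 * real n + 1) * p n * h n)"
      using I.poisson_bound[of n] unfolding I.card_pairs p a_def K_def by simp
    \<comment> \<open>There are at most \<open>n\<^sup>2 / 2\<close> pairs, and
      \<open>8 * n + 1 \<le> 9 * n\<close> for \<open>n \<ge> 1\<close>.\<close>
    also have "\<dots> \<le> (real n)\<^sup>2 / 2 * ((9 * real n) * p n * h n)"
    proof (intro mult_mono)
      show "K n \<le> (real n)\<^sup>2 / 2" by (simp add: K_def power2_eq_square field_simps)
    qed (use elim h0 I.p_nonneg p in \<open>auto intro!: mult_nonneg_nonneg\<close>)
    finally show ?case by (simp add: mult_ac)
  qed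
  have "(\<lambda>n. 9 * ((real n)\<^sup>2 / 2 * p n) * (real n * h n)) \<longlonglongrightarrow> 9 * l * 0"
    unfolding p_def by (intro tendsto_mult tendsto_const lam h)
  then have d0: "(\<lambda>n. a n - exp (- (K n * p n))) \<longlonglongrightarrow> 0"
    using tendsto_0_le[of "\<lambda>n. 9 * ((real n)\<^sup>2 / 2 * p n) * (real n * h n)" sequentially "\<lambda>n. a n - exp (- (K n * p n))" 1]
      bound by (simp add: eventually_mono)
  have "(\<lambda>n. (1 - 1 / real n) * ((real n)\<^sup>2 / 2 * p n)) \<longlonglongrightarrow> (1 - 0) * l"
    unfolding p_def by (intro tendsto_mult lam tendsto_diff tendsto_const lim_1_over_n)
  then have A: "(\<lambda>n. (1 - 1 / real n) * ((real n)\<^sup>2 / 2 * p n)) \<longlonglongrightarrow> l" by simp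
  have B: "(1 - 1 / real n) * ((real n)\<^sup>2 / 2 * p n) = K n * p n" for n
    by (cases "n = 0") (simp_all add: K_def power2_eq_square field_simps)
  have "(\<lambda>n. exp (- (K n * p n))) \<longlonglongrightarrow> exp (- l)"
    by (intro tendsto_exp tendsto_minus A[unfolded B])
  from tendsto_add[OF d0 this] show ?thesis by (simp add: a_def)
qed

section \<open>The normalising sequence and the limit for distant pairs\<close>

context pearson_ball begin

lemma sigma_pos: "sigma_const CARD('d) (card I0) \<beta> > 0"
proof -
  have "Gamma \<alpha> > 0" "Gamma ((e - 1) / 2 + 1) > 0" "Gamma (\<alpha> + (e - 1) / 2 + 1) > 0"
      "Gamma (\<alpha> + ((e - 1) / 2 + 1)) > 0" "Gamma (\<alpha> + (\<alpha> + (e - 1) / 2 + 1)) > 0"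
    using e_ge alpha_pos by (auto intro!: Gamma_real_pos add_pos_nonneg)
  then have "lim_const > 0" using e_ge unfolding lim_const_def Beta_def by (intro mult_pos_pos divide_pos_pos) auto
  then show ?thesis unfolding sigma_const_eq[symmetric] using CB_pos Ck_pos by simp
qed

lemma kappa_eq: "\<kappa> = (2 * real CARD('d) - real (card I0) + 4 * \<beta> + 3) / 2"
  by (simp add: \<kappa>_def \<alpha>_def d_def e_def field_simps)

lemma kappa_pos: "\<kappa> > 0" using alpha_pos e_ge by (simp add: \<kappa>_def add_pos_nonneg)

lemma b_seq_eq: "b_seq CARD('d) (card I0) \<beta> n = (sigma_const CARD('d) (card I0) \<beta> / 2) powr (1 / \<kappa>) * real n powr (2 / \<kappa>)"
  unfolding b_seq_def kappa_eq by simp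

lemma b_seq_pos: "n \<ge> 1 \<Longrightarrow> b_seq CARD('d) (card I0) \<beta> n > 0"
  using sigma_pos by (simp add: b_seq_eq)

text \<open>This identity explains the form of \<open>b_seq\<close>: if \<open>b n * s n\<close> is
  close to \<open>t\<close>, the mean number of distant pairs, about
  \<open>n\<^sup>2 / 2 * \<sigma> * s n powr \<kappa>\<close>, is close to
  \<open>t powr \<kappa>\<close>.\<close>

lemma b_seq_powr: "n \<ge> 1 \<Longrightarrow> b_seq CARD('d) (card I0) \<beta> n powr \<kappa> = sigma_const CARD('d) (card I0) \<beta> / 2 * (real n)\<^sup>2"
  using sigma_pos kappa_pos by (simp add: b_seq_eq powr_mult powr_powr)

lemma b_seq_at_top: "filterlim (b_seq CARD('d) (card I0) \<beta>) at_top sequentially"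
proof -
  have "filterlim (\<lambda>n. real n powr (2 / \<kappa>)) at_top sequentially"
  proof -
    have fl: "filterlim (\<lambda>n. exp (2 / \<kappa> * ln (real n))) at_top sequentially"
      using kappa_pos
      by (intro filterlim_compose[OF exp_at_top] filterlim_tendsto_pos_mult_at_top[OF tendsto_const]
            filterlim_compose[OF ln_at_top filterlim_real_sequentially]) auto
    have ev: "eventually (\<lambda>n. exp (2 / \<kappa> * ln (real n)) = real n powr (2 / \<kappa>)) sequentially"
      using eventually_gt_at_top[of 0] by eventually_elim (simp add: powr_def)
    show ?thesis using filterlim_cong[OF refl refl ev] fl by (rule iffD1)
  qed
  then show ?thesis
    unfolding b_seq_eq[abs_def] using sigma_pos
    by (intro filterlim_tendsto_pos_mult_at_top[OF tendsto_const]) auto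
qed

text \<open>The threshold is any sequence with \<open>b n * s n \<longlonglongrightarrow> t\<close>
  and not just \<open>t / b n\<close>, because the upper bound for the distribution function works
  with a perturbed threshold.\<close>

lemma far_pairs_limit:
  fixes X :: "nat \<Rightarrow> 'w \<Rightarrow> real ^ 'd" and s :: "nat \<Rightarrow> real"
  defines "b \<equiv> b_seq CARD('d) (card I0) \<beta>"
  assumes M: "prob_space M" and indep: "prob_space.indep_vars M (\<lambda>_. borel) X {1..}"
    and law: "\<And>i. i \<ge> 1 \<Longrightarrow> distr M borel (X i) = U_law"
    and s: "eventually (\<lambda>n. s n > 0) sequentially" and bs: "(\<lambda>n. b n * s n) \<longlonglongrightarrow> t" and t: "t \<ge> 0"
  shows "(\<lambda>n. measure M {\<omega>\<in>space M. \<forall>i j. 1 \<le> i \<longrightarrow> i < j \<longrightarrow> j \<le> n \<longrightarrow> (X i \<omega>, X j \<omega>) \<notin> far (s n)}) \<longlonglongrightarrow> exp (- (t powr \<kappa>))"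
proof -
  interpret M: prob_space M by (rule M)
  have Xm: "X i \<in> borel_measurable M" if "i \<ge> 1" for i
    using indep that unfolding M.indep_vars_def by auto
  have "prob_space U_law" using M.prob_space_distr[OF Xm[of 1]] law[of 1] by simp
  then interpret U: prob_space U_law .
  have 1: "emeasure U_law UNIV = 1" using U.emeasure_space_1 by (simp add: U_law_def)
  let ?\<sigma> = "sigma_const CARD('d) (card I0) \<beta>"
  have s0: "s \<longlonglongrightarrow> 0"
  proof -
    have "(\<lambda>n. inverse (b n) * (b n * s n)) \<longlonglongrightarrow> 0 * t"
      by (intro tendsto_mult bs tendsto_inverse_0_at_top) (simp add: b_def b_seq_at_top)
    moreover have "eventually (\<lambda>n. inverse (b n) * (b n * s n) = s n) sequentially"
      using eventually_ge_at_top[of 1] by eventually_elim (use b_seq_pos in \<open>force simp: b_def\<close>)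
    ultimately show ?thesis using Lim_transform_eventually by force
  qed
  have nsk: "(\<lambda>n. (real n)\<^sup>2 / 2 * ?\<sigma> * s n powr \<kappa>) \<longlonglongrightarrow> t powr \<kappa>"
  proof -
    have "(\<lambda>n. (b n * s n) powr \<kappa>) \<longlonglongrightarrow> t powr \<kappa>"
    proof (rule tendsto_powr2[OF bs tendsto_const _ kappa_pos])
      show "eventually (\<lambda>n. 0 \<le> b n * s n) sequentially"
        using s eventually_ge_at_top[of 1] by eventually_elim (simp add: b_def b_seq_pos less_imp_le)
    qed
    moreover have "eventually (\<lambda>n. (b n * s n) powr \<kappa> = (real n)\<^sup>2 / 2 * ?\<sigma> * s n powr \<kappa>) sequentially"
      using s eventually_ge_at_top[of 1]
    proof eventually_elim
      case (elim n)
      then show ?case using b_seq_pos[of n] b_seq_powr[of n] by (simp add: b_def powr_mult)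
    qed
    ultimately show ?thesis by (rule Lim_transform_eventually)
  qed
  obtain C where C: "C \<ge> 0" "\<And>s r. 0 < s \<Longrightarrow> s \<le> 1/8 \<Longrightarrow> 0 \<le> r \<Longrightarrow> r \<le> 1 \<Longrightarrow> slice s r \<le> ennreal (C * s powr (\<alpha> + (e - 1) / 2))"
    using slice_le by blast
  define h where "h n = C * s n powr (\<alpha> + (e - 1) / 2)" for n
  show ?thesis
  proof (rule poisson_limit_pairs)
    have "eventually (\<lambda>n. s n < 1/8) sequentially" using order_tendstoD(2)[OF s0, of "1/8"] by simp
    with s show "eventually (\<lambda>n. iid_relation M X borel U_law (far (s n)) (h n)) sequentially"
    proof eventually_elim
      case (elim n)
      show ?case
      proof (unfold_locales)
        show "M.indep_vars (\<lambda>_. borel) X {1..}" by (rule indep)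
        show "distr M borel (X i) = U_law" if "1 \<le> i" for i using law that .
        show "far (s n) \<in> sets (borel \<Otimes>\<^sub>M borel)" by (rule far_sets)
        show "(y, x) \<in> far (s n)" if "(x, y) \<in> far (s n)" for x y using far_sym that .
        fix y :: "real ^ 'd"
        have hn: "0 \<le> h n" using C by (simp add: h_def)
        show "measure U_law (Pair y -` far (s n)) \<le> h n"
        proof (cases "norm y < 1")
          case True
          have "(norm y)\<^sup>2 \<le> 1" using True by (simp add: power_le_one)
          then have "slice (s n) (Q y) \<le> ennreal (h n)"
            unfolding h_def using elim Q_nonneg Q_le_norm[of y] by (intro C) auto
          then show ?thesis
            unfolding measure_def emeasure_slice[OF True] using hn by (metis enn2real_leI)
        next
          case False
          then have "Pair y -` far (s n) = {}" by (auto simp: far_def)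
          then show ?thesis using hn by simp
        qed
      qed
    qed
    have ratio: "(\<lambda>n. measure (U_law \<Otimes>\<^sub>M U_law) (far (s n)) / s n powr \<kappa>) \<longlonglongrightarrow> ?\<sigma>"
      by (rule measure_far_asymp[OF 1 s0 s])
    have "(\<lambda>n. ((real n)\<^sup>2 / 2 * ?\<sigma> * s n powr \<kappa>) * (measure (U_law \<Otimes>\<^sub>M U_law) (far (s n)) / s n powr \<kappa>) / ?\<sigma>) \<longlonglongrightarrow> t powr \<kappa> * ?\<sigma> / ?\<sigma>"
      using sigma_pos by (intro tendsto_divide tendsto_mult nsk ratio tendsto_const) auto
    moreover have "eventually (\<lambda>n. ((real n)\<^sup>2 / 2 * ?\<sigma> * s n powr \<kappa>) * (measure (U_law \<Otimes>\<^sub>M U_law) (far (s n)) / s n powr \<kappa>) / ?\<sigma>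
       = (real n)\<^sup>2 / 2 * measure (U_law \<Otimes>\<^sub>M U_law) (far (s n))) sequentially"
      using s by eventually_elim (use sigma_pos in simp)
    ultimately show "(\<lambda>n. (real n)\<^sup>2 / 2 * measure (U_law \<Otimes>\<^sub>M U_law) (far (s n))) \<longlonglongrightarrow> t powr \<kappa>"
      using Lim_transform_eventually sigma_pos by force
    \<comment> \<open>\<open>real n * h n\<close> is \<open>C\<close> times the square root of
      \<open>n\<^sup>2 * s n powr \<kappa>\<close>, which converges, times the surplus
      \<open>s n powr ((e - 1) / 4)\<close>, which tends to 0 because \<open>e > 1\<close>.\<close>
    have "(\<lambda>n. C * sqrt (2 / ?\<sigma> * ((real n)\<^sup>2 / 2 * ?\<sigma> * s n powr \<kappa>)) * s n powr ((e - 1) / 4)) \<longlonglongrightarrow> C * sqrt (2 / ?\<sigma> * (t powr \<kappa>)) * 0"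
    proof (intro tendsto_mult tendsto_real_sqrt tendsto_const nsk)
      show "(\<lambda>n. s n powr ((e - 1) / 4)) \<longlonglongrightarrow> 0"
      proof -
        have "eventually (\<lambda>n. 0 \<le> s n) sequentially" using s by eventually_elim simp
        from tendsto_powr2[OF s0 tendsto_const this, of "(e - 1) / 4"] show ?thesis using e_ge by simp
      qed
    qed
    moreover have "eventually (\<lambda>n. C * sqrt (2 / ?\<sigma> * ((real n)\<^sup>2 / 2 * ?\<sigma> * s n powr \<kappa>)) * s n powr ((e - 1) / 4) = real n * h n) sequentially"
      using s
    proof eventually_elim
      case (elim n)
      have "2 / ?\<sigma> * ((real n)\<^sup>2 / 2 * ?\<sigma> * s n powr \<kappa>) = (real n)\<^sup>2 * s n powr \<kappa>" using sigma_pos by simp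
      moreover have "sqrt ((real n)\<^sup>2 * s n powr \<kappa>) = real n * s n powr (\<kappa> / 2)"
        using elim by (simp add: real_sqrt_mult powr_half_sqrt[symmetric] powr_powr)
      moreover have "s n powr (\<kappa> / 2) * s n powr ((e - 1) / 4) = s n powr (\<alpha> + (e - 1) / 2)"
        unfolding powr_add[symmetric] by (rule arg_cong[where f="\<lambda>x. s n powr x"]) (simp add: \<kappa>_def field_simps)
      ultimately show ?case by (simp add: h_def mult_ac)
    qed
    ultimately show "(\<lambda>n. real n * h n) \<longlonglongrightarrow> 0" using Lim_transform_eventually by force
  qed
qed

end

section \<open>The ellipsoid\<close>

text \<open>The number of unit semi-axes is called \<open>m\<close> here, since \<open>e\<close>
  denotes the same number as a real in \<open>pearson_ball\<close>.\<close>

locale ellipsoid_sample =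
  fixes \<nu> :: "'d::finite \<Rightarrow> nat" and m :: nat and a :: "nat \<Rightarrow> real" and \<beta> :: real
  assumes m: "m \<in> {2..CARD('d) - 1}" and nu: "bij_betw \<nu> UNIV {1..CARD('d)}"
    and a_lt: "a (m + 1) < 1" and a_anti: "antimono_on {m+1..CARD('d)} a" and a_pos: "a CARD('d) > 0"
    and beta': "\<beta> > -1"
begin

definition long :: "'d set" where "long = {k. \<nu> k \<le> m}"
definition kl :: 'd where "kl = (SOME k. \<nu> k = 1)"
definition sc :: "'d \<Rightarrow> real" where "sc k = (if \<nu> k \<le> m then 1 else a (\<nu> k))"

lemma nu_range: "1 \<le> \<nu> k" "\<nu> k \<le> CARD('d)"
  using bij_betwE[OF nu] by auto

lemma nu_surj: "i \<in> {1..CARD('d)} \<Longrightarrow> \<exists>k. \<nu> k = i"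
  using bij_betw_imp_surj_on[OF nu] by (metis imageE)

lemma card_long: "card long = m"
proof -
  have "\<nu> ` long = {1..m}"
  proof (intro equalityI subsetI)
    fix x assume x: "x \<in> {1..m}"
    then have "x \<in> {1..CARD('d)}" using m by auto
    then obtain k where "\<nu> k = x" using nu_surj by blast
    then show "x \<in> \<nu> ` long" using x by (auto simp: long_def)
  qed (use nu_range in \<open>auto simp: long_def\<close>)
  moreover have "inj_on \<nu> long" using nu by (auto simp: bij_betw_def inj_on_def)
  ultimately show ?thesis using card_image by fastforce
qed

lemma kl: "kl \<in> long"
proof -
  have "1 \<in> {1..CARD('d)}" using m by auto
  then have "\<exists>k. \<nu> k = 1" by (rule nu_surj)
  then have "\<nu> kl = 1" unfolding kl_def by (rule someI_ex)
  then show ?thesis using m by (auto simp: long_def)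
qed

sublocale pearson_ball long kl \<beta>
proof
  show "kl \<in> long" by (rule kl)
  show "2 \<le> card long" using m by (simp add: card_long)
  show "long \<noteq> UNIV" using m card_long by auto
  show "- 1 < \<beta>" by (rule beta')
qed

lemma a_bounds:
  assumes "m + 1 \<le> i" "i \<le> CARD('d)"
  shows "0 < a i" "a i \<le> a (m + 1)"
proof -
  have "a CARD('d) \<le> a i" "a i \<le> a (m + 1)"
    using assms a_anti by (auto simp: monotone_on_def)
  then show "0 < a i" "a i \<le> a (m + 1)" using a_pos by auto
qed

lemma a_first: "0 < a (m + 1)" using a_bounds(1)[of "m + 1"] m by auto

lemma a_first_sq: "(a (m + 1))\<^sup>2 < 1"
  using power_strict_mono[of "a (m + 1)" 1 2] a_lt a_first by simp

lemma sc_pos: "sc k > 0"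
  using a_bounds(1)[of "\<nu> k"] nu_range(2)[of k] by (auto simp: sc_def)

lemma sc_long: "k \<in> long \<Longrightarrow> sc k = 1" by (simp add: sc_def long_def)

lemma sc_le: "k \<notin> long \<Longrightarrow> sc k \<le> a (m + 1)"
  using a_bounds(2)[of "\<nu> k"] nu_range(2)[of k] by (auto simp: sc_def long_def)

section \<open>The linear map from the unit ball onto the ellipsoid\<close>

definition S :: "real ^ 'd \<Rightarrow> real ^ 'd" where "S u = (\<chi> k. sc k * u $ k)"
definition T :: "real ^ 'd \<Rightarrow> real ^ 'd" where "T z = (\<chi> k. z $ k / sc k)"

lemma T_S: "T (S u) = u" and S_T: "S (T z) = z"
  using sc_pos by (auto simp: S_def T_def vec_eq_iff less_imp_neq[symmetric])

lemma continuous_ST: "continuous_on UNIV S" "continuous_on UNIV T"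
proof -
  show "continuous_on UNIV S" unfolding S_def by (intro continuous_intros)
  show "continuous_on UNIV T" unfolding T_def using sc_pos by (intro continuous_intros) (auto simp: less_imp_neq[symmetric])
qed

lemma measurable_ST [measurable]: "S \<in> borel_measurable borel" "T \<in> borel_measurable borel"
  using continuous_ST by (auto intro: borel_measurable_continuous_onI)

lemma Basis_vec_range: "(Basis :: (real ^ 'd) set) = range (\<lambda>k. axis k 1)"
  "inj (\<lambda>k. axis k (1::real) :: real ^ 'd)"
  by (auto simp: Basis_vec_def inj_on_def axis_eq_axis)

lemma nn_integral_scale:
  assumes [measurable]: "g \<in> borel_measurable borel"
  shows "(\<integral>\<^sup>+z. g z \<partial>lborel) = ennreal (\<Prod>k\<in>UNIV. sc k) * (\<integral>\<^sup>+u. g (S u) \<partial>lborel)"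
proof -
  define c where "c = (\<lambda>j::real ^ 'd. (\<chi> k. sc k) \<bullet> j)"
  have c_axis: "c (axis k 1) = sc k" for k by (simp add: c_def inner_axis)
  have "lborel = density (distr lborel borel (\<lambda>x. 0 + (\<Sum>j\<in>Basis. (c j * (x \<bullet> j)) *\<^sub>R j))) (\<lambda>_. (\<Prod>j\<in>Basis. \<bar>c j\<bar>))"
  proof (rule lborel_affine_euclidean)
    fix j :: "real ^ 'd" assume "j \<in> Basis"
    then obtain k where "j = axis k 1" by (auto simp: Basis_vec_range)
    then show "c j \<noteq> 0" using sc_pos[of k] by (simp add: c_axis)
  qed
  also have "(\<lambda>x. 0 + (\<Sum>j\<in>Basis. (c j * (x \<bullet> j)) *\<^sub>R j)) = S"
  proof
    fix x :: "real ^ 'd"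
    have "(\<Sum>j\<in>Basis. (c j * (x \<bullet> j)) *\<^sub>R j) = (\<Sum>k\<in>UNIV. (sc k * x $ k) *\<^sub>R axis k 1)"
      unfolding Basis_vec_range(1) by (subst sum.reindex[OF Basis_vec_range(2)]) (simp add: c_axis inner_axis)
    also have "\<dots> = S x"
      by (simp add: vec_eq_iff S_def axis_def if_distrib cong: if_cong)
    finally show "0 + (\<Sum>j\<in>Basis. (c j * (x \<bullet> j)) *\<^sub>R j) = S x" by simp
  qed
  also have "(\<Prod>j\<in>Basis. \<bar>c j\<bar>) = (\<Prod>k\<in>UNIV. sc k)"
    unfolding Basis_vec_range(1) using sc_pos
    by (subst prod.reindex[OF Basis_vec_range(2)]) (simp add: c_axis abs_of_pos)
  finally have "lborel = density (distr lborel borel S) (\<lambda>_. ennreal (\<Prod>k\<in>UNIV. sc k))" .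
  then have "(\<integral>\<^sup>+z. g z \<partial>lborel) = (\<integral>\<^sup>+z. g z \<partial>density (distr lborel borel S) (\<lambda>_. ennreal (\<Prod>k\<in>UNIV. sc k)))" by simp
  also have "\<dots> = ennreal (\<Prod>k\<in>UNIV. sc k) * (\<integral>\<^sup>+u. g (S u) \<partial>lborel)"
    by (simp add: nn_integral_density nn_integral_distr nn_integral_cmult)
  finally show ?thesis .
qed

lemma norm_sq: "(norm (u :: real ^ 'd))\<^sup>2 = (\<Sum>k\<in>UNIV. (u $ k)\<^sup>2)"
  by (simp add: norm_vec_def L2_set_def sum_nonneg)

lemma Sigma_mat_mult: "(Sigma_mat \<nu> m a *v v) $ k = (sc k)\<^sup>2 * v $ k"
proof -
  have "(Sigma_mat \<nu> m a *v v) $ k = (\<Sum>l\<in>UNIV. if l = k then (sc k)\<^sup>2 * v $ k else 0)"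
    unfolding matrix_vector_mult_def Sigma_mat_def vec_lambda_beta by (rule sum.cong) (auto simp: sc_def)
  then show ?thesis by simp
qed

text \<open>\<open>matrix_inv\<close> is defined by choice, so its entries cannot be read off.
  Exhibiting the diagonal inverse \<open>A'\<close> shows that an inverse exists; the chosen matrix
  is then a right inverse, which determines its action on vectors.\<close>

lemma quadratic_form: "S u \<bullet> (matrix_inv (Sigma_mat \<nu> m a) *v S u) = (norm u)\<^sup>2"
proof -
  let ?A = "Sigma_mat \<nu> m a"
  define A' :: "real ^ 'd ^ 'd" where "A' = (\<chi> k l. if k = l then 1 / (sc k)\<^sup>2 else 0)"
  have A'v: "(A' *v v) $ k = v $ k / (sc k)\<^sup>2" for v k
  proof -
    have "(A' *v v) $ k = (\<Sum>l\<in>UNIV. if l = k then v $ k / (sc k)\<^sup>2 else 0)"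
      unfolding matrix_vector_mult_def A'_def vec_lambda_beta by (rule sum.cong) auto
    then show ?thesis by simp
  qed
  have nz: "sc k \<noteq> 0" for k using sc_pos[of k] by simp
  have "?A ** A' = mat 1" "A' ** ?A = mat 1"
    by (simp_all add: matrix_eq matrix_vector_mul_assoc[symmetric] vec_eq_iff Sigma_mat_mult A'v nz)
  then have "?A ** matrix_inv ?A = mat 1"
    unfolding matrix_inv_def by (metis (mono_tags, lifting) someI_ex)
  then have "?A *v (matrix_inv ?A *v v) = v" for v by (simp add: matrix_vector_mul_assoc)
  then have "(sc k)\<^sup>2 * (matrix_inv ?A *v v) $ k = v $ k" for v k by (metis Sigma_mat_mult)
  then have inv: "(matrix_inv ?A *v v) $ k = v $ k / (sc k)\<^sup>2" for v k
    using nz[of k] by (metis nonzero_mult_div_cancel_left power_not_zero)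
  show ?thesis
    unfolding inner_vec_def norm_sq by (intro sum.cong) (simp_all add: inv S_def nz power2_eq_square)
qed

lemma ellipsoid_iff: "S u \<in> ellipsoid \<nu> m a \<longleftrightarrow> norm u \<le> 1"
proof -
  have L: "{k. \<nu> k \<in> {1..m}} = long" using nu_range by (auto simp: long_def)
  have J: "{k. \<nu> k \<in> {m+1..CARD('d)}} = - long" using nu_range by (auto simp: long_def)
  have "(\<Sum>k\<in>long. (S u $ k)\<^sup>2) + (\<Sum>k\<in>-long. (S u $ k / a (\<nu> k))\<^sup>2) = (\<Sum>k\<in>long. (u $ k)\<^sup>2) + (\<Sum>k\<in>-long. (u $ k)\<^sup>2)"
  proof (intro arg_cong2[where f="(+)"] sum.cong refl)
    show "(S u $ k / a (\<nu> k))\<^sup>2 = (u $ k)\<^sup>2" if "k \<in> - long" for k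
      using that sc_pos[of k] by (auto simp: S_def sc_def long_def)
  qed (simp add: S_def sc_long)
  also have "\<dots> = (norm u)\<^sup>2"
    unfolding norm_sq by (subst sum.union_disjoint[symmetric]) auto
  finally show ?thesis
    unfolding ellipsoid_def mem_Collect_eq L J by (simp add: abs_square_le_1)
qed

text \<open>The preimage of the open unit ball under the continuous map \<open>T\<close> is open and
  contained in the ellipsoid. Boundary points are dealt with in
  \<open>density_scaled\<close>.\<close>

lemma interior_ellipsoid: "norm u < 1 \<Longrightarrow> S u \<in> interior (ellipsoid \<nu> m a)"
proof -
  assume u: "norm u < 1"
  have "open {z. norm (T z) < 1}"
    by (intro open_Collect_less continuous_on_norm continuous_ST continuous_on_const)
  moreover have "{z. norm (T z) < 1} \<subseteq> ellipsoid \<nu> m a"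
  proof
    fix z assume "z \<in> {z. norm (T z) < 1}"
    then show "z \<in> ellipsoid \<nu> m a" using ellipsoid_iff[of "T z"] S_T[of z] by simp
  qed
  ultimately have "{z. norm (T z) < 1} \<subseteq> interior (ellipsoid \<nu> m a)" by (rule interior_maximal[rotated])
  then show ?thesis using u by (auto simp: T_S)
qed

lemma prod_sc: "(\<Prod>k\<in>UNIV. sc k) = (\<Prod>i=m+1..CARD('d). a i)"
proof -
  have "(\<Prod>k\<in>UNIV. sc k) = (\<Prod>i\<in>{1..CARD('d)}. if i \<le> m then 1 else a i)"
    using prod.reindex_bij_betw[OF nu, of "\<lambda>i. if i \<le> m then 1 else a i"] by (simp add: sc_def)
  also have "\<dots> = (\<Prod>i=m+1..CARD('d). a i)"
    by (rule prod.mono_neutral_cong_right) auto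
  finally show ?thesis .
qed

text \<open>The Jacobian of \<open>S\<close> is the product of the semi-axes in the denominator of
  the density, and the quadratic form becomes the squared norm.\<close>

lemma density_scaled: "ennreal (\<Prod>k\<in>UNIV. sc k) * ennreal (pearson_density \<nu> m a \<beta> (S u)) = f0 u"
proof -
  define p where "p = (\<Prod>i=m+1..CARD('d). a i)"
  have pp: "p > 0" unfolding p_def by (intro prod_pos) (use a_bounds in auto)
  have pd: "pearson_density \<nu> m a \<beta> (S u) = c0 / p * (1 - (norm u)\<^sup>2) powr \<beta> * indicator (interior (ellipsoid \<nu> m a)) (S u)"
    unfolding pearson_density_def quadratic_form p_def by (simp add: c0_def d_def)
  show ?thesis
  proof (cases "norm u < 1")
    case True
    then show ?thesis using interior_ellipsoid[OF True] pp c0_pos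
      unfolding pd prod_sc p_def[symmetric] f0_def by (simp add: ennreal_mult'[symmetric])
  next
    case False
    have "pearson_density \<nu> m a \<beta> (S u) = 0"
    proof (cases "norm u = 1")
      case True
      \<comment> \<open>On the unit sphere the value is 0 because \<open>0 powr \<beta> = 0\<close>,
        also for negative \<open>\<beta>\<close>.\<close>
      then show ?thesis unfolding pd by simp
    next
      case F: False
      then have "S u \<notin> ellipsoid \<nu> m a" using False by (simp add: ellipsoid_iff)
      then have "S u \<notin> interior (ellipsoid \<nu> m a)" using interior_subset by blast
      then show ?thesis unfolding pd by simp
    qed
    then show ?thesis using False by (simp add: f0_def)
  qed
qed

lemma law_scaled:
  assumes Z: "distributed M lborel Z (\<lambda>z. ennreal (pearson_density \<nu> m a \<beta> z))"
  shows "distr M borel (\<lambda>\<omega>. T (Z \<omega>)) = U_law"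
proof (rule measure_eqI)
  show "sets (distr M borel (\<lambda>\<omega>. T (Z \<omega>))) = sets U_law" by (simp add: sets_U_law)
  fix A assume "A \<in> sets (distr M borel (\<lambda>\<omega>. T (Z \<omega>)))"
  then have A [measurable]: "A \<in> sets borel" by simp
  have Zm [measurable]: "Z \<in> borel_measurable M" using distributed_measurable[OF Z] by simp
  have fm [measurable]: "(\<lambda>z. ennreal (pearson_density \<nu> m a \<beta> z)) \<in> borel_measurable borel"
    using distributed_borel_measurable[OF Z] by simp
  have [measurable]: "T -` A \<in> sets borel" using measurable_sets[OF measurable_ST(2) A] by simp
  have "emeasure (distr M borel (\<lambda>\<omega>. T (Z \<omega>))) A = emeasure (distr M lborel Z) (T -` A)"
    by (subst (1 2) emeasure_distr) (auto intro!: arg_cong[where f="emeasure M"])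
  also have "\<dots> = (\<integral>\<^sup>+z. ennreal (pearson_density \<nu> m a \<beta> z) * indicator (T -` A) z \<partial>lborel)"
    unfolding distributed_distr_eq_density[OF Z] by (rule emeasure_density) auto
  also have "\<dots> = ennreal (\<Prod>k\<in>UNIV. sc k) * (\<integral>\<^sup>+u. ennreal (pearson_density \<nu> m a \<beta> (S u)) * indicator (T -` A) (S u) \<partial>lborel)"
    by (rule nn_integral_scale) measurable
  also have "\<dots> = (\<integral>\<^sup>+u. ennreal (\<Prod>k\<in>UNIV. sc k) * (ennreal (pearson_density \<nu> m a \<beta> (S u)) * indicator (T -` A) (S u)) \<partial>lborel)"
    by (rule nn_integral_cmult[symmetric]) measurable
  also have "\<dots> = (\<integral>\<^sup>+u. f0 u * indicator A u \<partial>lborel)"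
    by (intro nn_integral_cong) (simp add: density_scaled[symmetric] mult.assoc T_S indicator_def)
  also have "\<dots> = emeasure U_law A"
    unfolding U_law_def by (rule emeasure_density[symmetric]) auto
  finally show "emeasure (distr M borel (\<lambda>\<omega>. T (Z \<omega>))) A = emeasure U_law A" .
qed

text \<open>\<open>S\<close> fixes the long coordinates, and the short ones only add to the
  norm.\<close>

lemma norm_S_diff_ge: "Q (u - v) \<le> (norm (S u - S v))\<^sup>2"
proof -
  have "Q (u - v) = (\<Sum>k\<in>long. ((S u - S v) $ k)\<^sup>2)"
    unfolding Q_def by (intro sum.cong) (auto simp: S_def sc_long)
  also have "\<dots> \<le> (norm (S u - S v))\<^sup>2" unfolding norm_sq by (intro sum_mono2) auto
  finally show ?thesis .
qed

text \<open>\<open>S\<close> multiplies each short coordinate by at most \<open>a (m + 1)\<close>,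
  and two points of the unit ball have squared distance at most 4. With
  \<open>A = (a (m + 1))\<^sup>2\<close>, the squared distance of the images is thus at most
  \<open>Q (u - v) + A * (4 - Q (u - v))\<close>.\<close>

lemma norm_S_diff_le:
  assumes "norm u \<le> 1" "norm v \<le> 1"
  shows "(1 - (a (m + 1))\<^sup>2) * (4 - Q (u - v)) \<le> 4 - (norm (S u - S v))\<^sup>2"
proof -
  let ?A = "(a (m + 1))\<^sup>2" let ?w = "u - v"
  have spl: "(\<Sum>k\<in>UNIV. f k) = (\<Sum>k\<in>long. f k) + (\<Sum>k\<in>-long. f k)" for f :: "'d \<Rightarrow> real"
    by (subst sum.union_disjoint[symmetric]) auto
  have "(norm (S u - S v))\<^sup>2 = (\<Sum>k\<in>long. ((S u - S v) $ k)\<^sup>2) + (\<Sum>k\<in>-long. ((S u - S v) $ k)\<^sup>2)"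
    unfolding norm_sq by (rule spl)
  also have "(\<Sum>k\<in>long. ((S u - S v) $ k)\<^sup>2) = Q ?w"
    unfolding Q_def by (intro sum.cong) (auto simp: S_def sc_long)
  also have "(\<Sum>k\<in>-long. ((S u - S v) $ k)\<^sup>2) \<le> (\<Sum>k\<in>-long. ?A * (?w $ k)\<^sup>2)"
  proof (intro sum_mono)
    fix k assume "k \<in> - long"
    then have "(sc k)\<^sup>2 \<le> ?A" using sc_le[of k] sc_pos[of k] by (intro power_mono) auto
    moreover have "((S u - S v) $ k)\<^sup>2 = (sc k)\<^sup>2 * (?w $ k)\<^sup>2"
      by (simp add: S_def power_mult_distrib[symmetric] algebra_simps)
    ultimately show "((S u - S v) $ k)\<^sup>2 \<le> ?A * (?w $ k)\<^sup>2" by (simp add: mult_right_mono)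
  qed
  also have "(\<Sum>k\<in>-long. ?A * (?w $ k)\<^sup>2) = ?A * ((norm ?w)\<^sup>2 - Q ?w)"
    unfolding norm_sq spl[of "\<lambda>k. (?w $ k)\<^sup>2"] Q_def by (simp add: sum_distrib_left)
  also have "\<dots> \<le> ?A * (4 - Q ?w)"
  proof (intro mult_left_mono diff_right_mono)
    have "norm ?w \<le> 2" using norm_triangle_ineq4[of u v] assms by linarith
    then have "(norm ?w)\<^sup>2 \<le> 2\<^sup>2" by (intro power_mono) auto
    then show "(norm ?w)\<^sup>2 \<le> 4" by simp
  qed simp
  finally have "(norm (S u - S v))\<^sup>2 \<le> Q ?w + ?A * (4 - Q ?w)" by simp
  then show ?thesis by (simp add: algebra_simps)
qed

section \<open>The maximal distance as a random variable\<close>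

lemma Collect_pairs_eq_image:
  "{f i j | i j. i \<in> I \<and> j \<in> I} = (\<lambda>p. f (fst p) (snd p)) ` (I \<times> I)"
  by force

lemma max_dist_ge:
  fixes Z :: "nat \<Rightarrow> 'w \<Rightarrow> real ^ 'd"
  assumes "i \<in> {1..n}" "j \<in> {1..n}"
  shows "norm (Z i \<omega> - Z j \<omega>) \<le> max_dist Z n \<omega>"
proof -
  have "norm (Z i \<omega> - Z j \<omega>) \<in> {norm (Z i \<omega> - Z j \<omega>) | i j. i \<in> {1..n} \<and> j \<in> {1..n}}"
    using assms by blast
  then show ?thesis
    unfolding max_dist_def Collect_pairs_eq_image by (intro Max_ge) auto
qed

lemma max_dist_attained:
  fixes Z :: "nat \<Rightarrow> 'w \<Rightarrow> real ^ 'd"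
  assumes "n \<ge> 1"
  shows "\<exists>i\<in>{1..n}. \<exists>j\<in>{1..n}. max_dist Z n \<omega> = norm (Z i \<omega> - Z j \<omega>)"
proof -
  let ?D = "{norm (Z i \<omega> - Z j \<omega>) | i j. i \<in> {1..n} \<and> j \<in> {1..n}}"
  have "finite ?D" "?D \<noteq> {}" unfolding Collect_pairs_eq_image using assms by auto
  then have "Max ?D \<in> ?D" by (rule Max_in)
  then show ?thesis unfolding max_dist_def by blast
qed

lemma measurable_max_dist:
  fixes Z :: "nat \<Rightarrow> 'w \<Rightarrow> real ^ 'd"
  assumes "\<And>i. i \<ge> 1 \<Longrightarrow> Z i \<in> borel_measurable M"
  shows "(\<lambda>\<omega>. max_dist Z n \<omega>) \<in> borel_measurable M"
proof -
  have "(\<lambda>\<omega>. norm (Z (fst p) \<omega> - Z (snd p) \<omega>)) \<in> borel_measurable M" if "p \<in> {1..n} \<times> {1..n}" for p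
  proof -
    have [measurable]: "Z (fst p) \<in> borel_measurable M" "Z (snd p) \<in> borel_measurable M"
      using that by (auto intro: assms)
    show ?thesis by measurable
  qed
  then show ?thesis
    unfolding max_dist_def Collect_pairs_eq_image by (intro borel_measurable_Max) auto
qed

lemma AE_U_law_norm: "AE u in U_law. norm u < 1"
  unfolding U_law_def by (subst AE_density) (auto simp: f0_def indicator_def)

section \<open>The sample and both bounds on the distribution function\<close>

context
  fixes M :: "'w measure" and Z :: "nat \<Rightarrow> 'w \<Rightarrow> real ^ 'd" and t :: real
  assumes prob: "prob_space M" and indep: "prob_space.indep_vars M (\<lambda>_. borel) Z {1..}"
    and dens: "\<And>i. i \<ge> 1 \<Longrightarrow> distributed M lborel (Z i) (\<lambda>z. ennreal (pearson_density \<nu> m a \<beta> z))"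
    and t: "t \<ge> 0"
begin

interpretation M: prob_space M by (rule prob)

abbreviation "b \<equiv> b_seq CARD('d) (card long) \<beta>"

definition X :: "nat \<Rightarrow> 'w \<Rightarrow> real ^ 'd" where "X i \<omega> = T (Z i \<omega>)"

definition no_far :: "real \<Rightarrow> nat \<Rightarrow> 'w set" where
  "no_far s n = {\<omega>\<in>space M. \<forall>i j. 1 \<le> i \<longrightarrow> i < j \<longrightarrow> j \<le> n \<longrightarrow> (X i \<omega>, X j \<omega>) \<notin> far s}"

lemma Z_measurable: "i \<ge> 1 \<Longrightarrow> Z i \<in> borel_measurable M"
  using indep unfolding M.indep_vars_def by auto

lemma X_measurable: "i \<ge> 1 \<Longrightarrow> X i \<in> borel_measurable M"
  unfolding X_def using measurable_compose[OF Z_measurable measurable_ST(2)] by simp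

lemma S_X: "S (X i \<omega>) = Z i \<omega>" by (simp add: X_def S_T)

lemma X_law: "i \<ge> 1 \<Longrightarrow> distr M borel (X i) = U_law"
  unfolding X_def using law_scaled[OF dens] by simp

lemma X_indep: "M.indep_vars (\<lambda>_. borel) X {1..}"
proof -
  have "M.indep_vars (\<lambda>_. borel) (\<lambda>i. T \<circ> Z i) {1..}"
    by (rule M.indep_vars_compose[OF indep]) (rule measurable_ST)
  moreover have "(\<lambda>i. T \<circ> Z i) = X" by (intro ext) (simp add: X_def)
  ultimately show ?thesis by simp
qed

text \<open>\<open>far\<close> asks for points in the open ball. The sample lies there almost
  surely, so the comparison in \<open>near_upper\<close> that produces a distant pair holds almost
  surely.\<close>

lemma AE_X_norm: "AE \<omega> in M. \<forall>i\<ge>1. norm (X i \<omega>) < 1"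
proof -
  have "AE \<omega> in M. norm (X i \<omega>) < 1" if i: "i \<ge> 1" for i
  proof -
    have "AE u in distr M borel (X i). norm u < 1" unfolding X_law[OF i] by (rule AE_U_law_norm)
    then show ?thesis by (subst (asm) AE_distr_iff[OF X_measurable[OF i]]) auto
  qed
  then have "AE \<omega> in M. i \<ge> 1 \<longrightarrow> norm (X i \<omega>) < 1" for i by (cases "i \<ge> 1") auto
  then show ?thesis by (simp add: AE_all_countable)
qed

lemma no_far_sets: "no_far s n \<in> sets M"
proof -
  have "{\<omega>\<in>space M. 1 \<le> i \<longrightarrow> i < j \<longrightarrow> j \<le> n \<longrightarrow> (X i \<omega>, X j \<omega>) \<notin> far s} \<in> sets M" for i j
  proof (cases "1 \<le> i \<and> i < j \<and> j \<le> n")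
    case True
    then have "(\<lambda>\<omega>. (X i \<omega>, X j \<omega>)) -` far s \<inter> space M \<in> sets M"
      by (intro measurable_sets[OF measurable_Pair[OF X_measurable X_measurable] far_sets]) auto
    then have "space M - ((\<lambda>\<omega>. (X i \<omega>, X j \<omega>)) -` far s \<inter> space M) \<in> sets M" by (rule sets.compl_sets)
    moreover have "space M - ((\<lambda>\<omega>. (X i \<omega>, X j \<omega>)) -` far s \<inter> space M)
      = {\<omega>\<in>space M. 1 \<le> i \<longrightarrow> i < j \<longrightarrow> j \<le> n \<longrightarrow> (X i \<omega>, X j \<omega>) \<notin> far s}" using True by auto
    ultimately show ?thesis by (simp only:)
  next
    case False
    then have "{\<omega>\<in>space M. 1 \<le> i \<longrightarrow> i < j \<longrightarrow> j \<le> n \<longrightarrow> (X i \<omega>, X j \<omega>) \<notin> far s} = space M" by auto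
    then show ?thesis by simp
  qed
  then show ?thesis unfolding no_far_def by (intro sets.sets_Collect_countable_All)
qed

lemma no_far_limit:
  assumes "eventually (\<lambda>n. s n > 0) sequentially" "(\<lambda>n. b n * s n) \<longlonglongrightarrow> u" "u \<ge> 0"
  shows "(\<lambda>n. ereal (1 - measure M (no_far (s n) n))) \<longlonglongrightarrow> ereal (1 - exp (- (u powr \<kappa>)))"
  using far_pairs_limit[OF prob X_indep X_law assms]
  by (intro tendsto_ereal tendsto_diff tendsto_const) (simp add: no_far_def)

abbreviation "near n \<equiv> {\<omega> \<in> space M. b n * (2 - max_dist Z n \<omega>) \<le> t}"

lemma near_sets: "near n \<in> sets M"
proof -
  have [measurable]: "(\<lambda>\<omega>. max_dist Z n \<omega>) \<in> borel_measurable M" by (rule measurable_max_dist[OF Z_measurable])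
  show ?thesis by measurable
qed

text \<open>A pair at projected distance at least \<open>2 - s\<close> is at least that far apart in
  the ellipsoid, so a single such pair lifts \<open>max_dist\<close> to \<open>2 - s\<close> or
  more.\<close>

lemma near_lower:
  assumes n: "n \<ge> 1" and s: "0 \<le> s" "s \<le> 2" "b n * s \<le> t"
  shows "1 - measure M (no_far s n) \<le> measure M (near n)"
proof -
  have "space M - no_far s n \<subseteq> near n"
  proof
    fix \<omega> assume "\<omega> \<in> space M - no_far s n"
    then obtain i j where w: "\<omega> \<in> space M" and ij: "1 \<le> i" "i < j" "j \<le> n" and far: "(X i \<omega>, X j \<omega>) \<in> far s"
      by (auto simp: no_far_def)
    have "(2 - s)\<^sup>2 \<le> (norm (Z i \<omega> - Z j \<omega>))\<^sup>2"
      using far norm_S_diff_ge[of "X i \<omega>" "X j \<omega>"] by (auto simp: far_def S_X)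
    then have "2 - s \<le> norm (Z i \<omega> - Z j \<omega>)" by (rule power2_le_imp_le) simp
    also have "\<dots> \<le> max_dist Z n \<omega>" using ij by (intro max_dist_ge) auto
    finally have "b n * (2 - max_dist Z n \<omega>) \<le> b n * s"
      using b_seq_pos[OF n] by (intro mult_left_mono) auto
    then show "\<omega> \<in> near n" using w s(3) by auto
  qed
  then have "measure M (space M - no_far s n) \<le> measure M (near n)"
    by (intro M.finite_measure_mono near_sets)
  then show ?thesis using M.prob_compl[OF no_far_sets] by simp
qed

text \<open>The correction \<open>r\<^sup>2\<close> makes \<open>(2 - (r + r\<^sup>2))\<^sup>2 \<le> 4 - 4 * r\<close>.\<close>

lemma near_upper:
  defines "A \<equiv> (a (m + 1))\<^sup>2"
  assumes n: "n \<ge> 1" and r: "t / (1 - A) \<le> b n * r" "0 < r" "r \<le> 1/2"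
  shows "measure M (near n) \<le> 1 - measure M (no_far (r + r\<^sup>2) n)"
proof -
  define s where "s = r + r\<^sup>2"
  have A: "0 \<le> A" "A < 1" using a_first_sq by (simp_all add: A_def)
  have r2: "r\<^sup>2 \<le> r * (1/2)" unfolding power2_eq_square using r by (intro mult_left_mono) auto
  have s2: "s < 2" using r r2 by (simp add: s_def)
  have bn: "b n > 0" by (rule b_seq_pos[OF n])
  have sq: "(2 - s)\<^sup>2 \<le> 4 - 4 * r"
  proof -
    have "s \<le> 2 * r" using r2 r by (simp add: s_def)
    then have "s\<^sup>2 \<le> (2 * r)\<^sup>2" using r by (intro power_mono) (auto simp: s_def)
    then have "s\<^sup>2 \<le> 4 * r\<^sup>2" by (simp add: power_mult_distrib)
    moreover have "(2 - s)\<^sup>2 = 4 - 4 * s + s\<^sup>2" by (simp add: power2_eq_square algebra_simps)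
    ultimately show ?thesis by (simp add: s_def)
  qed
  have "AE \<omega> in M. \<omega> \<in> near n \<longrightarrow> \<omega> \<in> space M - no_far s n"
    using AE_X_norm
  proof eventually_elim
    case (elim \<omega>)
    show ?case
    proof
      assume w: "\<omega> \<in> near n"
      obtain i j where ij: "i \<in> {1..n}" "j \<in> {1..n}" and mx: "max_dist Z n \<omega> = norm (Z i \<omega> - Z j \<omega>)"
        using max_dist_attained[OF n, of Z \<omega>] by (elim bexE)
      have nrm: "norm (X i \<omega>) < 1" "norm (X j \<omega>) < 1" using elim ij by auto
      define N where "N = norm (Z i \<omega> - Z j \<omega>)"
      define q where "q = Q (X i \<omega> - X j \<omega>)"
      have "b n * (2 - N) \<le> t" using w mx by (simp add: N_def)
      also have "t \<le> (1 - A) * (b n * r)" using r(1) A by (simp add: field_simps)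
      finally have N: "2 - N \<le> (1 - A) * r" using bn by (simp add: mult_ac)
      \<comment> \<open>Equivalent to \<open>(2 - N)\<^sup>2 \<ge> 0\<close>; it passes from
        distances to squared distances without loss in the leading order.\<close>
      have "4 - N\<^sup>2 \<le> 4 * (2 - N)"
        using zero_le_power2[of "2 - N"] by (simp add: power2_eq_square algebra_simps)
      moreover have "(1 - A) * (4 - q) \<le> 4 - N\<^sup>2"
        using norm_S_diff_le[of "X i \<omega>" "X j \<omega>"] nrm by (simp add: S_X N_def q_def A_def)
      ultimately have "(1 - A) * (4 - q) \<le> (1 - A) * (4 * r)" using N by simp
      then have "4 - q \<le> 4 * r" using A by simp
      then have q: "(2 - s)\<^sup>2 \<le> q" using sq by simp
      then have far: "(X i \<omega>, X j \<omega>) \<in> far s" using nrm by (simp add: far_def q_def)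
      \<comment> \<open>The maximum also runs over \<open>i = j\<close>. Such a pair has distance 0
        and is excluded by \<open>s < 2\<close>.\<close>
      have "i \<noteq> j"
      proof
        assume "i = j"
        then have "q = 0" by (simp add: q_def Q_def)
        moreover have "(2 - s)\<^sup>2 > 0" using s2 by simp
        ultimately show False using q by simp
      qed
      then have "i < j \<or> j < i" by auto
      then have "\<omega> \<notin> no_far s n"
        using far far_sym[OF far] ij unfolding no_far_def by auto
      then show "\<omega> \<in> space M - no_far s n" using w by simp
    qed
  qed
  then have "measure M (near n) \<le> measure M (space M - no_far s n)"
    by (intro M.finite_measure_mono_AE) (use no_far_sets in auto)
  then show ?thesis using M.prob_compl[OF no_far_sets] by (simp add: s_def)
qed

lemma G_fun_eq: "G_fun CARD('d) (card long) \<beta> u = 1 - exp (- (u powr \<kappa>))"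
  by (simp add: G_fun_def kappa_eq)

lemma liminf_near: "ereal (G_fun CARD('d) (card long) \<beta> t) \<le> liminf (\<lambda>n. ereal (measure M (near n)))"
proof (cases "t = 0")
  \<comment> \<open>At \<open>t = 0\<close> the lower bound is 0, as
    \<open>0 powr \<kappa> = 0\<close>; the threshold \<open>t / b n\<close> used below would not be
    positive.\<close>
  case True
  then show ?thesis by (auto simp: G_fun_eq intro!: Liminf_bounded)
next
  case False
  define s where "s n = t / b n" for n
  have inv0: "(\<lambda>n. inverse (b n)) \<longlonglongrightarrow> 0" by (rule tendsto_inverse_0_at_top[OF b_seq_at_top])
  have s0: "s \<longlonglongrightarrow> 0" using tendsto_mult[OF tendsto_const[of t] inv0] by (simp add: s_def[abs_def] divide_inverse)
  have ev: "eventually (\<lambda>n. n \<ge> 1 \<and> s n > 0 \<and> b n * s n = t) sequentially"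
    using eventually_ge_at_top[of 1]
    by eventually_elim (use t False b_seq_pos in \<open>auto simp: s_def less_imp_neq[symmetric]\<close>)
  have "(\<lambda>n. ereal (1 - measure M (no_far (s n) n))) \<longlonglongrightarrow> ereal (1 - exp (- (t powr \<kappa>)))"
  proof (rule no_far_limit)
    show "eventually (\<lambda>n. s n > 0) sequentially" using ev by eventually_elim simp
    show "(\<lambda>n. b n * s n) \<longlonglongrightarrow> t"
      by (rule Lim_transform_eventually[OF tendsto_const]) (use ev in eventually_elim, simp)
  qed (rule t)
  then have "ereal (G_fun CARD('d) (card long) \<beta> t) = liminf (\<lambda>n. ereal (1 - measure M (no_far (s n) n)))"
    unfolding G_fun_eq by (rule lim_imp_Liminf[OF sequentially_bot, symmetric])
  also have "\<dots> \<le> liminf (\<lambda>n. ereal (measure M (near n)))"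
  proof (rule Liminf_mono)
    have "eventually (\<lambda>n. s n < 2) sequentially" using order_tendstoD(2)[OF s0, of 2] by simp
    with ev show "eventually (\<lambda>n. ereal (1 - measure M (no_far (s n) n)) \<le> ereal (measure M (near n))) sequentially"
      by eventually_elim (use near_lower in \<open>simp add: less_imp_le\<close>)
  qed
  finally show ?thesis .
qed

lemma limsup_near:
  "limsup (\<lambda>n. ereal (measure M (near n))) \<le> ereal (G_fun CARD('d) (card long) \<beta> (t / (1 - (a (m + 1))\<^sup>2)))"
proof -
  define u where "u = t / (1 - (a (m + 1))\<^sup>2)"
  have u: "u \<ge> 0" using t a_first_sq by (simp add: u_def)
  \<comment> \<open>The summand \<open>1 / real n\<close> keeps \<open>r n\<close> positive for
    \<open>n \<ge> 1\<close> even if \<open>u = 0\<close>, and it does not change the limit.\<close>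
  define r where "r n = (u + 1 / real n) / b n" for n
  define s where "s n = r n + (r n)\<^sup>2" for n
  have inv0: "(\<lambda>n. inverse (b n)) \<longlonglongrightarrow> 0" by (rule tendsto_inverse_0_at_top[OF b_seq_at_top])
  have u1: "(\<lambda>n. u + 1 / real n) \<longlonglongrightarrow> u"
    using tendsto_add[OF tendsto_const[of u] lim_1_over_n] by simp
  have r0: "r \<longlonglongrightarrow> 0" using tendsto_mult[OF u1 inv0] by (simp add: r_def[abs_def] divide_inverse)
  have ev: "eventually (\<lambda>n. n \<ge> 1 \<and> r n > 0 \<and> b n * r n = u + 1 / real n) sequentially"
    using eventually_ge_at_top[of 1]
  proof eventually_elim
    case (elim n)
    have "u + 1 / real n > 0" using u elim by (intro add_nonneg_pos) auto
    then show ?case using elim b_seq_pos[OF elim] by (simp add: r_def)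
  qed
  have lim: "(\<lambda>n. ereal (1 - measure M (no_far (s n) n))) \<longlonglongrightarrow> ereal (1 - exp (- (u powr \<kappa>)))"
  proof (rule no_far_limit)
    show "eventually (\<lambda>n. s n > 0) sequentially"
      using ev by eventually_elim (simp add: s_def add_pos_pos)
    \<comment> \<open>Since \<open>b n * s n = (b n * r n) * (1 + r n)\<close>, the quadratic
      correction in \<open>s\<close> disappears in the limit.\<close>
    have "(\<lambda>n. (u + 1 / real n) * (1 + r n)) \<longlonglongrightarrow> u * (1 + 0)"
      by (intro tendsto_mult u1 tendsto_add tendsto_const r0)
    moreover have "eventually (\<lambda>n. (u + 1 / real n) * (1 + r n) = b n * s n) sequentially"
      using ev
    proof eventually_elim
      case (elim n)
      have "b n * s n = (b n * r n) * (1 + r n)" by (simp add: s_def power2_eq_square algebra_simps)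
      then show ?case using elim by simp
    qed
    ultimately show "(\<lambda>n. b n * s n) \<longlonglongrightarrow> u" using Lim_transform_eventually by force
  qed (rule u)
  have "limsup (\<lambda>n. ereal (measure M (near n))) \<le> limsup (\<lambda>n. ereal (1 - measure M (no_far (s n) n)))"
  proof (rule Limsup_mono)
    have "eventually (\<lambda>n. r n < 1/2) sequentially" using order_tendstoD(2)[OF r0, of "1/2"] by simp
    with ev show "eventually (\<lambda>n. ereal (measure M (near n)) \<le> ereal (1 - measure M (no_far (s n) n))) sequentially"
    proof eventually_elim
      case (elim n)
      have "t / (1 - (a (m + 1))\<^sup>2) \<le> b n * r n" unfolding u_def[symmetric] using elim by simp
      then have "measure M (near n) \<le> 1 - measure M (no_far (r n + (r n)\<^sup>2) n)"
        using elim by (intro near_upper) auto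
      then show ?case by (simp add: s_def)
    qed
  qed
  also have "\<dots> = ereal (G_fun CARD('d) (card long) \<beta> u)"
    unfolding G_fun_eq by (rule lim_imp_Limsup[OF sequentially_bot lim])
  finally show ?thesis by (simp add: u_def)
qed

end

end

theorem theorem7:
  fixes P :: "'w measure"
    and Z :: "nat \<Rightarrow> 'w \<Rightarrow> real ^ 'd::finite"
    and \<nu> :: "'d \<Rightarrow> nat"
    and d e :: nat
    and a :: "nat \<Rightarrow> real"
    and \<beta> t :: real
  assumes "d = CARD('d)"
    and "d \<ge> 3"
    and "e \<in> {2..d - 1}"
    and "bij_betw \<nu> UNIV {1..d}"
    and "1 > a (e + 1)"
    and "antimono_on {e+1..d} a"
    and "a d > 0"
    and "\<beta> > -1"
    and "prob_space P"
    and "prob_space.indep_vars P (\<lambda>_. borel) Z {1..}"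
    and "\<forall>i\<ge>1. distributed P lborel (Z i) (\<lambda>z. ennreal (pearson_density \<nu> e a \<beta> z))"
    and "t \<ge> 0"
  shows "ereal (G_fun d e \<beta> t)
           \<le> liminf (\<lambda>n. ereal (measure P {\<omega> \<in> space P. b_seq d e \<beta> n * (2 - max_dist Z n \<omega>) \<le> t}))
       \<and> liminf (\<lambda>n. ereal (measure P {\<omega> \<in> space P. b_seq d e \<beta> n * (2 - max_dist Z n \<omega>) \<le> t}))
           \<le> limsup (\<lambda>n. ereal (measure P {\<omega> \<in> space P. b_seq d e \<beta> n * (2 - max_dist Z n \<omega>) \<le> t}))
       \<and> limsup (\<lambda>n. ereal (measure P {\<omega> \<in> space P. b_seq d e \<beta> n * (2 - max_dist Z n \<omega>) \<le> t}))
           \<le> ereal (G_fun d e \<beta> (t / (1 - (a (e + 1))\<^sup>2)))"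
proof -
  interpret ellipsoid_sample \<nu> e a \<beta>
    using assms by unfold_locales auto
  have "distributed P lborel (Z i) (\<lambda>z. ennreal (pearson_density \<nu> e a \<beta> z))" if "i \<ge> 1" for i
    using assms(11) that by blast
  note bounds = liminf_near[OF assms(9,10) this assms(12)] limsup_near[OF assms(9,10) this assms(12)]
  show ?thesis
    using bounds Liminf_le_Limsup[OF sequentially_bot] unfolding card_long assms(1) by auto
qed

end
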